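(* For every infinite cardinal $\kappa$ there are $2^\kappa$ pairwise non-isomorphic Boolean algebras of size $\kappa$ each of which is tightly $\sigma$-filtered and satisfies the countable chain condition (c.c.c.).
   Context: For Boolean algebras $A\leq B$ and $b\in B$, $A\restriction b:=\{a\in A:a\leq b\}$, an ideal of $A$. $A$ is a $\sigma$-subalgebra of $B$, written $A\leq_\sigma B$, if $A\leq B$ and for every $b\in B$ the ideal $A\restriction b$ is countably generated. For an ordinal $\delta$, a sequence $(A_\alpha)_{\alpha<\delta}$ of subalgebras of $A$ is a filtration of $A$ if $\bigcup_{\alpha<\delta}A_\alpha=A$, $A_\alpha\leq A_\beta$ for $\alpha<\beta<\delta$, and $A_\beta=\bigcup_{\alpha<\beta}A_\alpha$ for every limit $\beta<\delta$. A filtration is tight if there is a sequence $(x_\alpha)_{\alpha<\delta}$ in $A$ with $A_\beta=\langle\{x_\alpha:\alpha<\beta\}\rangle$ (the generated subalgebra) for all $\beta<\delta$. $A$ is tightly $\sigma$-filtered if it has a tight filtration $(A_\alpha)_{\alpha<\delta}$ with $A_\alpha\leq_\sigma A$ for all $\alpha<\delta$. *)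

theory Defs
  imports "HOL-Algebra.Lattice" "HOL-Library.Countable_Set"
begin

unbundle cardinal_syntax

section \<open>Boolean algebras\<close>

locale boolean_lattice = bounded_lattice L for L (structure) +
  assumes meet_join_distrib:
      "\<lbrakk>x \<in> carrier L; y \<in> carrier L; z \<in> carrier L\<rbrakk>
        \<Longrightarrow> x \<sqinter> (y \<squnion> z) = (x \<sqinter> y) \<squnion> (x \<sqinter> z)"
    and complement_exists:
      "x \<in> carrier L \<Longrightarrow> \<exists>y\<in>carrier L. x \<squnion> y = \<top> \<and> x \<sqinter> y = \<bottom>"

text \<open>By distributivity the complement is unique, so the description below is
  proper in every Boolean algebra.\<close>

definition ba_compl :: "('a, 'm) gorder_scheme \<Rightarrow> 'a \<Rightarrow> 'a" where
  "ba_compl L x =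
    (THE y. y \<in> carrier L \<and> x \<squnion>\<^bsub>L\<^esub> y = \<top>\<^bsub>L\<^esub> \<and> x \<sqinter>\<^bsub>L\<^esub> y = \<bottom>\<^bsub>L\<^esub>)"

definition ba_isomorphism ::
  "('a, 'm) gorder_scheme \<Rightarrow> ('b, 'n) gorder_scheme \<Rightarrow> ('a \<Rightarrow> 'b) \<Rightarrow> bool" where
  "ba_isomorphism L M h \<longleftrightarrow>
    bij_betw h (carrier L) (carrier M) \<and>
    (\<forall>x\<in>carrier L. \<forall>y\<in>carrier L. h (x \<squnion>\<^bsub>L\<^esub> y) = h x \<squnion>\<^bsub>M\<^esub> h y) \<and>
    (\<forall>x\<in>carrier L. \<forall>y\<in>carrier L. h (x \<sqinter>\<^bsub>L\<^esub> y) = h x \<sqinter>\<^bsub>M\<^esub> h y) \<and>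
    (\<forall>x\<in>carrier L. h (ba_compl L x) = ba_compl M (h x)) \<and>
    h \<bottom>\<^bsub>L\<^esub> = \<bottom>\<^bsub>M\<^esub> \<and> h \<top>\<^bsub>L\<^esub> = \<top>\<^bsub>M\<^esub>"

definition ba_isomorphic ::
  "('a, 'm) gorder_scheme \<Rightarrow> ('b, 'n) gorder_scheme \<Rightarrow> bool" where
  "ba_isomorphic L M \<longleftrightarrow> (\<exists>h. ba_isomorphism L M h)"

definition ba_ccc :: "('a, 'm) gorder_scheme \<Rightarrow> bool" where
  "ba_ccc L \<longleftrightarrow>
    (\<forall>X. X \<subseteq> carrier L - {\<bottom>\<^bsub>L\<^esub>} \<and> pairwise (\<lambda>x y. x \<sqinter>\<^bsub>L\<^esub> y = \<bottom>\<^bsub>L\<^esub>) X \<longrightarrow> countable X)"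


section \<open>Subalgebras and ideals\<close>

text \<open>A subalgebra of \<open>L\<close> is represented by its underlying set; its operations
  are those of \<open>L\<close>.  Between two subalgebras of \<open>L\<close>, being a subalgebra is therefore
  just inclusion.\<close>

definition ba_subalgebra :: "('a, 'm) gorder_scheme \<Rightarrow> 'a set \<Rightarrow> bool" where
  "ba_subalgebra L A \<longleftrightarrow>
    A \<subseteq> carrier L \<and> \<bottom>\<^bsub>L\<^esub> \<in> A \<and> \<top>\<^bsub>L\<^esub> \<in> A \<and>
    (\<forall>x\<in>A. \<forall>y\<in>A. x \<squnion>\<^bsub>L\<^esub> y \<in> A \<and> x \<sqinter>\<^bsub>L\<^esub> y \<in> A) \<and>
    (\<forall>x\<in>A. ba_compl L x \<in> A)"

definition ba_generated :: "('a, 'm) gorder_scheme \<Rightarrow> 'a set \<Rightarrow> 'a set" where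
  "ba_generated L X = \<Inter>{A. ba_subalgebra L A \<and> X \<subseteq> A}"

text \<open>Ideals of the subalgebra \<open>A\<close> of \<open>L\<close>.\<close>

definition ba_ideal :: "('a, 'm) gorder_scheme \<Rightarrow> 'a set \<Rightarrow> 'a set \<Rightarrow> bool" where
  "ba_ideal L A I \<longleftrightarrow>
    I \<subseteq> A \<and> \<bottom>\<^bsub>L\<^esub> \<in> I \<and>
    (\<forall>x\<in>I. \<forall>y\<in>I. x \<squnion>\<^bsub>L\<^esub> y \<in> I) \<and>
    (\<forall>x\<in>I. \<forall>a\<in>A. a \<sqsubseteq>\<^bsub>L\<^esub> x \<longrightarrow> a \<in> I)"

definition ba_genideal :: "('a, 'm) gorder_scheme \<Rightarrow> 'a set \<Rightarrow> 'a set \<Rightarrow> 'a set" where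
  "ba_genideal L A C = \<Inter>{I. ba_ideal L A I \<and> C \<subseteq> I}"

definition countably_generated_ideal ::
  "('a, 'm) gorder_scheme \<Rightarrow> 'a set \<Rightarrow> 'a set \<Rightarrow> bool" where
  "countably_generated_ideal L A I \<longleftrightarrow>
    (\<exists>C. countable C \<and> C \<subseteq> A \<and> I = ba_genideal L A C)"

definition ba_restrict :: "('a, 'm) gorder_scheme \<Rightarrow> 'a set \<Rightarrow> 'a \<Rightarrow> 'a set" where
  "ba_restrict L A b = {a \<in> A. a \<sqsubseteq>\<^bsub>L\<^esub> b}"

definition sigma_subalgebra :: "('a, 'm) gorder_scheme \<Rightarrow> 'a set \<Rightarrow> bool" where
  "sigma_subalgebra L A \<longleftrightarrow>
    ba_subalgebra L A \<and>
    (\<forall>b\<in>carrier L. countably_generated_ideal L A (ba_restrict L A b))"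


section \<open>Tight filtrations\<close>

text \<open>An ordinal is represented by a well-order \<open>r\<close>: the ordinals below it are
  the elements of \<open>Field r\<close>, and \<open>underS r \<beta>\<close> is the set of those below \<open>\<beta>\<close>.
  Here 0 does not count as a limit.\<close>

definition limit_point :: "'i rel \<Rightarrow> 'i \<Rightarrow> bool" where
  "limit_point r \<beta> \<longleftrightarrow>
    underS r \<beta> \<noteq> {} \<and> (\<forall>\<alpha>\<in>underS r \<beta>. \<exists>\<gamma>\<in>underS r \<beta>. \<alpha> \<in> underS r \<gamma>)"

definition filtration ::
  "('a, 'm) gorder_scheme \<Rightarrow> 'i rel \<Rightarrow> ('i \<Rightarrow> 'a set) \<Rightarrow> bool" where
  "filtration L r F \<longleftrightarrow>
    Well_order r \<and>
    (\<forall>\<alpha>\<in>Field r. ba_subalgebra L (F \<alpha>)) \<and>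
    (\<Union>\<alpha>\<in>Field r. F \<alpha>) = carrier L \<and>
    (\<forall>\<beta>\<in>Field r. \<forall>\<alpha>\<in>underS r \<beta>. F \<alpha> \<subseteq> F \<beta>) \<and>
    (\<forall>\<beta>\<in>Field r. limit_point r \<beta> \<longrightarrow> F \<beta> = (\<Union>\<alpha>\<in>underS r \<beta>. F \<alpha>))"

definition tight_filtration ::
  "('a, 'm) gorder_scheme \<Rightarrow> 'i rel \<Rightarrow> ('i \<Rightarrow> 'a set) \<Rightarrow> bool" where
  "tight_filtration L r F \<longleftrightarrow>
    filtration L r F \<and>
    (\<exists>x. (\<forall>\<alpha>\<in>Field r. x \<alpha> \<in> carrier L) \<and>
         (\<forall>\<beta>\<in>Field r. F \<beta> = ba_generated L (x ` underS r \<beta>)))"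

text \<open>HOL cannot quantify over all types, so the length of the filtration ranges over
  the well-orders of subsets of the element type.  Nothing is lost: given a tight
  filtration of arbitrary length, keep only the indices \<open>\<alpha>\<close> with \<open>x \<alpha> \<notin> F \<alpha>\<close>; if
  these are empty or have a largest element, add one further index above them, whose
  algebra is all of \<open>L\<close>.  This is again a tight filtration, each of its members is a
  member of the old one or \<open>L\<close> itself, and its index set embeds into the carrier: the
  kept indices via \<open>x\<close>, which is injective on them and avoids bottom, and the
  additional index by sending it to bottom.\<close>

definition tightly_sigma_filtered :: "('a, 'm) gorder_scheme \<Rightarrow> bool" where
  "tightly_sigma_filtered L \<longleftrightarrow>
    (\<exists>(r :: 'a rel) F. tight_filtration L r F \<and>
       (\<forall>\<alpha>\<in>Field r. sigma_subalgebra L (F \<alpha>)))"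

end

theory Submission
  imports Defs "HOL-Algebra.Free_Abelian_Groups" "HOL-Library.Sublist"
begin

text \<open>
  For a graph \<open>E\<close> on \<open>G\<close>, let \<open>X\<close> be the compact space of all points of the power
  \<open>(\<omega> + 1)\<^sup>G\<close> whose coordinates are \<open>\<omega>\<close> off an \<open>E\<close>-independent set. If
  \<open>G\<close> carries a partial order with finite initial segments in which adjacent vertices
  are comparable, then the clopen algebra of \<open>X\<close> is c.c.c. and tightly \<open>\<sigma>\<close>-filtered:
  the generators \<open>{p. p g = k}\<close> are enumerated along the order, and a clopen set below
  \<open>a\<close> that only uses early generators can be enlarged, still below \<open>a\<close>, to one that
  only uses the early generators at the finitely many vertices below the support of \<open>a\<close>.
  An isomorphism of such algebras is a homeomorphism of the spaces. It remains to code
  \<open>2\<^sup>\<kappa>\<close> sets \<open>S\<close> by graphs on \<open>\<kappa>\<close> vertices, recoverable from the space.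

  For \<open>\<kappa> = \<omega>\<close> the space is a union of blocks, one for each \<open>n \<in> S\<close>. The \<open>n\<close>-th one
  has points of the perfect kernel that are limits of points of Cantor-Bendixson rank
  \<open>n\<close>, but not of points of higher finite rank, so \<open>S\<close> can be read off the derivatives.

  For uncountable \<open>\<kappa>\<close> take the comparability graph of the tree of strictly descending
  sequences below \<open>\<kappa>\<close> that start in \<open>S\<close>, where every node is repeated \<open>\<kappa>\<close> times. A
  homeomorphism between two such spaces respects the subalgebras over a countable label
  set \<open>Q\<close>, closed under the supports of the images of the generators. Each clopen set
  has a trace on such a subalgebra, its saturation. The germs of traces at a point
  \<open>q\<close> form a lattice whose prime elements are the sets of points that are \<open>\<omega>\<close> at a
  node \<open>t\<close> and all its predecessors, where \<open>t\<close> is a node over \<open>Q\<close> with a child outside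
  and \<open>q\<close> is \<open>\<omega>\<close> on all nodes over \<open>Q\<close> comparable with \<open>t\<close>. For \<open>q = \<omega>\<close> these are all
  nonterminal nodes over \<open>Q\<close>, so a homeomorphism yields an isomorphism of their tree onto
  a forest of nodes on the other side, which by well-foundedness preserves labels. The
  labels of the children of the root give back \<open>S \<inter> Q\<close>.
\<close>

section \<open>Clopen algebras of powers of a convergent sequence\<close>

text \<open>In a coordinate, \<open>0\<close> stands for the limit point of \<open>\<omega> + 1\<close> and \<open>Suc k\<close> for the
  isolated point \<open>k\<close>.\<close>

definition pts :: "'g set \<Rightarrow> ('g \<Rightarrow> 'g \<Rightarrow> bool) \<Rightarrow> ('g \<Rightarrow> nat) set" where
  "pts G E = {p. (\<forall>g. g \<notin> G \<longrightarrow> p g = 0) \<and> (\<forall>g h. E g h \<longrightarrow> p g = 0 \<or> p h = 0)}"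

text \<open>Agreement on \<open>F\<close> means lying in the same cylinders \<open>cyl X x\<close>
  for \<open>x\<close> in \<open>F\<close>. A test asks for an isolated value \<open>Suc k\<close>;
  finitely many tests cannot single out the limit value \<open>0\<close>.\<close>

definition agree :: "('g \<times> nat) set \<Rightarrow> ('g \<Rightarrow> nat) \<Rightarrow> ('g \<Rightarrow> nat) \<Rightarrow> bool" where
  "agree F p q \<longleftrightarrow> (\<forall>g k. (g, k) \<in> F \<longrightarrow> (p g = Suc k \<longleftrightarrow> q g = Suc k))"

text \<open>Clopen sets are encoded by a finite support of tests. For \<open>X = pts G E\<close> and
  \<open>P = G \<times> UNIV\<close> these are, by compactness, all clopen subsets of the
  space.\<close>

definition clop :: "('g \<Rightarrow> nat) set \<Rightarrow> ('g \<times> nat) set \<Rightarrow> ('g \<Rightarrow> nat) set set" where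
  "clop X P = {a. a \<subseteq> X \<and> (\<exists>F. finite F \<and> F \<subseteq> P \<and> (\<forall>p\<in>X. \<forall>q\<in>X. agree F p q \<longrightarrow> p \<in> a \<longrightarrow> q \<in> a))}"

definition cyl :: "('g \<Rightarrow> nat) set \<Rightarrow> 'g \<times> nat \<Rightarrow> ('g \<Rightarrow> nat) set" where
  "cyl X x = {p \<in> X. p (fst x) = Suc (snd x)}"

abbreviation determines :: "('g \<Rightarrow> nat) set \<Rightarrow> ('g \<times> nat) set \<Rightarrow> ('g \<Rightarrow> nat) set \<Rightarrow> bool" where
  "determines X F a \<equiv> \<forall>p\<in>X. \<forall>q\<in>X. agree F p q \<longrightarrow> (p \<in> a \<longleftrightarrow> q \<in> a)"

lemma pts_edge: "p \<in> pts G E \<Longrightarrow> E g h \<Longrightarrow> p g = 0 \<or> p h = 0"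
  by (simp add: pts_def)

lemma pts_outside: "p \<in> pts G E \<Longrightarrow> g \<notin> G \<Longrightarrow> p g = 0"
  by (simp add: pts_def)

lemma ptsI: "(\<And>g. g \<notin> G \<Longrightarrow> p g = 0) \<Longrightarrow> (\<And>g h. E g h \<Longrightarrow> p g = 0 \<or> p h = 0) \<Longrightarrow> p \<in> pts G E"
  by (simp add: pts_def)

section \<open>Boolean operations on clopen sets\<close>

lemma agree_sym: "agree F p q \<Longrightarrow> agree F q p"
  by (auto simp: agree_def)

lemma agree_refl [simp]: "agree F p p"
  by (auto simp: agree_def)

lemma agree_trans: "agree F p q \<Longrightarrow> agree F q r \<Longrightarrow> agree F p r"
  by (auto simp: agree_def)

lemma agree_mono: "agree F p q \<Longrightarrow> F' \<subseteq> F \<Longrightarrow> agree F' p q"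
  by (auto simp: agree_def)

lemma clopI:
  assumes "a \<subseteq> X" "finite F" "F \<subseteq> P"
    and "\<And>p q. p \<in> X \<Longrightarrow> q \<in> X \<Longrightarrow> agree F p q \<Longrightarrow> p \<in> a \<Longrightarrow> q \<in> a"
  shows "a \<in> clop X P"
  using assms unfolding clop_def by blast

lemma clopE:
  assumes "a \<in> clop X P"
  obtains F where "a \<subseteq> X" "finite F" "F \<subseteq> P"
    "determines X F a"
proof -
  from assms obtain F where F: "a \<subseteq> X" "finite F" "F \<subseteq> P"
    "\<forall>p\<in>X. \<forall>q\<in>X. agree F p q \<longrightarrow> p \<in> a \<longrightarrow> q \<in> a" unfolding clop_def by blast
  have "determines X F a"
  proof (intro ballI impI)
    fix p q assume "p \<in> X" "q \<in> X" "agree F p q"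
    then show "p \<in> a \<longleftrightarrow> q \<in> a" using F(4) agree_sym[of F p q] by blast
  qed
  with F(1-3) show thesis by (rule that)
qed

lemma clop_subset: "a \<in> clop X P \<Longrightarrow> a \<subseteq> X"
  by (auto simp: clop_def)

lemma clop_mono: "P \<subseteq> P' \<Longrightarrow> clop X P \<subseteq> clop X P'"
  unfolding clop_def by blast

lemma clop_empty [simp]: "{} \<in> clop X P"
  by (rule clopI[where F = "{}"]) auto

lemma clop_compl: assumes "a \<in> clop X P" shows "X - a \<in> clop X P"
proof -
  from assms obtain F where "a \<subseteq> X" "finite F" "F \<subseteq> P"
    "determines X F a" by (rule clopE)
  then show ?thesis by (intro clopI[where F = F]) blast+
qed

lemma clop_space [simp]: "X \<in> clop X P"
  using clop_compl[OF clop_empty] by simp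

lemma clop_un: assumes "a \<in> clop X P" "b \<in> clop X P" shows "a \<union> b \<in> clop X P"
proof -
  from assms(1) obtain F where F: "a \<subseteq> X" "finite F" "F \<subseteq> P"
    "determines X F a" by (rule clopE)
  from assms(2) obtain F' where F': "b \<subseteq> X" "finite F'" "F' \<subseteq> P"
    "determines X F' b" by (rule clopE)
  show ?thesis
  proof (rule clopI[where F = "F \<union> F'"])
    fix p q assume pq: "p \<in> X" "q \<in> X" "agree (F \<union> F') p q" "p \<in> a \<union> b"
    then have "agree F p q" "agree F' p q" using agree_mono[OF pq(3)] by simp_all
    then show "q \<in> a \<union> b" using pq(1,2,4) F(4) F'(4) by blast
  qed (use F(1-3) F'(1-3) in auto)
qed

lemma clop_int: assumes "a \<in> clop X P" "b \<in> clop X P" shows "a \<inter> b \<in> clop X P"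
proof -
  have "a \<inter> b = X - ((X - a) \<union> (X - b))" using assms[THEN clop_subset] by blast
  then show ?thesis using assms by (simp add: clop_compl clop_un)
qed

lemma cyl_clop [simp]: "x \<in> P \<Longrightarrow> cyl X x \<in> clop X P"
  by (rule clopI[where F = "{x}"]) (auto simp: cyl_def agree_def)

lemma clop_Inter:
  assumes "finite I" "\<And>i. i \<in> I \<Longrightarrow> a i \<in> clop X P"
  shows "{p \<in> X. \<forall>i\<in>I. p \<in> a i} \<in> clop X P"
  using assms
proof (induction I)
  case (insert i I)
  have "{p \<in> X. \<forall>j\<in>insert i I. p \<in> a j} = a i \<inter> {p \<in> X. \<forall>i\<in>I. p \<in> a i}"
    using insert.prems[of i, THEN clop_subset] by auto
  then show ?case using insert by (simp add: clop_int)
qed auto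

text \<open>A set with support \<open>insert x F\<close> is glued from two sets with support
  \<open>F\<close>, one used inside \<open>cyl X x\<close> and the other outside. So
  \<open>clop X P\<close> is generated by its cylinders.\<close>

lemma clop_induct [consumes 1, case_names empty cyl compl un]:
  assumes a: "a \<in> clop X P"
    and empty: "Q {}"
    and cyl: "\<And>x. x \<in> P \<Longrightarrow> Q (cyl X x)"
    and compl: "\<And>a. a \<in> clop X P \<Longrightarrow> Q a \<Longrightarrow> Q (X - a)"
    and un: "\<And>a b. a \<in> clop X P \<Longrightarrow> b \<in> clop X P \<Longrightarrow> Q a \<Longrightarrow> Q b \<Longrightarrow> Q (a \<union> b)"
  shows "Q a"
proof -
  have int: "Q (a \<inter> b)" if "a \<in> clop X P" "b \<in> clop X P" "Q a" "Q b" for a b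
  proof -
    have "a \<inter> b = X - ((X - a) \<union> (X - b))" using that(1,2)[THEN clop_subset] by blast
    then show ?thesis using that by (simp add: clop_compl clop_un compl un)
  qed
  have main: "a \<subseteq> X \<Longrightarrow> (\<And>p q. p \<in> X \<Longrightarrow> q \<in> X \<Longrightarrow> agree F p q \<Longrightarrow> p \<in> a \<Longrightarrow> q \<in> a) \<Longrightarrow> a \<in> clop X P \<and> Q a"
    if "finite F" "F \<subseteq> P" for F a
    using that
  proof (induction F arbitrary: a)
    case empty
    then have "a = {} \<or> a = X" by (auto simp: agree_def)
    then show ?case using assms(2) compl[of "{}"] by auto
  next
    case (insert x F)
    \<comment> \<open>\<open>a1\<close> and \<open>a2\<close> close the two halves of
      \<open>a\<close> under agreement on \<open>F\<close>. Cutting them back to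
      \<open>cyl X x\<close> and its complement recovers \<open>a\<close>, because agreement on
      \<open>F\<close> and on \<open>x\<close> together decides membership.\<close>
    define a1 where "a1 = {q \<in> X. \<exists>p \<in> a \<inter> cyl X x. agree F p q}"
    define a2 where "a2 = {q \<in> X. \<exists>p \<in> a - cyl X x. agree F p q}"
    have tr: "\<exists>p\<in>c. agree F p q'" if "\<exists>p\<in>c. agree F p q" "agree F q q'" for c q q'
      using that agree_trans[of F _ q q'] by blast
    have 1: "a1 \<in> clop X P \<and> Q a1"
      by (rule insert.IH) (use insert.prems(3) tr[of "a \<inter> cyl X x"] in \<open>simp_all add: a1_def\<close>)
    have 2: "a2 \<in> clop X P \<and> Q a2"
      by (rule insert.IH) (use insert.prems(3) tr[of "a - cyl X x"] in \<open>simp_all add: a2_def\<close>)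
    have x: "x \<in> P" using insert by auto
    have ag: "agree (insert x F) p q" if "agree F p q" "p \<in> X" "q \<in> X" "p \<in> cyl X x \<longleftrightarrow> q \<in> cyl X x" for p q
      using that by (auto simp: agree_def cyl_def)
    have aX: "a \<subseteq> X" by fact
    have eq: "a = (a1 \<inter> cyl X x) \<union> (a2 \<inter> (X - cyl X x))"
    proof (intro equalityI subsetI)
      fix q assume "q \<in> a"
      then show "q \<in> (a1 \<inter> cyl X x) \<union> (a2 \<inter> (X - cyl X x))"
        using aX agree_refl[of F q] unfolding a1_def a2_def by blast
    next
      fix q assume "q \<in> (a1 \<inter> cyl X x) \<union> (a2 \<inter> (X - cyl X x))"
      then obtain p where "p \<in> a" "q \<in> X" "p \<in> cyl X x \<longleftrightarrow> q \<in> cyl X x" "agree F p q"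
        by (auto simp: a1_def a2_def)
      then show "q \<in> a" using insert.prems(2)[of p q] ag[of p q] aX by blast
    qed
    have 3: "a1 \<inter> cyl X x \<in> clop X P \<and> Q (a1 \<inter> cyl X x)"
      using 1 x by (simp add: clop_int int cyl)
    have 4: "a2 \<inter> (X - cyl X x) \<in> clop X P \<and> Q (a2 \<inter> (X - cyl X x))"
      using 2 x by (simp add: clop_int int cyl compl clop_compl)
    show ?case by (subst (1 2) eq) (use 3 4 in \<open>simp add: un clop_un\<close>)
  qed
  obtain F where F: "a \<subseteq> X" "finite F" "F \<subseteq> P"
    "determines X F a" using a by (rule clopE)
  then show ?thesis using main[OF F(2,3,1)] by blast
qed

text \<open>A clopen set is coded by a finite support \<open>F\<close> and the finite family
  \<open>H\<close> of the patterns of true tests that its points show on \<open>F\<close>.\<close>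

lemma clop_subset_image:
  "clop X P \<subseteq> (\<lambda>(F, H). {p \<in> X. {x \<in> F. p (fst x) = Suc (snd x)} \<in> H}) ` (Fpow P \<times> Fpow (Fpow P))"
  (is "_ \<subseteq> ?f ` _")
proof
  fix a assume "a \<in> clop X P"
  then obtain F where F: "a \<subseteq> X" "finite F" "F \<subseteq> P"
    "determines X F a" by (rule clopE)
  define H where "H = (\<lambda>p. {x \<in> F. p (fst x) = Suc (snd x)}) ` a"
  have HF: "H \<subseteq> Pow F" by (auto simp: H_def)
  then have "finite H" using F(2) finite_subset by blast
  moreover have "H \<subseteq> Fpow P"
  proof
    fix h assume "h \<in> H"
    then have "h \<subseteq> F" using HF by blast
    then show "h \<in> Fpow P" using F(2,3) finite_subset[of h F] by (simp add: Fpow_def)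
  qed
  ultimately have "H \<in> Fpow (Fpow P)" by (simp add: Fpow_def)
  moreover have "F \<in> Fpow P" using F(2,3) by (simp add: Fpow_def)
  moreover have "a = ?f (F, H)"
  proof -
    have ag: "agree F p q" if "{x \<in> F. p (fst x) = Suc (snd x)} = {x \<in> F. q (fst x) = Suc (snd x)}" for p q
      using that unfolding agree_def by (auto simp: set_eq_iff)
    have "q \<in> a" if "q \<in> X" "{x \<in> F. q (fst x) = Suc (snd x)} \<in> H" for q
    proof -
      from that obtain p where p: "p \<in> a" "{x \<in> F. q (fst x) = Suc (snd x)} = {x \<in> F. p (fst x) = Suc (snd x)}"
        unfolding H_def by blast
      have "agree F p q" by (rule ag) (simp add: p(2))
      then show "q \<in> a" using p(1) that(1) F(1,4) by blast
    qed
    then show ?thesis using F(1) by (auto simp: H_def)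
  qed
  ultimately show "a \<in> ?f ` (Fpow P \<times> Fpow (Fpow P))" by blast
qed

lemma countable_clop: "countable P \<Longrightarrow> countable (clop X P)"
  using clop_subset_image[of X P] by (meson countable_SIGMA countable_image countable_subset countable_Fpow)

section \<open>Sparse graphs\<close>

text \<open>Induction on the bound \<open>n\<close>. Every other member conflicts with a fixed
  \<open>c\<close> at one of the finitely many points of \<open>D c\<close>. Sorting by such a point
  and the value there gives countably many classes; within a class this point causes no conflict, so
  it is dropped from the domains and the bound decreases.\<close>

lemma countable_pairwise_incompatible_bounded:
  fixes D :: "'a \<Rightarrow> 'g set" and f :: "'a \<Rightarrow> 'g \<Rightarrow> nat"
  assumes "\<And>a. a \<in> Y \<Longrightarrow> finite (D a) \<and> card (D a) \<le> n"
    and "\<And>a b. a \<in> Y \<Longrightarrow> b \<in> Y \<Longrightarrow> a \<noteq> b \<Longrightarrow> \<exists>g\<in>D a \<inter> D b. f a g \<noteq> f b g"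
  shows "countable Y"
  using assms
proof (induction n arbitrary: Y D)
  case 0
  have "D a = {}" if "a \<in> Y" for a using 0(1)[OF that] card_0_eq[of "D a"] by auto
  then have "a = b" if "a \<in> Y" "b \<in> Y" for a b using 0(2)[of a b] that by auto
  then have "Y = {} \<or> (\<exists>a. Y = {a})" by blast
  then show ?case by auto
next
  case (Suc n)
  show ?case
  proof (cases "Y = {}")
    case False
    then obtain c where c: "c \<in> Y" by blast
    define Z where "Z = (\<lambda>g v. {a \<in> Y. g \<in> D a \<and> f a g = v})"
    have "countable (Z g v)" for g v
    proof (rule Suc.IH[of _ "\<lambda>a. D a - {g}"])
      fix a assume "a \<in> Z g v"
      then show "finite (D a - {g}) \<and> card (D a - {g}) \<le> n"
        using Suc.prems(1)[of a] by (auto simp: Z_def)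
    next
      fix a b assume ab: "a \<in> Z g v" "b \<in> Z g v" "a \<noteq> b"
      then have "a \<in> Y" "b \<in> Y" "f a g = f b g" by (auto simp: Z_def)
      with Suc.prems(2)[of a b] ab(3) show "\<exists>h\<in>(D a - {g}) \<inter> (D b - {g}). f a h \<noteq> f b h" by auto
    qed
    then have "countable (\<Union>v. Z g v)" for g by (intro countable_UN) simp_all
    moreover have "countable (D c)" using Suc.prems(1)[OF c] by (simp add: countable_finite)
    ultimately have "countable (\<Union>g\<in>D c. \<Union>v. Z g v)" by (rule countable_UN[rotated])
    then have "countable (insert c (\<Union>g\<in>D c. \<Union>v. Z g v))" by simp
    moreover have "Y \<subseteq> insert c (\<Union>g\<in>D c. \<Union>v. Z g v)"
      using Suc.prems(2)[OF c] unfolding Z_def by blast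
    ultimately show ?thesis by (rule countable_subset[rotated])
  qed simp
qed

lemma countable_pairwise_incompatible:
  fixes D :: "'a \<Rightarrow> 'g set" and f :: "'a \<Rightarrow> 'g \<Rightarrow> nat"
  assumes "\<And>a. a \<in> Y \<Longrightarrow> finite (D a)"
    and "\<And>a b. a \<in> Y \<Longrightarrow> b \<in> Y \<Longrightarrow> a \<noteq> b \<Longrightarrow> \<exists>g\<in>D a \<inter> D b. f a g \<noteq> f b g"
  shows "countable Y"
proof -
  have "countable {a \<in> Y. card (D a) \<le> n}" for n
    by (rule countable_pairwise_incompatible_bounded[where D = D and f = f and n = n])
      (use assms in auto)
  moreover have "Y = (\<Union>n. {a \<in> Y. card (D a) \<le> n})" by auto
  moreover have "countable (\<Union>n. {a \<in> Y. card (D a) \<le> n})"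
    using calculation(1) by (intro countable_UN) simp_all
  ultimately show ?thesis by simp
qed

lemma square_eqpoll: "infinite A \<Longrightarrow> A \<times> A \<approx> A"
  by (simp add: eqpoll_iff_card_of_ordIso)

text \<open>\<open>low g\<close> is the initial segment of \<open>g\<close> in a partial order of
  the vertices. Its finiteness and the comparability of adjacent vertices yield both the chain
  condition and the interpolation of clopen sets.\<close>

locale sparse_graph =
  fixes G :: "'g set" and E :: "'g \<Rightarrow> 'g \<Rightarrow> bool" and low :: "'g \<Rightarrow> 'g set"
  assumes finite_low: "g \<in> G \<Longrightarrow> finite (low g)"
    and self_low: "g \<in> G \<Longrightarrow> g \<in> low g"
    and low_subset: "g \<in> G \<Longrightarrow> low g \<subseteq> G"
    and low_trans: "g \<in> G \<Longrightarrow> h \<in> low g \<Longrightarrow> low h \<subseteq> low g"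
    and low_antisym: "g \<in> low h \<Longrightarrow> h \<in> low g \<Longrightarrow> g = h"
    and edge_low: "g \<in> G \<Longrightarrow> h \<in> G \<Longrightarrow> E g h \<Longrightarrow> h \<in> low g \<or> g \<in> low h"
    and edge_sym: "E g h \<Longrightarrow> E h g"
    and edge_irrefl: "\<not> E g g"
begin

abbreviation "X \<equiv> pts G E"

lemma finite_UN_low: "finite F \<Longrightarrow> F \<subseteq> G \<times> K \<Longrightarrow> finite (\<Union>g\<in>fst ` F. low g)"
  using finite_low by auto

text \<open>Let \<open>D\<close> be the finite initial segment spanned by the support of
  \<open>a\<close>. The interpolant is the closure of \<open>b\<close> under agreement on finitely
  many tests from \<open>P\<close> at \<open>D\<close>. If \<open>q\<close> agrees in this way with
  \<open>p\<close> in \<open>b\<close>, the two are spliced to a point of \<open>b\<close>, hence of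
  \<open>a\<close>, that the tests for \<open>a\<close> cannot tell from \<open>q\<close>.\<close>

lemma clop_sigma_interpolant:
  assumes P: "P \<subseteq> G \<times> UNIV"
    and init: "\<And>g k g' k'. (g', k') \<in> P \<Longrightarrow> g \<in> G \<Longrightarrow> (g, k) \<notin> P \<Longrightarrow> E g g' \<Longrightarrow> g' \<in> low g"
    and a: "finite F0" "F0 \<subseteq> G \<times> UNIV"
      "determines X F0 a"
    and b: "b \<in> clop X P" "b \<subseteq> a"
  shows "\<exists>c\<in>clop X (P \<inter> ((\<Union>g\<in>fst ` F0. low g) \<times> UNIV)). b \<subseteq> c \<and> c \<subseteq> a"
proof -
  obtain F where F: "b \<subseteq> X" "finite F" "F \<subseteq> P"
    "determines X F b" using b(1) by (rule clopE)
  define D where "D = (\<Union>g\<in>fst ` F0. low g)"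
  have finD: "finite D" unfolding D_def using finite_UN_low[OF a(1,2)] .
  have DG: "D \<subseteq> G" unfolding D_def using a(2) low_subset by fastforce
  have D_low: "h \<in> D" if "g \<in> D" "h \<in> low g" for g h
  proof -
    from that(1) obtain g0 where "g0 \<in> fst ` F0" "g \<in> low g0" unfolding D_def by blast
    moreover then have "g0 \<in> G" using a(2) by auto
    ultimately show ?thesis using low_trans[of g0 g] that(2) unfolding D_def by blast
  qed
  have F0D: "g \<in> D" if "(g, k) \<in> F0" for g k
    unfolding D_def using that a(2) self_low[of g] by force
  \<comment> \<open>\<open>K\<close> bounds the values tested by the supports of \<open>a\<close>
    and \<open>b\<close>; these tests cannot tell larger values from the limit.\<close>
  define K where "K = Max (insert 0 (snd ` (F \<union> F0)))"
  have K: "k \<le> K" if "(g, k) \<in> F \<union> F0" for g k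
    unfolding K_def using that F(2) a(1) by (intro Max_ge) force+
  define R where "R = P \<inter> (D \<times> {..K})"
  define c where "c = {q \<in> X. \<exists>p\<in>b. agree R p q}"
  have "c \<in> clop X (P \<inter> (D \<times> UNIV))"
  proof (rule clopI[where F = R])
    fix p q assume "p \<in> X" "q \<in> X" "agree R p q" "p \<in> c"
    then show "q \<in> c" unfolding c_def using agree_trans[of R _ p q] by blast
  qed (use finD in \<open>auto simp: c_def R_def\<close>)
  moreover have "b \<subseteq> c" using F(1) agree_refl unfolding c_def by blast
  moreover have "c \<subseteq> a"
  proof
    fix q assume "q \<in> c"
    then obtain p where q: "q \<in> X" and p: "p \<in> b" "agree R p q" unfolding c_def by blast
    then have pX: "p \<in> X" using F(1) by blast
    \<comment> \<open>On \<open>D\<close> the splice follows \<open>q\<close>, with values beyond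
      the tested range reset to the limit; off \<open>D\<close> it keeps only those values of
      \<open>p\<close> that the support of \<open>b\<close> detects.\<close>
    define s where "s = (\<lambda>g. if g \<in> D then (if q g \<le> Suc K then q g else 0)
      else if \<exists>k. (g, k) \<in> F \<and> p g = Suc k then p g else 0)"
    \<comment> \<open>For an edge leaving \<open>D\<close> there are two cases. If \<open>P\<close>
      tests the value of \<open>q\<close> at \<open>g\<close>, it is also the value of
      \<open>p\<close>, and \<open>p\<close> respects the edge. Otherwise \<open>init\<close> puts
      \<open>h\<close> below \<open>g\<close> and thus into \<open>D\<close>.\<close>
    have cross: "s g = 0 \<or> s h = 0" if E: "E g h" and g: "g \<in> D" and h: "h \<notin> D" for g h
    proof (rule ccontr)
      assume "\<not> (s g = 0 \<or> s h = 0)"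
      then obtain k where k: "(h, k) \<in> F" "p h = Suc k" and sg: "q g \<noteq> 0" "q g \<le> Suc K"
        using g h unfolding s_def by (auto split: if_splits)
      obtain l where l: "q g = Suc l" "l \<le> K" using sg by (cases "q g") auto
      show False
      proof (cases "(g, l) \<in> P")
        case True
        then have "(g, l) \<in> R" using g l by (simp add: R_def)
        then have "p g = Suc l" using p(2) l by (simp add: agree_def)
        moreover have "p g = 0 \<or> p h = 0" using pX E by (rule pts_edge)
        ultimately show False using k(2) by simp
      next
        case False
        then have "h \<in> low g" using init[of h k g l] k F(3) g DG E by blast
        then show False using D_low g h by blast
      qed
    qed
    have "s \<in> X"
    proof -
      have "s g = 0" if "g \<notin> G" for g
        using that pts_outside[OF q that] pts_outside[OF pX that] DG unfolding s_def by auto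
      moreover have "s g = 0 \<or> s h = 0" if "E g h" for g h
      proof -
        consider "g \<in> D \<and> h \<in> D" | "g \<in> D \<and> h \<notin> D" | "g \<notin> D \<and> h \<in> D" | "g \<notin> D \<and> h \<notin> D" by blast
        then show ?thesis
        proof cases
          case 1 then show ?thesis using pts_edge[OF q that] by (auto simp: s_def)
        next
          case 2 then show ?thesis using cross[OF that] by simp
        next
          case 3 then show ?thesis using cross[OF edge_sym[OF that]] by auto
        next
          case 4 then show ?thesis using pts_edge[OF pX that] by (auto simp: s_def)
        qed
      qed
      ultimately show ?thesis by (rule ptsI)
    qed
    moreover have "agree F p s"
      unfolding agree_def
    proof (intro allI impI)
      fix g k assume gk: "(g, k) \<in> F"
      show "p g = Suc k \<longleftrightarrow> s g = Suc k"
      proof (cases "g \<in> D")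
        case True
        then have "(g, k) \<in> R" using gk F(3) K by (auto simp: R_def)
        then have "p g = Suc k \<longleftrightarrow> q g = Suc k" using p(2) by (simp add: agree_def)
        then show ?thesis using True K[of g k] gk by (auto simp: s_def)
      next
        case False
        then show ?thesis using gk by (auto simp: s_def)
      qed
    qed
    ultimately have "s \<in> a" using p(1) pX F(4) b(2) by blast
    moreover have "agree F0 s q"
      unfolding agree_def
    proof (intro allI impI)
      fix g k assume "(g, k) \<in> F0"
      then show "s g = Suc k \<longleftrightarrow> q g = Suc k" using F0D K[of g k] by (auto simp: s_def)
    qed
    ultimately show "q \<in> a" using a(3) \<open>s \<in> X\<close> q by blast
  qed
  ultimately show ?thesis unfolding D_def by blast
qed

text \<open>Choose a point in each set and a finite initial segment containing the support of the
  set. Points that agree on the common part of their segments amalgamate to a point of both sets. So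
  for disjoint sets the chosen points are pairwise incompatible, which allows only countably
  many.\<close>

lemma clop_ccc:
  assumes Y: "Y \<subseteq> clop X (G \<times> UNIV) - {{}}" and disj: "\<And>a b. a \<in> Y \<Longrightarrow> b \<in> Y \<Longrightarrow> a \<noteq> b \<Longrightarrow> a \<inter> b = {}"
  shows "countable Y"
proof -
  define S where "S = (\<lambda>a F. a \<subseteq> X \<and> finite F \<and> F \<subseteq> G \<times> UNIV \<and>
      (determines X F a))"
  have "\<exists>F. S a F" if "a \<in> Y" for a
  proof -
    have a: "a \<in> clop X (G \<times> UNIV)" using Y that by auto
    then obtain F where "a \<subseteq> X" "finite F" "F \<subseteq> G \<times> UNIV"
      "determines X F a" by (rule clopE)
    then show ?thesis unfolding S_def by blast
  qed
  then obtain F where F: "\<And>a. a \<in> Y \<Longrightarrow> S a (F a)" by metis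
  have "\<exists>p. p \<in> a" if "a \<in> Y" for a using Y that by blast
  then obtain p where p: "\<And>a. a \<in> Y \<Longrightarrow> p a \<in> a" by metis
  have pF: "a \<subseteq> X" "finite (F a)" "F a \<subseteq> G \<times> UNIV"
      "determines X (F a) a" if "a \<in> Y" for a
    using F[OF that] unfolding S_def by blast+
  define D where "D = (\<lambda>a. \<Union>g\<in>fst ` F a. low g)"
  have DG: "D a \<subseteq> G" if "a \<in> Y" for a unfolding D_def using pF(3)[OF that] low_subset by fastforce
  have D_low: "h \<in> D a" if "a \<in> Y" "g \<in> D a" "h \<in> low g" for a g h
  proof -
    from that(2) obtain g0 where "g0 \<in> fst ` F a" "g \<in> low g0" unfolding D_def by blast
    moreover then have "g0 \<in> G" using pF(3)[OF that(1)] by auto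
    ultimately show ?thesis using low_trans[of g0 g] that(3) unfolding D_def by blast
  qed
  have FD: "g \<in> D a" if "(g, k) \<in> F a" "a \<in> Y" for a g k
    unfolding D_def using that pF(3)[of a] self_low[of g] by force
  show ?thesis
  proof (rule countable_pairwise_incompatible[where D = D and f = p])
    show "finite (D a)" if "a \<in> Y" for a
      unfolding D_def using finite_UN_low pF(2,3)[OF that] by blast
  next
    fix a b assume ab: "a \<in> Y" "b \<in> Y" "a \<noteq> b"
    show "\<exists>g\<in>D a \<inter> D b. p a g \<noteq> p b g"
    proof (rule ccontr)
      assume "\<not> ?thesis"
      then have eq: "p a g = p b g" if "g \<in> D a" "g \<in> D b" for g using that by blast
      define s where "s = (\<lambda>g. if g \<in> D a then p a g else if g \<in> D b then p b g else 0)"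
      have sa: "s g = p a g" if "g \<in> D a" for g using that by (simp add: s_def)
      have sb: "s g = p b g" if "g \<in> D b" for g using that eq by (simp add: s_def)
      have pX: "p a \<in> X" "p b \<in> X" using p pF(1) ab by blast+
      \<comment> \<open>Adjacent vertices are comparable and both domains are downward closed, so an
        edge between the domains lies entirely in one of them.\<close>
      have cross: "s g = 0 \<or> s h = 0" if "E g h" "g \<in> D a" "h \<in> D b" for g h
      proof -
        have "h \<in> low g \<or> g \<in> low h" using edge_low that DG ab by blast
        then have "h \<in> D a \<or> g \<in> D b" using D_low that ab by blast
        then show ?thesis
          using that sa[of g] sa[of h] sb[of g] sb[of h] pts_edge[OF pX(1) that(1)] pts_edge[OF pX(2) that(1)] by auto
      qed
      have "s g = 0 \<or> s h = 0" if "E g h" for g h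
      proof -
        have "E h g" using that edge_sym by blast
        consider "g \<notin> D a \<union> D b \<or> h \<notin> D a \<union> D b" | "g \<in> D a \<and> h \<in> D b" | "g \<in> D b \<and> h \<in> D a"
          | "g \<in> D a \<and> h \<in> D a" | "g \<in> D b \<and> h \<in> D b" by blast
        then show ?thesis
        proof cases
          case 1 then show ?thesis by (auto simp: s_def)
        next
          case 2 then show ?thesis using cross[OF that] by simp
        next
          case 3 then show ?thesis using cross[OF \<open>E h g\<close>] by auto
        next
          case 4 then show ?thesis using sa[of g] sa[of h] pts_edge[OF pX(1) that] by auto
        next
          case 5 then show ?thesis using sb[of g] sb[of h] pts_edge[OF pX(2) that] by auto
        qed
      qed
      moreover have "s g = 0" if "g \<notin> G" for g using that DG ab by (auto simp: s_def)
      ultimately have sX: "s \<in> X" by (intro ptsI)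
      have "agree (F a) (p a) s" "agree (F b) (p b) s"
        unfolding agree_def using FD sa sb ab by simp_all
      then have "s \<in> a" "s \<in> b" using p[OF ab(1)] p[OF ab(2)] pF(4)[OF ab(1)] pF(4)[OF ab(2)] pX sX by blast+
      then show False using disj ab by blast
    qed
  qed
qed

text \<open>The finite codes give the upper bound. For the lower one, the cylinders
  \<open>cyl X (g, 0)\<close> are distinct: the point with value \<open>Suc 0\<close> at
  \<open>g\<close> alone lies in exactly one of them.\<close>

lemma clop_eqpoll:
  assumes "infinite G" shows "clop X (G \<times> UNIV) \<approx> G"
proof (rule lepoll_antisym)
  let ?P = "G \<times> (UNIV :: nat set)"
  have "(UNIV :: nat set) \<lesssim> G" using assms infinite_le_lepoll[of G] by simp
  then have "?P \<lesssim> G \<times> G" by (rule times_lepoll_mono[OF lepoll_refl])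
  then have P: "?P \<lesssim> G"
    using eqpoll_imp_lepoll[OF square_eqpoll[OF assms]] by (rule lepoll_trans)
  have inf: "infinite ?P" using assms by (auto simp: finite_cartesian_product_iff)
  have F1: "Fpow ?P \<approx> ?P" using eqpoll_Fpow[OF inf] .
  have "infinite (Fpow ?P)" using eqpoll_finite_iff[OF F1] inf by simp
  then have F2: "Fpow (Fpow ?P) \<approx> ?P" using eqpoll_trans[OF eqpoll_Fpow F1] by simp
  have "clop X ?P \<lesssim> Fpow ?P \<times> Fpow (Fpow ?P)"
    using subset_image_lepoll[OF clop_subset_image] .
  also have "\<dots> \<lesssim> ?P \<times> ?P" by (intro times_lepoll_mono eqpoll_imp_lepoll F1 F2)
  also have "\<dots> \<lesssim> ?P" by (intro eqpoll_imp_lepoll square_eqpoll inf)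
  also note P
  finally show "clop X ?P \<lesssim> G" .
next
  let ?d = "\<lambda>g h. if h = g then Suc 0 else 0"
  have "?d g \<in> X" if "g \<in> G" for g
    using that edge_irrefl by (intro ptsI) auto
  then have d: "?d g \<in> cyl X (g', 0) \<longleftrightarrow> g = g'" if "g \<in> G" for g g'
    using that by (simp add: cyl_def)
  have "inj_on (\<lambda>g. cyl X (g, 0)) G"
    by (rule inj_onI) (metis d)
  moreover have "(\<lambda>g. cyl X (g, 0)) ` G \<subseteq> clop X (G \<times> UNIV)" by auto
  ultimately show "G \<lesssim> clop X (G \<times> UNIV)" unfolding lepoll_def by blast
qed

end

section \<open>Tight filtrations\<close>

text \<open>The algebra of sets is copied along an injection \<open>f\<close>, so that algebras of
  different spaces become structures over one type.\<close>

definition ba_of :: "'p set set \<Rightarrow> ('p set \<Rightarrow> 'k) \<Rightarrow> 'k gorder" where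
  "ba_of A f = \<lparr>carrier = f ` A, eq = (=), le = (\<lambda>x y. inv_into A f x \<subseteq> inv_into A f y)\<rparr>"

section \<open>Algebras of sets transported along an injection\<close>

locale set_algebra =
  fixes X :: "'p set" and A :: "'p set set" and f :: "'p set \<Rightarrow> 'k"
  assumes sub: "a \<in> A \<Longrightarrow> a \<subseteq> X"
    and empty: "{} \<in> A"
    and compl: "a \<in> A \<Longrightarrow> X - a \<in> A"
    and un: "a \<in> A \<Longrightarrow> b \<in> A \<Longrightarrow> a \<union> b \<in> A"
    and inj: "inj_on f A"
begin

abbreviation "L \<equiv> ba_of A f"

lemma int: assumes "a \<in> A" "b \<in> A" shows "a \<inter> b \<in> A"
proof -
  have "a \<inter> b = X - ((X - a) \<union> (X - b))" using assms[THEN sub] by blast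
  then show ?thesis using assms by (simp add: compl un)
qed

lemma space: "X \<in> A"
  using compl[OF empty] by simp

lemma carrier_ba [simp]: "carrier L = f ` A"
  by (simp add: ba_of_def)

lemma le_ba [simp]: "a \<in> A \<Longrightarrow> b \<in> A \<Longrightarrow> f a \<sqsubseteq>\<^bsub>L\<^esub> f b \<longleftrightarrow> a \<subseteq> b"
  using inj by (simp add: ba_of_def)

lemma partial_order_ba: "partial_order L"
proof unfold_locales
  show "(.=\<^bsub>L\<^esub>) = (=)" by (simp add: ba_of_def)
qed (use inj in \<open>auto simp: ba_of_def\<close>)

sublocale partial_order L
  by (rule partial_order_ba)

lemma least_ba: "a \<in> A \<Longrightarrow> b \<in> A \<Longrightarrow> least L (f (a \<union> b)) (Upper L {f a, f b})"
  unfolding least_def Upper_def by (auto simp: un)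

lemma greatest_ba: "a \<in> A \<Longrightarrow> b \<in> A \<Longrightarrow> greatest L (f (a \<inter> b)) (Lower L {f a, f b})"
  unfolding greatest_def Lower_def by (auto simp: int)

lemma join_ba [simp]: assumes "a \<in> A" "b \<in> A" shows "f a \<squnion>\<^bsub>L\<^esub> f b = f (a \<union> b)"
  unfolding join_def sup_def
  using least_ba[OF assms] by (rule some_equality) (use least_unique least_ba[OF assms] in blast)

lemma meet_ba [simp]: assumes "a \<in> A" "b \<in> A" shows "f a \<sqinter>\<^bsub>L\<^esub> f b = f (a \<inter> b)"
  unfolding meet_def inf_def
  using greatest_ba[OF assms] by (rule some_equality) (use greatest_unique greatest_ba[OF assms] in blast)

lemma bottom_ba [simp]: "\<bottom>\<^bsub>L\<^esub> = f {}"
proof -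
  have l: "least L (f {}) (carrier L)" unfolding least_def using empty by auto
  then show ?thesis unfolding bottom_def by (rule some_equality) (use least_unique l in blast)
qed

lemma top_ba [simp]: "\<top>\<^bsub>L\<^esub> = f X"
proof -
  have l: "greatest L (f X) (carrier L)" unfolding greatest_def using space sub by auto
  then show ?thesis unfolding top_def by (rule some_equality) (use greatest_unique l in blast)
qed

lemma f_eq: "a \<in> A \<Longrightarrow> b \<in> A \<Longrightarrow> f a = f b \<longleftrightarrow> a = b"
  using inj by (auto dest: inj_onD)

lemma compl_ba [simp]: assumes "a \<in> A" shows "ba_compl L (f a) = f (X - a)"
  unfolding ba_compl_def
proof (rule the_equality)
  have "a \<union> (X - a) = X" using sub[OF assms] by blast
  then show "f (X - a) \<in> carrier L \<and> f a \<squnion>\<^bsub>L\<^esub> f (X - a) = \<top>\<^bsub>L\<^esub> \<and> f a \<sqinter>\<^bsub>L\<^esub> f (X - a) = \<bottom>\<^bsub>L\<^esub>"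
    using assms compl by simp
next
  fix y assume y: "y \<in> carrier L \<and> f a \<squnion>\<^bsub>L\<^esub> y = \<top>\<^bsub>L\<^esub> \<and> f a \<sqinter>\<^bsub>L\<^esub> y = \<bottom>\<^bsub>L\<^esub>"
  then obtain b where b: "b \<in> A" "y = f b" by auto
  with y assms have "f (a \<union> b) = f X" "f (a \<inter> b) = f {}" by simp_all
  then have "a \<union> b = X" "a \<inter> b = {}" using assms b un int space empty by (simp_all add: f_eq)
  then have "b = X - a" by blast
  then show "y = f (X - a)" using b by simp
qed

lemma boolean_lattice_ba: "boolean_lattice L"
proof unfold_locales
  fix x y assume "x \<in> carrier L" "y \<in> carrier L"
  then show "\<exists>s. least L s (Upper L {x, y})" using least_ba by auto
next
  fix x y assume "x \<in> carrier L" "y \<in> carrier L"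
  then show "\<exists>s. greatest L s (Lower L {x, y})" using greatest_ba by auto
next
  show "\<exists>x. least L x (carrier L)" using empty by (auto simp: least_def intro!: exI[of _ "f {}"])
next
  show "\<exists>x. greatest L x (carrier L)" using space sub by (auto simp: greatest_def intro!: exI[of _ "f X"])
next
  fix x y z assume "x \<in> carrier L" "y \<in> carrier L" "z \<in> carrier L"
  then show "x \<sqinter>\<^bsub>L\<^esub> (y \<squnion>\<^bsub>L\<^esub> z) = x \<sqinter>\<^bsub>L\<^esub> y \<squnion>\<^bsub>L\<^esub> (x \<sqinter>\<^bsub>L\<^esub> z)"
    by (auto simp: un int Int_Un_distrib)
next
  fix x assume "x \<in> carrier L"
  then obtain a where a: "a \<in> A" "x = f a" by auto
  have "a \<union> (X - a) = X" using sub[OF a(1)] by blast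
  with a show "\<exists>y\<in>carrier L. x \<squnion>\<^bsub>L\<^esub> y = \<top>\<^bsub>L\<^esub> \<and> x \<sqinter>\<^bsub>L\<^esub> y = \<bottom>\<^bsub>L\<^esub>"
    by (intro bexI[of _ "f (X - a)"]) (simp_all add: compl)
qed

lemma ccc_ba:
  assumes "\<And>Y. Y \<subseteq> A - {{}} \<Longrightarrow> (\<And>a b. a \<in> Y \<Longrightarrow> b \<in> Y \<Longrightarrow> a \<noteq> b \<Longrightarrow> a \<inter> b = {}) \<Longrightarrow> countable Y"
  shows "ba_ccc L"
  unfolding ba_ccc_def
proof (intro allI impI)
  fix Z assume Z: "Z \<subseteq> carrier L - {\<bottom>\<^bsub>L\<^esub>} \<and> pairwise (\<lambda>x y. x \<sqinter>\<^bsub>L\<^esub> y = \<bottom>\<^bsub>L\<^esub>) Z"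
  define Y where "Y = {a \<in> A. f a \<in> Z}"
  have "countable Y"
  proof (rule assms)
    show "Y \<subseteq> A - {{}}" using Z by (auto simp: Y_def)
  next
    fix a b assume ab: "a \<in> Y" "b \<in> Y" "a \<noteq> b"
    then have "f a \<noteq> f b" by (simp add: Y_def f_eq)
    then have "f a \<sqinter>\<^bsub>L\<^esub> f b = \<bottom>\<^bsub>L\<^esub>" using Z ab unfolding pairwise_def Y_def by blast
    then show "a \<inter> b = {}" using ab by (simp add: Y_def f_eq int empty)
  qed
  moreover have "Z = f ` Y" using Z by (auto simp: Y_def)
  ultimately show "countable Z" by simp
qed

lemma subalgebra_ba:
  assumes "B \<subseteq> A" "{} \<in> B" "\<And>a. a \<in> B \<Longrightarrow> X - a \<in> B" "\<And>a b. a \<in> B \<Longrightarrow> b \<in> B \<Longrightarrow> a \<union> b \<in> B"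
  shows "ba_subalgebra L (f ` B)"
proof -
  have "X \<in> B" using assms(3)[OF assms(2)] by simp
  moreover have "a \<inter> b \<in> B" if "a \<in> B" "b \<in> B" for a b
  proof -
    have "a \<inter> b = X - ((X - a) \<union> (X - b))" using that assms(1) sub by blast
    then show ?thesis using that assms by simp
  qed
  moreover have "f a \<squnion>\<^bsub>L\<^esub> f b = f (a \<union> b)" "f a \<sqinter>\<^bsub>L\<^esub> f b = f (a \<inter> b)" "ba_compl L (f a) = f (X - a)"
    if "a \<in> B" "b \<in> B" for a b using that assms(1) by (auto simp: subset_eq)
  ultimately show ?thesis
    unfolding ba_subalgebra_def using assms by auto
qed

text \<open>A countable \<open>C\<close> that is cofinal among the members of \<open>B\<close> below
  \<open>a\<close> generates the ideal of all of them.\<close>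

lemma restrict_countably_generated:
  assumes B: "B \<subseteq> A" and a: "a \<in> A"
    and C: "countable C" "C \<subseteq> B" "\<And>c. c \<in> C \<Longrightarrow> c \<subseteq> a" "\<And>b. b \<in> B \<Longrightarrow> b \<subseteq> a \<Longrightarrow> \<exists>c\<in>C. b \<subseteq> c"
    and B': "{} \<in> B" "\<And>a b. a \<in> B \<Longrightarrow> b \<in> B \<Longrightarrow> a \<union> b \<in> B"
  shows "countably_generated_ideal L (f ` B) (ba_restrict L (f ` B) (f a))"
  unfolding countably_generated_ideal_def
proof (intro exI conjI)
  show "countable (f ` C)" "f ` C \<subseteq> f ` B" using C by auto
  have le: "f b \<sqsubseteq>\<^bsub>L\<^esub> f c \<longleftrightarrow> b \<subseteq> c" if "b \<in> B" "c \<in> A" for b c using that B by (auto simp: subset_eq)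
  have jn: "f b \<squnion>\<^bsub>L\<^esub> f c = f (b \<union> c)" if "b \<in> B" "c \<in> B" for b c using that B by (auto simp: subset_eq)
  have R: "ba_restrict L (f ` B) (f a) = f ` {b \<in> B. b \<subseteq> a}"
    unfolding ba_restrict_def using le[OF _ a] by auto
  have "ba_ideal L (f ` B) (f ` {b \<in> B. b \<subseteq> a})"
    unfolding ba_ideal_def
  proof (intro conjI ballI impI)
    fix x y assume "x \<in> f ` {b \<in> B. b \<subseteq> a}" "y \<in> f ` B" "y \<sqsubseteq>\<^bsub>L\<^esub> x"
    then obtain b c where "b \<in> B" "b \<subseteq> a" "c \<in> B" "x = f b" "y = f c" "f c \<sqsubseteq>\<^bsub>L\<^esub> f b" by auto
    moreover then have "c \<subseteq> b" using le B by blast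
    ultimately show "y \<in> f ` {b \<in> B. b \<subseteq> a}" by blast
  next
    fix x y assume "x \<in> f ` {b \<in> B. b \<subseteq> a}" "y \<in> f ` {b \<in> B. b \<subseteq> a}"
    then show "x \<squnion>\<^bsub>L\<^esub> y \<in> f ` {b \<in> B. b \<subseteq> a}" using jn B' by (auto intro!: imageI)
  qed (use B' in auto)
  moreover have "f ` C \<subseteq> f ` {b \<in> B. b \<subseteq> a}" using C by auto
  moreover have "f ` {b \<in> B. b \<subseteq> a} \<subseteq> I" if I: "ba_ideal L (f ` B) I" "f ` C \<subseteq> I" for I
  proof
    fix x assume "x \<in> f ` {b \<in> B. b \<subseteq> a}"
    then obtain b where b: "b \<in> B" "b \<subseteq> a" "x = f b" by auto
    then obtain c where c: "c \<in> C" "b \<subseteq> c" using C(4) by blast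
    then have "f b \<sqsubseteq>\<^bsub>L\<^esub> f c" using le b C(2) B by blast
    then show "x \<in> I" using I b c unfolding ba_ideal_def by blast
  qed
  ultimately show "ba_restrict L (f ` B) (f a) = ba_genideal L (f ` B) (f ` C)"
    unfolding R ba_genideal_def by blast
qed

end

lemma clop_set_algebra: "inj_on f (clop X P) \<Longrightarrow> set_algebra X (clop X P) f"
  by unfold_locales (auto simp: clop_subset clop_compl clop_un)

text \<open>By induction over clopen sets, a subalgebra that contains the cylinders over
  \<open>Q\<close> contains all of \<open>clop X Q\<close>.\<close>

lemma ba_generated_clop:
  assumes inj: "inj_on f (clop X P)" and Q: "Q \<subseteq> P"
  shows "ba_generated (ba_of (clop X P) f) ((\<lambda>x. f (cyl X x)) ` Q) = f ` clop X Q"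
proof -
  interpret set_algebra X "clop X P" f using inj by (rule clop_set_algebra)
  have sub: "clop X Q \<subseteq> clop X P" using Q by (rule clop_mono)
  have "ba_subalgebra L (f ` clop X Q)"
    by (rule subalgebra_ba) (simp_all add: sub clop_compl clop_un)
  moreover have "(\<lambda>x. f (cyl X x)) ` Q \<subseteq> f ` clop X Q" by auto
  moreover have "f ` clop X Q \<subseteq> D" if D: "ba_subalgebra L D" "(\<lambda>x. f (cyl X x)) ` Q \<subseteq> D" for D
  proof -
    have "f a \<in> D" if "a \<in> clop X Q" for a
      using that
    proof (induction rule: clop_induct)
      case empty
      then show ?case using D(1) by (simp add: ba_subalgebra_def)
    next
      case (cyl x)
      then show ?case using D(2) by auto
    next
      case (compl a)
      then have "f (X - a) = ba_compl L (f a)" using sub by auto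
      then show ?case using D(1) compl by (simp add: ba_subalgebra_def)
    next
      case (un a b)
      then have "f (a \<union> b) = f a \<squnion>\<^bsub>L\<^esub> f b" using sub by (auto simp: subset_eq)
      then show ?case using D(1) un by (simp add: ba_subalgebra_def)
    qed
    then show ?thesis by blast
  qed
  ultimately show ?thesis unfolding ba_generated_def by blast
qed

text \<open>This captures a finite support at a single earlier stage: \<open>U\<close> is directed
  upwards without a largest element.\<close>

lemma finite_subset_underS:
  assumes r: "Well_order r" and U: "U \<subseteq> Field r" "U \<noteq> {}"
    and dir: "\<And>\<alpha>. \<alpha> \<in> U \<Longrightarrow> \<exists>\<gamma>\<in>U. \<alpha> \<in> underS r \<gamma>"
    and F: "finite F" "F \<subseteq> U"
  shows "\<exists>\<gamma>\<in>U. F \<subseteq> underS r \<gamma>"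
  using F
proof (induction F)
  case empty
  then show ?case using U by auto
next
  case (insert x F)
  then obtain \<gamma> where \<gamma>: "\<gamma> \<in> U" "F \<subseteq> underS r \<gamma>" by auto
  obtain \<delta> where \<delta>: "\<delta> \<in> U" "x \<in> underS r \<delta>" using dir insert.prems by auto
  have tr: "trans r" and an: "antisym r"
    using r by (auto simp: well_order_on_def linear_order_on_def partial_order_on_def preorder_on_def)
  have "(\<gamma>, \<delta>) \<in> r \<or> (\<delta>, \<gamma>) \<in> r"
    using wo_rel.TOTALS[of r] r \<gamma>(1) \<delta>(1) U(1) by (auto simp: wo_rel_def)
  then have "underS r \<gamma> \<subseteq> underS r \<delta> \<or> underS r \<delta> \<subseteq> underS r \<gamma>"
    using underS_incr[OF tr an] by blast
  then show ?case using \<gamma> \<delta> by auto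
qed

section \<open>The filtration along an order of the generators\<close>

context sparse_graph begin

lemma card_low_less:
  assumes "g \<in> G" "h \<in> low g" "h \<noteq> g" shows "card (low h) < card (low g)"
proof (rule psubset_card_mono)
  show "finite (low g)" using assms finite_low by blast
  have "h \<in> G" using assms low_subset by blast
  have "low h \<subseteq> low g" using low_trans assms by blast
  moreover have "g \<notin> low h" using low_antisym assms by blast
  moreover have "g \<in> low g" using self_low assms by blast
  ultimately show "low h \<subset> low g" by blast
qed

text \<open>The order is lexicographic: by the size of \<open>low g\<close>, then by an arbitrary
  well-order of the vertices, then by the value. The size increases strictly along the partial
  order, so of two adjacent vertices the one listed first is below the other. No generator is last,
  since \<open>(g, Suc k)\<close> comes after \<open>(g, k)\<close>.\<close>

lemma generator_order:
  "\<exists>r :: ('g \<times> nat) rel. Well_order r \<and> Field r = G \<times> UNIV \<and>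
    (\<forall>g k h l. ((h, l), (g, k)) \<in> r \<longrightarrow> E g h \<longrightarrow> h \<in> low g) \<and>
    (\<forall>x\<in>Field r. \<exists>y\<in>Field r. x \<in> underS r y)"
proof -
  from well_ordering obtain w :: "'g rel" where w: "Well_order w" "Field w = UNIV" by metis
  have lin: "Linear_order w" and wf: "wf (w - Id)" using w(1) by (simp_all add: well_order_on_def)
  have tr: "trans w" and an: "antisym w" and rf: "refl_on UNIV w" and to: "total_on UNIV w"
    using lin by (simp_all add: w(2) linear_order_on_def partial_order_on_def preorder_on_def)
  have tot: "(a, b) \<in> w \<or> (b, a) \<in> w" for a b
    using to refl_onD[OF rf, of a] by (cases "a = b") (simp_all add: total_on_def)
  define key where "key = (\<lambda>x :: 'g \<times> nat. (card (low (fst x)), fst x, snd x))"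
  define s where "s = inv_image (less_than <*lex*> (w - Id) <*lex*> less_than) key"
  define r where "r = {(x, y). x \<in> G \<times> UNIV \<and> y \<in> G \<times> UNIV \<and> ((x, y) \<in> s \<or> x = y)}"
  have wfs: "wf s" unfolding s_def by (intro wf_inv_image wf_lex_prod wf_less_than wf)
  have trw: "trans (w - Id)" using tr an by (auto simp: trans_def antisym_def)
  have trs: "trans s" unfolding s_def by (intro trans_inv_image trans_lex_prod trans_less_than trw)
  have tots: "(x, y) \<in> s \<or> (y, x) \<in> s \<or> x = y" for x y
  proof -
    have in_s: "((g, k), (h, l)) \<in> s \<longleftrightarrow> card (low g) < card (low h) \<or> card (low g) = card (low h) \<and>
      (g \<noteq> h \<and> (g, h) \<in> w \<or> g = h \<and> k < l)" for g k h l
      unfolding s_def key_def by auto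
    obtain g k h l where xy: "x = (g, k)" "y = (h, l)" by (cases x, cases y)
    show ?thesis
      using tot[of g h] linorder_less_linear[of "card (low g)" "card (low h)"] linorder_less_linear[of k l]
      unfolding xy in_s prod.inject by metis
  qed
  have irr: "(x, x) \<notin> s" for x using wfs by (simp add: wf_not_refl)
  have F: "Field r = G \<times> UNIV" by (auto simp: r_def Field_def)
  have "Well_order r"
    unfolding well_order_on_def linear_order_on_def partial_order_on_def preorder_on_def F
  proof (intro conjI)
    show "refl_on (G \<times> UNIV) r" by (auto simp: refl_on_def r_def)
    show "r \<subseteq> (G \<times> UNIV) \<times> G \<times> UNIV" by (auto simp: r_def)
    show "trans r" using trs by (auto simp: r_def trans_def)
    show "antisym r" using trs irr by (fastforce simp: r_def antisym_def trans_def)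
    show "total_on (G \<times> UNIV) r" using tots by (auto simp: r_def total_on_def)
    have "r - Id \<subseteq> s" by (auto simp: r_def)
    then show "wf (r - Id)" using wfs wf_subset by blast
  qed
  moreover have "h \<in> low g" if "((h, l), (g, k)) \<in> r" "E g h" for g h k l
  proof (rule ccontr)
    assume "h \<notin> low g"
    moreover have "g \<in> G" "h \<in> G" using that by (auto simp: r_def)
    moreover have "g \<noteq> h" using that edge_irrefl by blast
    ultimately have "card (low g) < card (low h)" using edge_low that(2) card_low_less by blast
    then show False using that(1) \<open>g \<noteq> h\<close> by (auto simp: r_def s_def key_def)
  qed
  moreover have "\<exists>y\<in>Field r. x \<in> underS r y" if "x \<in> Field r" for x
  proof -
    obtain g k where x: "x = (g, k)" "g \<in> G" using \<open>x \<in> Field r\<close> unfolding F by auto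
    have "(x, (g, Suc k)) \<in> s" unfolding x s_def key_def by simp
    then have "x \<in> underS r (g, Suc k)" using x unfolding underS_def r_def by simp
    then show ?thesis using x unfolding F by blast
  qed
  ultimately show ?thesis using F by blast
qed

text \<open>Stage \<open>\<beta>\<close> consists of the clopen sets over the generators listed
  before \<open>\<beta>\<close>. The choice of the order makes \<open>clop_sigma_interpolant\<close>
  applicable, and the interpolants below a fixed \<open>a\<close> come from a countable
  algebra.\<close>

lemma tightly_sigma_filtered_clop:
  fixes f :: "('g \<Rightarrow> nat) set \<Rightarrow> 'k"
  assumes f: "inj_on f (clop X (G \<times> UNIV))" and G: "G \<noteq> {}"
  shows "tightly_sigma_filtered (ba_of (clop X (G \<times> UNIV)) f)"
proof -
  let ?P = "G \<times> (UNIV :: nat set)"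
  interpret set_algebra X "clop X ?P" f using f by (rule clop_set_algebra)
  \<comment> \<open>A filtration is indexed by elements of the algebra's type, so each generator is
    indexed by the code of its own cylinder. The tight sequence is then the identity.\<close>
  define \<iota> where "\<iota> = (\<lambda>x. f (cyl X x))"
  have \<iota>: "inj_on \<iota> ?P"
  proof (rule inj_onI)
    fix x y assume xy: "x \<in> ?P" "y \<in> ?P" "\<iota> x = \<iota> y"
    then have eq: "cyl X x = cyl X y" using inj_onD[OF f] by (simp add: \<iota>_def)
    define p where "p = (\<lambda>h. if h = fst x then Suc (snd x) else 0)"
    have "p \<in> X" using xy edge_irrefl by (intro ptsI) (auto simp: p_def)
    then have "p \<in> cyl X x" by (simp add: cyl_def p_def)
    then have "p \<in> cyl X y" using eq by simp
    then show "x = y" by (simp add: cyl_def p_def prod_eq_iff split: if_splits)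
  qed
  obtain r0 :: "('g \<times> nat) rel" where r0: "Well_order r0" "Field r0 = ?P"
    "\<And>g k h l. ((h, l), (g, k)) \<in> r0 \<Longrightarrow> E g h \<Longrightarrow> h \<in> low g"
    "\<And>x. x \<in> Field r0 \<Longrightarrow> \<exists>y\<in>Field r0. x \<in> underS r0 y"
    using generator_order by blast
  define r where "r = dir_image r0 \<iota>"
  have r: "Well_order r" unfolding r_def using Well_order_dir_image[OF r0(1)] \<iota> r0(2) by simp
  have Fr: "Field r = \<iota> ` ?P" unfolding r_def dir_image_Field r0(2) ..
  have r_iff: "(\<iota> x, \<iota> y) \<in> r \<longleftrightarrow> (x, y) \<in> r0" if "x \<in> ?P" "y \<in> ?P" for x y
  proof -
    have "x' = x \<and> y' = y" if h: "(x', y') \<in> r0" "\<iota> x' = \<iota> x" "\<iota> y' = \<iota> y" for x' y'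
    proof -
      have "x' \<in> ?P" "y' \<in> ?P" using h(1) r0(2) by (auto simp: Field_def)
      then show ?thesis using inj_onD[OF \<iota> h(2)] inj_onD[OF \<iota> h(3)] \<open>x \<in> ?P\<close> \<open>y \<in> ?P\<close> by blast
    qed
    note * = this
    have "(x, y) \<in> r0" if xy: "(\<iota> x, \<iota> y) \<in> r"
    proof -
      obtain x' y' where xy': "(x', y') \<in> r0" "\<iota> x' = \<iota> x" "\<iota> y' = \<iota> y"
        using xy unfolding r_def dir_image_def by auto
      then show ?thesis using *[OF xy'] by simp
    qed
    moreover have "(x, y) \<in> r0 \<Longrightarrow> (\<iota> x, \<iota> y) \<in> r" unfolding r_def dir_image_def by blast
    ultimately show ?thesis by blast
  qed
  have tr: "trans r" and an: "antisym r"
    using r by (auto simp: well_order_on_def linear_order_on_def partial_order_on_def preorder_on_def)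
  define Q where "Q = (\<lambda>\<beta>. {x \<in> ?P. \<iota> x \<in> underS r \<beta>})"
  have under: "underS r \<beta> = \<iota> ` Q \<beta>" for \<beta>
    using underS_Field[of _ r \<beta>] by (auto simp: Q_def Fr)
  have QP: "Q \<beta> \<subseteq> ?P" for \<beta> by (auto simp: Q_def)
  define F where "F = (\<lambda>\<beta>. f ` clop X (Q \<beta>))"
  have gen: "F \<beta> = ba_generated L (underS r \<beta>)" for \<beta>
    unfolding F_def under \<iota>_def using ba_generated_clop[OF f QP] by simp
  have subF: "ba_subalgebra L (F \<beta>)" for \<beta>
    unfolding F_def by (rule subalgebra_ba) (simp_all add: clop_mono[OF QP] clop_compl clop_un)
  have Qmono: "Q \<alpha> \<subseteq> Q \<beta>" if "\<alpha> \<in> underS r \<beta>" for \<alpha> \<beta>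
    using underS_incr[OF tr an, of \<alpha> \<beta>] that by (auto simp: Q_def underS_def)
  \<comment> \<open>A clopen set over a directed set of indices has finite support and so belongs to
    one stage. This covers the limit stages and the union of all stages.\<close>
  have approx: "\<exists>\<gamma>\<in>U. a \<in> clop X (Q \<gamma>)"
    if aU: "a \<in> clop X {x \<in> ?P. \<iota> x \<in> U}" and U: "U \<subseteq> Field r" "U \<noteq> {}" "\<And>\<alpha>. \<alpha> \<in> U \<Longrightarrow> \<exists>\<gamma>\<in>U. \<alpha> \<in> underS r \<gamma>" for U a
  proof -
    obtain D where D: "a \<subseteq> X" "finite D" "D \<subseteq> {x \<in> ?P. \<iota> x \<in> U}"
      "determines X D a" using aU by (rule clopE)
    have "finite (\<iota> ` D)" "\<iota> ` D \<subseteq> U" using D(2,3) by auto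
    from finite_subset_underS[OF r U this]
    obtain \<gamma> where \<gamma>: "\<gamma> \<in> U" "\<iota> ` D \<subseteq> underS r \<gamma>" by auto
    have "a \<in> clop X (Q \<gamma>)"
    proof (rule clopI[OF D(1,2)])
      show "D \<subseteq> Q \<gamma>" using D(3) \<gamma>(2) by (auto simp: Q_def)
    qed (use D(4) in blast)
    then show ?thesis using \<gamma>(1) by blast
  qed
  have nomax: "\<exists>\<gamma>\<in>Field r. \<alpha> \<in> underS r \<gamma>" if \<alpha>: "\<alpha> \<in> Field r" for \<alpha>
  proof -
    obtain x where x: "x \<in> ?P" "\<alpha> = \<iota> x" using \<alpha> unfolding Fr by blast
    then obtain y where y: "y \<in> ?P" "x \<in> underS r0 y" using r0(2,4) by metis
    then have "(\<iota> x, \<iota> y) \<in> r" "x \<noteq> y" using x r_iff by (auto simp: underS_def)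
    then have "\<iota> x \<in> underS r (\<iota> y)" using x y inj_onD[OF \<iota>] by (auto simp: underS_def)
    then show ?thesis using x y Fr by blast
  qed
  have "(\<Union>\<alpha>\<in>Field r. F \<alpha>) = carrier L"
  proof
    show "(\<Union>\<alpha>\<in>Field r. F \<alpha>) \<subseteq> carrier L" using clop_mono[OF QP] by (auto simp: F_def)
    show "carrier L \<subseteq> (\<Union>\<alpha>\<in>Field r. F \<alpha>)"
    proof
      fix z assume "z \<in> carrier L"
      then obtain a where a: "a \<in> clop X ?P" "z = f a" by auto
      show "z \<in> (\<Union>\<alpha>\<in>Field r. F \<alpha>)"
      proof (cases "?P = {}")
        case True
        then show ?thesis using G by auto
      next
        case False
        have "a \<in> clop X {x \<in> ?P. \<iota> x \<in> Field r}" using a(1) clop_mono[of ?P "{x \<in> ?P. \<iota> x \<in> Field r}"] by (auto simp: Fr)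
        then obtain \<gamma> where "\<gamma> \<in> Field r" "a \<in> clop X (Q \<gamma>)"
          using approx[of a "Field r"] nomax False Fr by auto
        then show ?thesis using a by (auto simp: F_def)
      qed
    qed
  qed
  moreover have "F \<beta> = (\<Union>\<alpha>\<in>underS r \<beta>. F \<alpha>)" if lp: "limit_point r \<beta>" for \<beta>
  proof
    have U: "underS r \<beta> \<subseteq> Field r" using underS_Field by auto
    show "F \<beta> \<subseteq> (\<Union>\<alpha>\<in>underS r \<beta>. F \<alpha>)"
    proof
      fix z assume "z \<in> F \<beta>"
      then obtain a where a: "a \<in> clop X (Q \<beta>)" "z = f a" by (auto simp: F_def)
      have "\<exists>\<gamma>\<in>underS r \<beta>. a \<in> clop X (Q \<gamma>)"
        by (rule approx) (use a(1) U lp in \<open>simp_all add: Q_def limit_point_def\<close>)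
      then obtain \<gamma> where "\<gamma> \<in> underS r \<beta>" "a \<in> clop X (Q \<gamma>)" by blast
      then show "z \<in> (\<Union>\<alpha>\<in>underS r \<beta>. F \<alpha>)" using a(2) by (auto simp: F_def)
    qed
    show "(\<Union>\<alpha>\<in>underS r \<beta>. F \<alpha>) \<subseteq> F \<beta>" unfolding F_def using clop_mono[OF Qmono] by blast
  qed
  moreover have "F \<alpha> \<subseteq> F \<beta>" if "\<alpha> \<in> underS r \<beta>" for \<alpha> \<beta>
    unfolding F_def using clop_mono[OF Qmono[OF that]] by (rule image_mono)
  ultimately have filt: "filtration L r F" unfolding filtration_def using r subF by simp
  have carr: "\<alpha> \<in> carrier L" if "\<alpha> \<in> Field r" for \<alpha> using that Fr by (auto simp: \<iota>_def)
  have "tight_filtration L r F"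
    unfolding tight_filtration_def
  proof (intro conjI exI[of _ "\<lambda>\<alpha>. \<alpha>"] ballI filt)
    show "\<alpha> \<in> carrier L" if "\<alpha> \<in> Field r" for \<alpha> using carr[OF that] .
    show "F \<beta> = ba_generated L ((\<lambda>\<alpha>. \<alpha>) ` underS r \<beta>)" for \<beta> by (simp add: gen)
  qed
  moreover have "sigma_subalgebra L (F \<beta>)" if \<beta>: "\<beta> \<in> Field r" for \<beta>
    unfolding sigma_subalgebra_def
  proof (intro conjI ballI subF)
    fix z assume "z \<in> carrier L"
    then obtain a where a: "a \<in> clop X ?P" "z = f a" by auto
    obtain D where D: "a \<subseteq> X" "finite D" "D \<subseteq> ?P"
      "determines X D a" using a(1) by (rule clopE)
    let ?R = "Q \<beta> \<inter> ((\<Union>g\<in>fst ` D. low g) \<times> UNIV)"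
    define C where "C = {c \<in> clop X ?R. c \<subseteq> a}"
    have "countable ((\<Union>g\<in>fst ` D. low g) \<times> (UNIV :: nat set))"
      using countable_finite[OF finite_UN_low[OF D(2,3)]] by (intro countable_SIGMA) simp_all
    then have "countable ?R" by (rule countable_Int2)
    then have "countable (clop X ?R)" by (rule countable_clop)
    then have "countable C" unfolding C_def by (rule countable_subset[rotated]) blast
    moreover have "C \<subseteq> clop X (Q \<beta>)" unfolding C_def using clop_mono[of ?R "Q \<beta>"] by auto
    moreover have "\<exists>c\<in>C. b \<subseteq> c" if "b \<in> clop X (Q \<beta>)" "b \<subseteq> a" for b
    proof -
      \<comment> \<open>At stage \<open>\<beta>\<close> the generator \<open>(h, l)\<close> is
        listed and \<open>(g, k)\<close> is not, so \<open>(h, l)\<close> comes first and adjacency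
        puts \<open>h\<close> below \<open>g\<close>.\<close>
      have init: "h \<in> low g" if "(h, l) \<in> Q \<beta>" "g \<in> G" "(g, k) \<notin> Q \<beta>" "E g h" for g k h l
      proof -
        have "\<iota> (g, k) \<in> Field r" "\<iota> (g, k) \<notin> underS r \<beta>" using that by (auto simp: Q_def Fr)
        then have "(\<beta>, \<iota> (g, k)) \<in> r"
          using wo_rel.TOTALS[of r] r \<beta> wo_rel.REFL[of r] by (auto simp: wo_rel_def underS_def refl_on_def)
        moreover have "(\<iota> (h, l), \<beta>) \<in> r" using that by (auto simp: Q_def underS_def)
        ultimately have "(\<iota> (h, l), \<iota> (g, k)) \<in> r" using tr by (auto dest: transD)
        moreover have "(h, l) \<in> ?P" "(g, k) \<in> ?P" using that by (auto simp: Q_def)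
        ultimately have "((h, l), (g, k)) \<in> r0" using r_iff by blast
        then show ?thesis using r0(3) that by blast
      qed
      have "\<exists>c\<in>clop X ?R. b \<subseteq> c \<and> c \<subseteq> a"
        by (rule clop_sigma_interpolant[OF QP _ D(2-4) that]) (rule init)
      then show ?thesis unfolding C_def by blast
    qed
    ultimately show "countably_generated_ideal L (F \<beta>) (ba_restrict L (F \<beta>) z)"
      unfolding F_def a(2)
      by (intro restrict_countably_generated[where C = C] clop_mono[OF QP] a(1)) (auto simp: clop_un C_def)
  qed
  ultimately show ?thesis unfolding tightly_sigma_filtered_def by blast
qed

end

section \<open>Isomorphisms as homeomorphisms\<close>

lemma pts_eqI:
  assumes "p \<in> pts G E" "q \<in> pts G E"
    and "\<And>a. a \<in> clop (pts G E) (G \<times> UNIV) \<Longrightarrow> p \<in> a \<longleftrightarrow> q \<in> a"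
  shows "p = q"
proof
  fix g
  have *: "p g = Suc k \<longleftrightarrow> q g = Suc k" if "g \<in> G" for k
  proof -
    have "cyl (pts G E) (g, k) \<in> clop (pts G E) (G \<times> UNIV)" using that by simp
    from assms(3)[OF this] show ?thesis using assms(1,2) by (simp add: cyl_def)
  qed
  show "p g = q g"
  proof (cases "g \<in> G")
    case True
    show ?thesis
    proof (cases "p g")
      case 0
      then show ?thesis using *[OF True, of "q g - 1"] by (cases "q g") auto
    next
      case (Suc k)
      then show ?thesis using *[OF True, of k] by simp
    qed
  next
    case False
    then show ?thesis using pts_outside[OF assms(1)] pts_outside[OF assms(2)] by simp
  qed
qed

text \<open>The sets \<open>a\<close> with \<open>p\<close> in \<open>K a\<close> form an
  ultrafilter. Its limit is built coordinatewise: different cylinders at \<open>g\<close> are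
  disjoint, so at most one value is selected there. The cylinders then determine the whole
  ultrafilter.\<close>

lemma point_of_hom:
  assumes K: "\<And>a. a \<in> clop (pts G E) (G \<times> UNIV) \<Longrightarrow> K a \<subseteq> Y"
      "K {} = {}"
      "\<And>a. a \<in> clop (pts G E) (G \<times> UNIV) \<Longrightarrow> K (pts G E - a) = Y - K a"
      "\<And>a b. a \<in> clop (pts G E) (G \<times> UNIV) \<Longrightarrow> b \<in> clop (pts G E) (G \<times> UNIV) \<Longrightarrow> K (a \<union> b) = K a \<union> K b"
    and p: "p \<in> Y"
  shows "\<exists>q\<in>pts G E. \<forall>a\<in>clop (pts G E) (G \<times> UNIV). q \<in> a \<longleftrightarrow> p \<in> K a"
proof -
  let ?X = "pts G E" and ?P = "G \<times> (UNIV :: nat set)"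
  have disj: "K a \<inter> K b = {}" if "a \<in> clop ?X ?P" "b \<in> clop ?X ?P" "a \<inter> b = {}" for a b
  proof -
    have "?X - a = b \<union> (?X - a)" using that(3) clop_subset[OF that(2)] by blast
    then have "K (?X - a) = K b \<union> K (?X - a)" using K(4)[OF that(2) clop_compl[OF that(1)]] by simp
    then have "K b \<subseteq> Y - K a" using K(3)[OF that(1)] by blast
    then show ?thesis by blast
  qed
  \<comment> \<open>The default \<open>0\<close> is the limit value, taken when no cylinder at
    \<open>g\<close> is selected.\<close>
  define q where "q = (\<lambda>g. if \<exists>k. g \<in> G \<and> p \<in> K (cyl ?X (g, k)) then Suc (SOME k. p \<in> K (cyl ?X (g, k))) else 0)"
  have q: "q g = Suc k \<longleftrightarrow> p \<in> K (cyl ?X (g, k))" if g: "g \<in> G" for g k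
  proof
    assume "q g = Suc k"
    then have ex: "\<exists>k. p \<in> K (cyl ?X (g, k))" and k: "k = (SOME k. p \<in> K (cyl ?X (g, k)))"
      unfolding q_def by (auto split: if_splits)
    show "p \<in> K (cyl ?X (g, k))" unfolding k using ex by (rule someI_ex)
  next
    assume k: "p \<in> K (cyl ?X (g, k))"
    have "l = k" if "p \<in> K (cyl ?X (g, l))" for l
    proof (rule ccontr)
      assume "l \<noteq> k"
      then have "cyl ?X (g, l) \<inter> cyl ?X (g, k) = {}" by (auto simp: cyl_def)
      then have "K (cyl ?X (g, l)) \<inter> K (cyl ?X (g, k)) = {}" using g by (intro disj) simp_all
      then show False using that k by blast
    qed
    then have "(SOME k. p \<in> K (cyl ?X (g, k))) = k" using some_equality[of "\<lambda>k. p \<in> K (cyl ?X (g, k))" k, OF k] by blast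
    moreover have "\<exists>k. g \<in> G \<and> p \<in> K (cyl ?X (g, k))" using k g by blast
    ultimately show "q g = Suc k" unfolding q_def by simp
  qed
  have qX: "q \<in> ?X"
  proof (rule ptsI)
    show "q g = 0" if "g \<notin> G" for g using that by (simp add: q_def)
  next
    fix g h assume E: "E g h"
    show "q g = 0 \<or> q h = 0"
    proof (rule ccontr)
      assume *: "\<not> (q g = 0 \<or> q h = 0)"
      obtain k where k: "q g = Suc k" using * by (cases "q g") auto
      obtain l where l: "q h = Suc l" using * by (cases "q h") auto
      have gh: "g \<in> G" "h \<in> G" using * by (auto simp: q_def split: if_splits)
      have "cyl ?X (g, k) \<inter> cyl ?X (h, l) = {}"
      proof -
        have "\<not> (p g = Suc k \<and> p h = Suc l)" if "p \<in> ?X" for p using pts_edge[OF that E] by auto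
        then show ?thesis by (auto simp: cyl_def)
      qed
      then have "K (cyl ?X (g, k)) \<inter> K (cyl ?X (h, l)) = {}" using gh by (intro disj) simp_all
      then show False using k l q gh by blast
    qed
  qed
  have "q \<in> a \<longleftrightarrow> p \<in> K a" if "a \<in> clop ?X ?P" for a
    using that
  proof (induction rule: clop_induct)
    case empty
    then show ?case by (simp add: K(2))
  next
    case (cyl x)
    then show ?case using q[of "fst x" "snd x"] qX by (auto simp: cyl_def)
  next
    case (compl a)
    then show ?case using K(3) qX p by auto
  next
    case (un a b)
    then show ?case using K(4) by auto
  qed
  then show ?thesis using qX by blast
qed

text \<open>Stone duality: the isomorphism and its inverse turn points of either space into
  ultrafilters on the other algebra, that is, into points. The two maps are mutually inverse because
  clopen sets separate points.\<close>

lemma homeomorphism_of_ba_isomorphism: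
  fixes f :: "('g \<Rightarrow> nat) set \<Rightarrow> 'k" and f' :: "('h \<Rightarrow> nat) set \<Rightarrow> 'l"
  assumes f: "inj_on f (clop (pts G E) (G \<times> UNIV))" and f': "inj_on f' (clop (pts G' E') (G' \<times> UNIV))"
    and iso: "ba_isomorphic (ba_of (clop (pts G E) (G \<times> UNIV)) f) (ba_of (clop (pts G' E') (G' \<times> UNIV)) f')"
  obtains \<phi> where "bij_betw \<phi> (pts G E) (pts G' E')"
    "\<And>a. a \<subseteq> pts G E \<Longrightarrow> a \<in> clop (pts G E) (G \<times> UNIV) \<longleftrightarrow> \<phi> ` a \<in> clop (pts G' E') (G' \<times> UNIV)"
proof -
  let ?X = "pts G E" and ?X' = "pts G' E'"
  let ?A = "clop ?X (G \<times> UNIV)" and ?A' = "clop ?X' (G' \<times> UNIV)"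
  interpret A: set_algebra ?X ?A f using f by (rule clop_set_algebra)
  interpret A': set_algebra ?X' ?A' f' using f' by (rule clop_set_algebra)
  obtain h where h: "ba_isomorphism A.L A'.L h" using iso unfolding ba_isomorphic_def by blast
  have bij: "bij_betw h (f ` ?A) (f' ` ?A')" using h by (simp add: ba_isomorphism_def)
  define H where "H = (\<lambda>a. inv_into ?A' f' (h (f a)))"
  have HA: "H a \<in> ?A'" and fH: "f' (H a) = h (f a)" if "a \<in> ?A" for a
  proof -
    have "h (f a) \<in> f' ` ?A'" using bij_betwE[OF bij] that by blast
    then show "H a \<in> ?A'" "f' (H a) = h (f a)" unfolding H_def
      by (rule inv_into_into) (rule f_inv_into_f, fact)
  qed
  have H_eq: "H a = b" if "a \<in> ?A" "b \<in> ?A'" "h (f a) = f' b" for a b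
    using HA[OF that(1)] fH[OF that(1)] that A'.f_eq by auto
  have Hbij: "bij_betw H ?A ?A'"
  proof (rule bij_betwI')
    fix a b assume ab: "a \<in> ?A" "b \<in> ?A"
    have "H a = H b \<Longrightarrow> h (f a) = h (f b)" using fH[OF ab(1)] fH[OF ab(2)] by simp
    then have "H a = H b \<Longrightarrow> f a = f b" using bij_betw_imp_inj_on[OF bij] ab by (auto dest: inj_onD)
    then show "H a = H b \<longleftrightarrow> a = b" using A.f_eq[OF ab] by auto
  next
    fix b assume b: "b \<in> ?A'"
    have "h ` f ` ?A = f' ` ?A'" using bij by (simp add: bij_betw_def)
    then have "f' b \<in> h ` f ` ?A" using b by simp
    then obtain a where a: "a \<in> ?A" "f' b = h (f a)" by (elim imageE) simp
    show "\<exists>a\<in>?A. b = H a" using H_eq[OF a(1) b a(2)[symmetric]] a(1) by blast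
  qed (rule HA)
  have He: "H {} = {}"
    by (rule H_eq) (use h in \<open>simp_all add: ba_isomorphism_def\<close>)
  have Hc: "H (?X - a) = ?X' - H a" if "a \<in> ?A" for a
  proof (rule H_eq)
    have "h (ba_compl A.L (f a)) = ba_compl A'.L (h (f a))" using h that by (simp add: ba_isomorphism_def)
    then show "h (f (?X - a)) = f' (?X' - H a)" using that fH[OF that] HA[OF that] by (metis A.compl_ba A'.compl_ba)
  qed (use that HA in \<open>simp_all add: clop_compl\<close>)
  have Hu: "H (a \<union> b) = H a \<union> H b" if "a \<in> ?A" "b \<in> ?A" for a b
  proof (rule H_eq)
    have "h (f a \<squnion>\<^bsub>A.L\<^esub> f b) = h (f a) \<squnion>\<^bsub>A'.L\<^esub> h (f b)" using h that by (simp add: ba_isomorphism_def)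
    then show "h (f (a \<union> b)) = f' (H a \<union> H b)" using that fH HA by (metis A.join_ba A'.join_ba)
  qed (use that HA in \<open>simp_all add: clop_un\<close>)
  define K where "K = inv_into ?A H"
  have KA: "K b \<in> ?A" and HK: "H (K b) = b" if "b \<in> ?A'" for b
  proof -
    have "b \<in> H ` ?A" using Hbij that by (simp add: bij_betw_def)
    then show "K b \<in> ?A" "H (K b) = b" unfolding K_def
      by (rule inv_into_into) (rule f_inv_into_f, fact)
  qed
  have KH: "K (H a) = a" if "a \<in> ?A" for a
    using Hbij that unfolding K_def by (simp add: bij_betw_def)
  have K_eq: "K b = a" if "a \<in> ?A" "H a = b" for a b using KH that by blast
  have Ke: "K {} = {}" by (rule K_eq) (simp_all add: He)
  have Kc: "K (?X' - b) = ?X - K b" if "b \<in> ?A'" for b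
    by (rule K_eq) (simp_all add: that clop_compl KA Hc HK)
  have Ku: "K (a \<union> b) = K a \<union> K b" if "a \<in> ?A'" "b \<in> ?A'" for a b
    by (rule K_eq) (simp_all add: that clop_un KA Hu HK)
  have "\<exists>q\<in>?X'. \<forall>b\<in>?A'. q \<in> b \<longleftrightarrow> p \<in> K b" if "p \<in> ?X" for p
    by (rule point_of_hom[where Y = ?X]) (simp_all add: KA[THEN clop_subset] Ke Kc Ku that)
  then obtain \<phi> where \<phi>: "\<And>p. p \<in> ?X \<Longrightarrow> \<phi> p \<in> ?X'" "\<And>p b. p \<in> ?X \<Longrightarrow> b \<in> ?A' \<Longrightarrow> \<phi> p \<in> b \<longleftrightarrow> p \<in> K b"
    by metis
  have "\<exists>p\<in>?X. \<forall>a\<in>?A. p \<in> a \<longleftrightarrow> q \<in> H a" if "q \<in> ?X'" for q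
    by (rule point_of_hom[where Y = ?X']) (simp_all add: HA[THEN clop_subset] He Hc Hu that)
  then obtain \<psi> where \<psi>: "\<And>q. q \<in> ?X' \<Longrightarrow> \<psi> q \<in> ?X" "\<And>q a. q \<in> ?X' \<Longrightarrow> a \<in> ?A \<Longrightarrow> \<psi> q \<in> a \<longleftrightarrow> q \<in> H a"
    by metis
  have \<psi>\<phi>: "\<psi> (\<phi> p) = p" if "p \<in> ?X" for p
  proof (rule pts_eqI[OF _ that])
    show "\<psi> (\<phi> p) \<in> ?X" using \<psi>(1)[OF \<phi>(1)[OF that]] .
    show "\<psi> (\<phi> p) \<in> a \<longleftrightarrow> p \<in> a" if "a \<in> ?A" for a
      using \<psi>(2)[OF \<phi>(1)[OF \<open>p \<in> ?X\<close>] that] \<phi>(2)[OF \<open>p \<in> ?X\<close> HA[OF that]] KH[OF that] by simp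
  qed
  have \<phi>\<psi>: "\<phi> (\<psi> q) = q" if "q \<in> ?X'" for q
  proof (rule pts_eqI[OF _ that])
    show "\<phi> (\<psi> q) \<in> ?X'" using \<phi>(1)[OF \<psi>(1)[OF that]] .
    show "\<phi> (\<psi> q) \<in> b \<longleftrightarrow> q \<in> b" if "b \<in> ?A'" for b
      using \<phi>(2)[OF \<psi>(1)[OF \<open>q \<in> ?X'\<close>] that] \<psi>(2)[OF \<open>q \<in> ?X'\<close> KA[OF that]] HK[OF that] by simp
  qed
  have b: "bij_betw \<phi> ?X ?X'"
    by (rule bij_betw_byWitness[where f' = \<psi>]) (use \<psi>\<phi> \<phi>\<psi> \<phi>(1) \<psi>(1) in auto)
  have im: "\<phi> ` a = H a" if a: "a \<in> ?A" for a
  proof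
    show "\<phi> ` a \<subseteq> H a" using \<phi>(2)[OF _ HA[OF a]] KH[OF a] clop_subset[OF a] by blast
    show "H a \<subseteq> \<phi> ` a"
    proof
      fix q assume q: "q \<in> H a"
      then have qX: "q \<in> ?X'" using clop_subset[OF HA[OF a]] by blast
      then have "\<psi> q \<in> a" using \<psi>(2) a q by blast
      then show "q \<in> \<phi> ` a" using \<phi>\<psi>[OF qX] by (metis imageI)
    qed
  qed
  have "a \<in> ?A \<longleftrightarrow> \<phi> ` a \<in> ?A'" if a: "a \<subseteq> ?X" for a
  proof
    assume "a \<in> ?A" then show "\<phi> ` a \<in> ?A'" using im HA by simp
  next
    assume *: "\<phi> ` a \<in> ?A'"
    then have "\<phi> ` a = \<phi> ` (K (\<phi> ` a))" using im[OF KA[OF *]] HK by simp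
    then have "a = K (\<phi> ` a)"
      using bij_betw_imp_inj_on[OF b] a clop_subset[OF KA[OF *]] by (simp add: inj_on_image_eq_iff)
    then show "a \<in> ?A" using KA[OF *] by simp
  qed
  with b show thesis by (rule that)
qed

definition clop_homeo :: "'g set \<Rightarrow> ('g \<Rightarrow> 'g \<Rightarrow> bool) \<Rightarrow> 'h set \<Rightarrow> ('h \<Rightarrow> 'h \<Rightarrow> bool) \<Rightarrow> (('g \<Rightarrow> nat) \<Rightarrow> ('h \<Rightarrow> nat)) \<Rightarrow> bool" where
  "clop_homeo G E G' E' \<phi> \<longleftrightarrow> bij_betw \<phi> (pts G E) (pts G' E') \<and>
    (\<forall>a. a \<subseteq> pts G E \<longrightarrow>
      (a \<in> clop (pts G E) (G \<times> UNIV) \<longleftrightarrow> \<phi> ` a \<in> clop (pts G' E') (G' \<times> UNIV)))"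

text \<open>This reduces the theorem to a family of graphs: their clopen algebras have all the
  required properties, and an isomorphism of two of them gives a homeomorphism, to which
  \<open>noniso\<close> applies.\<close>

lemma family_of_sparse_graphs:
  fixes \<kappa> :: "'k rel" and I :: "'i set" and G :: "'i \<Rightarrow> 'g set"
  assumes \<kappa>: "Card_order \<kappa>" "cinfinite \<kappa>"
    and I: "|I| =o ctwo ^c \<kappa>"
    and sparse: "\<And>i. i \<in> I \<Longrightarrow> sparse_graph (G i) (E i) (low i)"
    and size: "\<And>i. i \<in> I \<Longrightarrow> |G i| =o \<kappa>"
    and noniso: "\<And>i j \<phi>. i \<in> I \<Longrightarrow> j \<in> I \<Longrightarrow> clop_homeo (G i) (E i) (G j) (E j) \<phi> \<Longrightarrow> i = j"
  shows "\<exists>S :: 'k gorder set.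
    |S| =o ctwo ^c \<kappa> \<and>
    (\<forall>A\<in>S. boolean_lattice A \<and> |carrier A| =o \<kappa> \<and> tightly_sigma_filtered A \<and> ba_ccc A) \<and>
    pairwise (\<lambda>A B. \<not> ba_isomorphic A B) S"
proof -
  define A where "A = (\<lambda>i. clop (pts (G i) (E i)) (G i \<times> UNIV))"
  have infK: "infinite (Field \<kappa>)" using \<kappa>(2) by (simp add: cinfinite_def)
  have fld: "|Field \<kappa>| =o \<kappa>" using \<kappa>(1) by (rule card_of_Field_ordIso)
  have infG: "infinite (G i)" if "i \<in> I" for i
  proof -
    have "|G i| =o |Field \<kappa>|" using size[OF that] ordIso_symmetric[OF fld] by (rule ordIso_transitive)
    then show ?thesis using card_of_ordIso_finite infK by blast
  qed
  have "\<exists>f. bij_betw f (A i) (Field \<kappa>)" if i: "i \<in> I" for i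
  proof -
    interpret sparse_graph "G i" "E i" "low i" using sparse[OF i] .
    have "|A i| =o |G i|" using clop_eqpoll[OF infG[OF i]] unfolding A_def eqpoll_iff_card_of_ordIso .
    also note size[OF i]
    also have "\<kappa> =o |Field \<kappa>|" using fld by (rule ordIso_symmetric)
    finally show ?thesis using card_of_ordIso by blast
  qed
  then obtain f where f: "\<And>i. i \<in> I \<Longrightarrow> bij_betw (f i) (A i) (Field \<kappa>)" by metis
  define M where "M = (\<lambda>i. ba_of (A i) (f i))"
  have injf: "inj_on (f i) (A i)" if "i \<in> I" for i using f[OF that] by (simp add: bij_betw_def)
  have noniso': "i = j" if ij: "i \<in> I" "j \<in> I" and iso: "ba_isomorphic (M i) (M j)" for i j
  proof -
    obtain \<phi> where "bij_betw \<phi> (pts (G i) (E i)) (pts (G j) (E j))"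
      "\<And>a. a \<subseteq> pts (G i) (E i) \<Longrightarrow> a \<in> A i \<longleftrightarrow> \<phi> ` a \<in> A j"
      using homeomorphism_of_ba_isomorphism[OF injf[OF ij(1), unfolded A_def] injf[OF ij(2), unfolded A_def]] iso
      unfolding M_def A_def by blast
    then have "clop_homeo (G i) (E i) (G j) (E j) \<phi>" by (simp add: clop_homeo_def A_def)
    then show ?thesis using noniso ij by blast
  qed
  have refl: "ba_isomorphic (M i) (M i)" if "i \<in> I" for i
    unfolding ba_isomorphic_def ba_isomorphism_def by (intro exI[of _ "\<lambda>x. x"]) (auto simp: bij_betw_def)
  \<comment> \<open>Every algebra is isomorphic to itself, so different indices give different
    algebras and the family has full size.\<close>
  have injM: "inj_on M I" using noniso' refl by (metis (no_types, lifting) inj_onI)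
  show ?thesis
  proof (intro exI[of _ "M ` I"] conjI ballI)
    have "|M ` I| =o |I|" using card_of_ordIsoI[of M I "M ` I"] injM ordIso_symmetric by (auto simp: bij_betw_def)
    then show "|M ` I| =o ctwo ^c \<kappa>" using I by (rule ordIso_transitive)
    show "pairwise (\<lambda>A B. \<not> ba_isomorphic A B) (M ` I)"
      unfolding pairwise_def using noniso' by blast
  next
    fix B assume "B \<in> M ` I"
    then obtain i where i: "i \<in> I" "B = M i" by blast
    interpret sparse_graph "G i" "E i" "low i" using sparse[OF i(1)] .
    interpret set_algebra "pts (G i) (E i)" "A i" "f i"
      using injf[OF i(1)] unfolding A_def by (rule clop_set_algebra)
    show "boolean_lattice B" unfolding i M_def by (rule boolean_lattice_ba)
    show "|carrier B| =o \<kappa>" using f[OF i(1)] fld by (simp add: i M_def bij_betw_def)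
    show "tightly_sigma_filtered B" unfolding i M_def A_def
      by (rule tightly_sigma_filtered_clop) (use injf[OF i(1)] infG[OF i(1)] in \<open>auto simp: A_def\<close>)
    show "ba_ccc B" unfolding i M_def by (rule ccc_ba) (rule clop_ccc, auto simp: A_def)
  qed
qed

text \<open>Basic neighbourhoods of \<open>p\<close>: on finitely many coordinates an isolated value
  is kept, while the limit value \<open>0\<close> may move to any value beyond
  \<open>N\<close>.\<close>

lemma clop_nbhd:
  assumes a: "a \<in> clop X P" and p: "p \<in> a"
  obtains D N where "finite D"
    "\<And>q. q \<in> X \<Longrightarrow> (\<And>g. g \<in> D \<Longrightarrow> q g = p g \<or> p g = 0 \<and> N < q g) \<Longrightarrow> q \<in> a"
proof -
  obtain F where F: "a \<subseteq> X" "finite F" "F \<subseteq> P"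
    "determines X F a" using a by (rule clopE)
  \<comment> \<open>The successor is taken because \<open>Suc k\<close> codes the isolated value
    \<open>k\<close>: beyond \<open>N\<close> every test of \<open>F\<close> fails.\<close>
  define N where "N = Suc (Max (insert 0 (snd ` F)))"
  have N: "Suc k \<le> N" if "(g, k) \<in> F" for g k
    unfolding N_def using that F(2) by (auto intro!: Max_ge image_eqI[of _ snd])
  have "q \<in> a" if q: "q \<in> X" "\<And>g. g \<in> fst ` F \<Longrightarrow> q g = p g \<or> p g = 0 \<and> N < q g" for q
  proof -
    have "agree F p q" unfolding agree_def
    proof (intro allI impI)
      fix g k assume gk: "(g, k) \<in> F"
      then have "g \<in> fst ` F" by force
      from q(2)[OF this] N[OF gk] show "p g = Suc k \<longleftrightarrow> q g = Suc k" by auto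
    qed
    then show ?thesis using F(1,4) p q(1) by blast
  qed
  then show thesis using that[of "fst ` F" N] F(2) by blast
qed

lemma clop_homeo_image:
  assumes "clop_homeo G E G' E' \<phi>"
  shows "image \<phi> ` clop (pts G E) (G \<times> UNIV) = clop (pts G' E') (G' \<times> UNIV)"
proof
  let ?X = "pts G E" and ?X' = "pts G' E'"
  have b: "bij_betw \<phi> ?X ?X'" and c: "\<And>a. a \<subseteq> ?X \<Longrightarrow> a \<in> clop ?X (G \<times> UNIV) \<longleftrightarrow> \<phi> ` a \<in> clop ?X' (G' \<times> UNIV)"
    using assms by (simp_all add: clop_homeo_def)
  show "image \<phi> ` clop ?X (G \<times> UNIV) \<subseteq> clop ?X' (G' \<times> UNIV)"
  proof
    fix b assume "b \<in> image \<phi> ` clop ?X (G \<times> UNIV)"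
    then obtain a where a: "a \<in> clop ?X (G \<times> UNIV)" "b = \<phi> ` a" by blast
    then show "b \<in> clop ?X' (G' \<times> UNIV)" using c[OF clop_subset[OF a(1)]] by simp
  qed
  show "clop ?X' (G' \<times> UNIV) \<subseteq> image \<phi> ` clop ?X (G \<times> UNIV)"
  proof
    fix d assume d: "d \<in> clop ?X' (G' \<times> UNIV)"
    then have "d \<subseteq> \<phi> ` ?X" using b clop_subset[OF d] by (simp add: bij_betw_def)
    then obtain a where a: "a \<subseteq> ?X" "d = \<phi> ` a" by (auto simp: subset_image_iff)
    then have "a \<in> clop ?X (G \<times> UNIV)" using c d by simp
    then show "d \<in> image \<phi> ` clop ?X (G \<times> UNIV)" using a by blast
  qed
qed

section \<open>Countable cardinals\<close>

primrec cb :: "'p set \<Rightarrow> 'p set set \<Rightarrow> nat \<Rightarrow> 'p set" where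
  "cb X A 0 = X"
| "cb X A (Suc n) = {p \<in> cb X A n. \<forall>a\<in>A. p \<in> a \<longrightarrow> (\<exists>q\<in>a \<inter> cb X A n. q \<noteq> p)}"

text \<open>The points of \<open>cb X A m - cb X A (Suc m)\<close> are those of Cantor-Bendixson
  rank \<open>m\<close>. The two clauses make \<open>m\<close> the largest finite rank that
  accumulates at \<open>p\<close>.\<close>

definition cb_type :: "'p set \<Rightarrow> 'p set set \<Rightarrow> nat \<Rightarrow> bool" where
  "cb_type X A m \<longleftrightarrow> (\<exists>p\<in>\<Inter>n. cb X A n.
    (\<forall>a\<in>A. p \<in> a \<longrightarrow> a \<inter> (cb X A m - cb X A (Suc m)) \<noteq> {}) \<and>
    (\<exists>a\<in>A. p \<in> a \<and> a \<inter> cb X A (Suc m) \<subseteq> (\<Inter>n. cb X A n)))"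

section \<open>Invariance of the derivatives under bijections\<close>

lemma cb_subset: "cb X A n \<subseteq> X"
  by (induction n) auto

lemma cb_image:
  assumes inj: "inj_on \<phi> X" and A: "A \<subseteq> Pow X"
  shows "cb (\<phi> ` X) (image \<phi> ` A) n = \<phi> ` cb X A n"
proof (induction n)
  case (Suc n)
  have *: "(\<exists>q\<in>\<phi> ` a \<inter> \<phi> ` cb X A n. q \<noteq> \<phi> p) \<longleftrightarrow> (\<exists>q\<in>a \<inter> cb X A n. q \<noteq> p)"
    if "a \<in> A" "p \<in> X" for a p
  proof -
    have "\<phi> ` a \<inter> \<phi> ` cb X A n = \<phi> ` (a \<inter> cb X A n)"
      using inj_on_image_Int[OF inj, of a "cb X A n"] A that(1) cb_subset[of X A n] by blast
    moreover have "\<phi> q \<noteq> \<phi> p \<longleftrightarrow> q \<noteq> p" if "q \<in> a \<inter> cb X A n" for q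
      using inj_on_eq_iff[OF inj, of q p] that \<open>p \<in> X\<close> cb_subset[of X A n] by blast
    ultimately show ?thesis by simp
  qed
  have mem: "\<phi> p \<in> \<phi> ` a \<longleftrightarrow> p \<in> a" if "a \<in> A" "p \<in> X" for a p
    using inj_on_image_mem_iff[OF inj that(2)] A that(1) by blast
  show ?case
  proof (intro equalityI subsetI)
    fix y assume y: "y \<in> cb (\<phi> ` X) (image \<phi> ` A) (Suc n)"
    then obtain p where p: "p \<in> cb X A n" "y = \<phi> p" using Suc by auto
    then have pX: "p \<in> X" using cb_subset[of X A n] by auto
    have "\<exists>q\<in>a \<inter> cb X A n. q \<noteq> p" if "a \<in> A" "p \<in> a" for a
      using y that *[OF that(1) pX] unfolding p(2) by (auto simp: Suc)
    then show "y \<in> \<phi> ` cb X A (Suc n)" using p by simp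
  next
    fix y assume "y \<in> \<phi> ` cb X A (Suc n)"
    then obtain p where p: "p \<in> cb X A (Suc n)" "y = \<phi> p" by blast
    then have pX: "p \<in> X" using cb_subset[of X A n] by auto
    have "\<exists>q\<in>b \<inter> \<phi> ` cb X A n. q \<noteq> \<phi> p" if b: "b \<in> image \<phi> ` A" "\<phi> p \<in> b" for b
    proof -
      obtain a where a: "a \<in> A" "b = \<phi> ` a" using b(1) by blast
      then have "p \<in> a" using mem[OF a(1) pX] b(2) by simp
      then show ?thesis using *[OF a(1) pX] p(1) a by simp
    qed
    then show "y \<in> cb (\<phi> ` X) (image \<phi> ` A) (Suc n)" using p by (simp add: Suc)
  qed
qed simp

lemma cb_type_image:
  assumes inj: "inj_on \<phi> X" and A: "A \<subseteq> Pow X" and t: "cb_type X A m"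
  shows "cb_type (\<phi> ` X) (image \<phi> ` A) m"
proof -
  obtain p a where p: "p \<in> (\<Inter>n. cb X A n)" "\<And>a. a \<in> A \<Longrightarrow> p \<in> a \<Longrightarrow> a \<inter> (cb X A m - cb X A (Suc m)) \<noteq> {}"
    and a: "a \<in> A" "p \<in> a" "a \<inter> cb X A (Suc m) \<subseteq> (\<Inter>n. cb X A n)"
    using t unfolding cb_type_def by metis
  have sub: "cb X A n \<subseteq> X" for n by (rule cb_subset)
  have "p \<in> cb X A 0" using p(1) by blast
  then have pX: "p \<in> X" by simp
  have mem: "\<phi> p \<in> \<phi> ` b \<longleftrightarrow> p \<in> b" if "b \<in> A" for b
    using inj_on_image_mem_iff[OF inj pX] A that by blast
  have int: "\<phi> ` b \<inter> \<phi> ` c = \<phi> ` (b \<inter> c)" if "b \<in> A" "c \<subseteq> X" for b c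
    using inj_on_image_Int[OF inj, of b c] A that by blast
  have diff: "\<phi> ` b - \<phi> ` c = \<phi> ` (b - c)" if "b \<subseteq> X" "c \<subseteq> X" for b c
    using inj_on_image_set_diff[OF inj, of b c] that by blast
  show ?thesis
    unfolding cb_type_def cb_image[OF inj A]
  proof (intro bexI[of _ "\<phi> p"] conjI ballI impI)
    show "\<phi> p \<in> (\<Inter>n. \<phi> ` cb X A n)" using p(1) by blast
  next
    fix b assume b: "b \<in> image \<phi> ` A" "\<phi> p \<in> b"
    then obtain c where c: "c \<in> A" "b = \<phi> ` c" by blast
    then have "c \<inter> (cb X A m - cb X A (Suc m)) \<noteq> {}" using p(2) mem b(2) by simp
    moreover have "b \<inter> (\<phi> ` cb X A m - \<phi> ` cb X A (Suc m)) = \<phi> ` (c \<inter> (cb X A m - cb X A (Suc m)))"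
      unfolding c(2) diff[OF sub sub] by (rule int[OF c(1)]) (use sub in blast)
    ultimately show "b \<inter> (\<phi> ` cb X A m - \<phi> ` cb X A (Suc m)) \<noteq> {}" by simp
  next
    have "\<phi> ` a \<inter> \<phi> ` cb X A (Suc m) = \<phi> ` (a \<inter> cb X A (Suc m))" by (rule int[OF a(1) sub])
    then show "\<exists>b\<in>image \<phi> ` A. \<phi> p \<in> b \<and> b \<inter> \<phi> ` cb X A (Suc m) \<subseteq> (\<Inter>n. \<phi> ` cb X A n)"
      using a by (intro bexI[of _ "\<phi> ` a"]) auto
  qed
qed

text \<open>The vertices of the block \<open>n\<close> are \<open>(n, 0, 0)\<close>, an infinite independent set
  \<open>(n, 1, j)\<close> whose presence puts a point into the kernel, and \<open>(n, 2, j)\<close> with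
  \<open>j \<le> n\<close>. A point using some \<open>(n, 2, j)\<close> has as rank the number of its zeros among
  \<open>(n, 0, 0)\<close> and the \<open>(n, 2, j)\<close>.\<close>

definition cgraph :: "nat set \<Rightarrow> (nat \<times> nat \<times> nat) set" where
  "cgraph S = {(n, c, j). n \<in> S \<and> (c = 0 \<and> j = 0 \<or> c = 1 \<or> c = 2 \<and> j \<le> n)}"

text \<open>Different blocks are joined completely, so a point uses vertices of one block only and
  the blocks meet just in the zero point. Within a block, using some \<open>(n, 1, i)\<close>
  excludes every \<open>(n, 2, j)\<close>.\<close>

definition cedge :: "nat \<times> nat \<times> nat \<Rightarrow> nat \<times> nat \<times> nat \<Rightarrow> bool" where
  "cedge g h \<longleftrightarrow> fst g \<noteq> fst h \<or> fst (snd g) = 1 \<and> fst (snd h) = 2 \<or> fst (snd g) = 2 \<and> fst (snd h) = 1"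

text \<open>An enumeration makes all vertices comparable, with finite initial segments.\<close>

lemma sparse_graph_cgraph:
  "sparse_graph (cgraph S) cedge (\<lambda>g. {h \<in> cgraph S. to_nat h \<le> to_nat g})"
proof
  fix g show "finite {h \<in> cgraph S. to_nat h \<le> to_nat g}"
    by (rule finite_subset[of _ "to_nat -` {..to_nat g}"]) (auto intro: finite_vimageI)
qed (auto simp: cedge_def)

definition slots :: "nat \<Rightarrow> (nat \<times> nat \<times> nat) set" where
  "slots n = insert (n, 0, 0) ((\<lambda>j. (n, 2, j)) ` {..n})"

lemma finite_slots [simp]: "finite (slots n)"
  by (simp add: slots_def)

section \<open>Derivatives of the block spaces\<close>

context
  fixes S :: "nat set"
begin

abbreviation (input) "CX \<equiv> pts (cgraph S) cedge"
abbreviation (input) "CA \<equiv> clop (pts (cgraph S) cedge) (cgraph S \<times> UNIV)"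

definition perf :: "(nat \<times> nat \<times> nat \<Rightarrow> nat) set" where
  "perf = {p \<in> pts (cgraph S) cedge. \<forall>n j. p (n, 2, j) = 0}"

definition free :: "nat \<Rightarrow> (nat \<times> nat \<times> nat \<Rightarrow> nat) \<Rightarrow> (nat \<times> nat \<times> nat) set" where
  "free n p = {g \<in> slots n. p g = 0}"

text \<open>The block \<open>n\<close> is determined by the nonzero coordinate
  \<open>(n, 2, j)\<close>. Each free slot sits at its limit value and contributes one to the
  rank.\<close>

definition rank_ge :: "nat \<Rightarrow> (nat \<times> nat \<times> nat \<Rightarrow> nat) set" where
  "rank_ge m = {p \<in> pts (cgraph S) cedge. \<exists>n j. p (n, 2, j) \<noteq> 0 \<and> m \<le> card (free n p)}"

lemma finite_free [simp]: "finite (free n p)"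
  by (simp add: free_def)

lemma pts_same_block: "p \<in> CX \<Longrightarrow> p g \<noteq> 0 \<Longrightarrow> p h \<noteq> 0 \<Longrightarrow> fst g = fst h"
  using pts_edge[of p "cgraph S" cedge g h] by (auto simp: cedge_def)

lemma pts_block:
  assumes p: "p \<in> CX" and S: "S \<noteq> {}"
  obtains n where "n \<in> S" "\<And>g. fst g \<noteq> n \<Longrightarrow> p g = 0"
proof (cases "\<exists>g. p g \<noteq> 0")
  case True
  then obtain g where g: "p g \<noteq> 0" by blast
  then have "g \<in> cgraph S" using pts_outside[OF p, of g] by (cases "g \<in> cgraph S") auto
  then have "fst g \<in> S" by (auto simp: cgraph_def)
  moreover have "p h = 0" if "fst h \<noteq> fst g" for h
    using pts_same_block[OF p g, of h] that by (cases "p h = 0") auto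
  ultimately show thesis by (rule that)
next
  case False
  obtain n where "n \<in> S" using S by blast
  moreover have "p g = 0" for g using False by (rule contrapos_np) (rule exI)
  ultimately show thesis by (rule that)
qed

lemma pts_no_cantor: "p \<in> CX \<Longrightarrow> p (n, 2, j) \<noteq> 0 \<Longrightarrow> p (m, 1, i) = 0"
  using pts_edge[of p "cgraph S" cedge "(n, 2, j)" "(m, 1, i)"] by (auto simp: cedge_def)

lemma pts_in: "p \<in> CX \<Longrightarrow> p (n, c, j) \<noteq> 0 \<Longrightarrow> n \<in> S \<and> (c = 0 \<and> j = 0 \<or> c = 1 \<or> c = 2 \<and> j \<le> n)"
  using pts_outside[of p "cgraph S" cedge "(n, c, j)"] by (auto simp: cgraph_def)

text \<open>Within its block a slot is adjacent at most to vertices \<open>(n, 1, j)\<close>; these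
  vanish at \<open>p\<close>, as do all other blocks.\<close>

lemma pts_update_slot:
  assumes p: "p \<in> CX" and n: "n \<in> S" "\<And>g. fst g \<noteq> n \<Longrightarrow> p g = 0" and g: "g \<in> slots n"
    and c: "\<And>j. p (n, 1, j) = 0"
  shows "p(g := v) \<in> CX"
proof (rule ptsI)
  fix h assume "h \<notin> cgraph S"
  moreover have "g \<in> cgraph S" using g n by (auto simp: slots_def cgraph_def)
  ultimately show "(p(g := v)) h = 0" using pts_outside[OF p] by auto
next
  have *: "p h = 0" if "cedge g h" for h
  proof (cases "fst h = n")
    case True
    then have "fst (snd h) = 1" using that g by (auto simp: cedge_def slots_def)
    then have "h = (n, 1, snd (snd h))" using True by (simp add: prod_eq_iff)
    then show ?thesis using c[of "snd (snd h)"] by simp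
  qed (use n in blast)
  fix h k assume hk: "cedge h k"
  then have kh: "cedge k h" by (auto simp: cedge_def)
  have "h \<noteq> k" using hk by (auto simp: cedge_def)
  show "(p(g := v)) h = 0 \<or> (p(g := v)) k = 0"
    using * hk kh pts_edge[OF p hk] \<open>h \<noteq> k\<close> by (cases "h = g"; cases "k = g") auto
qed

lemma perf_disjoint: "p \<in> perf \<Longrightarrow> p (n, 2, j) = 0"
  by (simp add: perf_def)

text \<open>Of the \<open>n + 2\<close> slots at least two are occupied.\<close>

lemma card_free_le: "p (n, 0, 0) \<noteq> 0 \<Longrightarrow> p (n, 2, j) \<noteq> 0 \<Longrightarrow> j \<le> n \<Longrightarrow> card (free n p) \<le> n"
proof -
  assume *: "p (n, 0, 0) \<noteq> 0" "p (n, 2, j) \<noteq> 0" "j \<le> n"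
  have "free n p \<subseteq> (\<lambda>j. (n, 2, j)) ` ({..n} - {j})"
  proof
    fix g assume "g \<in> free n p"
    then have g: "g \<in> slots n" "p g = 0" by (simp_all add: free_def)
    then obtain i where "g = (n, 2, i)" "i \<le> n" using *(1) by (auto simp: slots_def)
    then show "g \<in> (\<lambda>j. (n, 2, j)) ` ({..n} - {j})" using *(2) g(2) by (cases "i = j") auto
  qed
  then have "card (free n p) \<le> card ((\<lambda>j. (n, 2 :: nat, j)) ` ({..n} - {j}))" by (intro card_mono) auto
  also have "\<dots> \<le> card ({..n} - {j})" by (rule card_image_le) simp
  also have "\<dots> = n" using * by simp
  finally show ?thesis .
qed

lemma card_free_ge: "(\<And>j. j \<ge> 1 \<Longrightarrow> p (n, 2, j) = 0) \<Longrightarrow> n \<le> card (free n p)"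
proof -
  assume *: "\<And>j. j \<ge> 1 \<Longrightarrow> p (n, 2, j) = 0"
  have "card ((\<lambda>j. (n, 2 :: nat, j)) ` {1..n}) \<le> card (free n p)"
    by (intro card_mono) (use * in \<open>auto simp: free_def slots_def\<close>)
  moreover have "card ((\<lambda>j. (n, 2 :: nat, j)) ` {1..n}) = n" by (subst card_image) (auto simp: inj_on_def)
  ultimately show ?thesis by simp
qed

lemma card_free_ge_Suc: "(\<And>j. j \<ge> 1 \<Longrightarrow> p (n, 2, j) = 0) \<Longrightarrow> p (n, 0, 0) = 0 \<Longrightarrow> Suc n \<le> card (free n p)"
proof -
  assume *: "\<And>j. j \<ge> 1 \<Longrightarrow> p (n, 2, j) = 0" "p (n, 0, 0) = 0"
  have "card (insert (n, 0, 0) ((\<lambda>j. (n, 2 :: nat, j)) ` {1..n})) \<le> card (free n p)"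
    by (intro card_mono) (use * in \<open>auto simp: free_def slots_def\<close>)
  moreover have "card ((\<lambda>j. (n, 2 :: nat, j)) ` {1..n}) = n" by (subst card_image) (auto simp: inj_on_def)
  ultimately show ?thesis by (simp add: card_insert_if image_iff)
qed

text \<open>Induction on \<open>m\<close>. Points of \<open>perf\<close> are limits of points of
  \<open>perf\<close>. Outside \<open>perf\<close>, a point with a free slot is a limit of points
  with one free slot fewer, and a point with exactly \<open>m\<close> free slots is isolated in the
  \<open>m\<close>-th derivative by its values at the occupied slots.\<close>

lemma cb_cgraph:
  assumes S: "S \<noteq> {}"
  shows "cb CX CA m = perf \<union> rank_ge m"
proof (induction m)
  case 0
  show ?case by (auto simp: perf_def rank_ge_def)
next
  case (Suc m)
  let ?R = "perf \<union> rank_ge m"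
  have lim1: "(\<exists>q\<in>a \<inter> ?R. q \<noteq> p)" if p: "p \<in> perf \<union> rank_ge (Suc m)" and a: "a \<in> CA" "p \<in> a" for p a
  proof -
    have pX: "p \<in> CX" using p by (auto simp: perf_def rank_ge_def)
    obtain D N where D: "finite D" "\<And>q. q \<in> CX \<Longrightarrow> (\<And>g. g \<in> D \<Longrightarrow> q g = p g \<or> p g = 0 \<and> N < q g) \<Longrightarrow> q \<in> a"
      using clop_nbhd[OF a] by blast
    obtain n where n: "n \<in> S" "\<And>g. fst g \<noteq> n \<Longrightarrow> p g = 0" using pts_block[OF pX S] by blast
    show ?thesis
    proof (cases "p \<in> perf")
      case True
      have "infinite ((\<lambda>j. (n, 1 :: nat, j)) ` (UNIV :: nat set))"
        by (subst finite_image_iff) (auto simp: inj_on_def)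
      then have "\<not> range (\<lambda>j. (n, 1 :: nat, j :: nat)) \<subseteq> D" using D(1) finite_subset by blast
      then obtain g where g: "g \<in> range (\<lambda>j. (n, 1 :: nat, j))" "g \<notin> D" by blast
      \<comment> \<open>Since \<open>g\<close> is outside \<open>D\<close>, any value is allowed
        there; raising it by one stays in \<open>perf\<close> and differs from
        \<open>p\<close>.\<close>
      define q where "q = p(g := Suc (p g))"
      have w: "q (i, 2, j) = 0" for i j using perf_disjoint[OF True] g by (auto simp: q_def)
      have "q \<in> CX"
      proof (rule ptsI)
        fix h assume "h \<notin> cgraph S"
        moreover have "g \<in> cgraph S" using g n by (auto simp: cgraph_def)
        ultimately show "q h = 0" using pts_outside[OF pX] by (auto simp: q_def)
      next
        have *: "q h = 0" if "cedge g h" for h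
        proof (cases "fst h = n")
          case True
          then have "fst (snd h) = 2" using that g by (auto simp: cedge_def)
          then have "h = (n, 2, snd (snd h))" using True by (simp add: prod_eq_iff)
          then show ?thesis using w[of n "snd (snd h)"] by simp
        next
          case False
          then show ?thesis using n(2)[of h] g by (auto simp: q_def)
        qed
        fix h k assume hk: "cedge h k"
        then have kh: "cedge k h" by (auto simp: cedge_def)
        show "q h = 0 \<or> q k = 0"
          using *[of h] *[of k] hk kh pts_edge[OF pX hk] by (cases "h = g"; cases "k = g") (auto simp: q_def)
      qed
      moreover have "q h = p h" if "h \<in> D" for h using g that by (auto simp: q_def)
      ultimately have "q \<in> a" using D(2) by blast
      moreover have "q \<in> perf" using \<open>q \<in> CX\<close> w by (simp add: perf_def)
      moreover have "q g \<noteq> p g" by (simp add: q_def)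
      ultimately show ?thesis by (intro bexI[of _ q]) auto
    next
      case False
      then obtain i j where ij: "p (i, 2, j) \<noteq> 0" "Suc m \<le> card (free i p)" using p by (auto simp: rank_ge_def)
      have "i = n" using n(2)[of "(i, 2, j)"] ij by auto
      have "free n p \<noteq> {}" using ij \<open>i = n\<close> by auto
      then obtain g where "g \<in> free n p" by blast
      then have g: "g \<in> slots n" "p g = 0" by (auto simp: free_def)
      \<comment> \<open>Filling a free slot beyond \<open>N\<close> stays in the neighbourhood and
        lowers the number of free slots by one.\<close>
      define q where "q = p(g := Suc N)"
      have "q \<in> CX" unfolding q_def
        using pts_update_slot[OF pX n g(1)] pts_no_cantor[OF pX ij(1)] by blast
      moreover have "q h = p h \<or> p h = 0 \<and> N < q h" for h using g by (auto simp: q_def)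
      ultimately have "q \<in> a" using D(2) by blast
      moreover have "q \<in> rank_ge m"
      proof -
        have "free n q = free n p - {g}" by (auto simp: free_def q_def)
        moreover have "g \<in> free n p" using g by (simp add: free_def)
        ultimately have "m \<le> card (free n q)" using ij \<open>i = n\<close> by simp
        moreover have "q (n, 2, j) \<noteq> 0" using ij \<open>i = n\<close> by (auto simp: q_def)
        ultimately show ?thesis using \<open>q \<in> CX\<close> unfolding rank_ge_def by blast
      qed
      moreover have "q g \<noteq> p g" using g by (simp add: q_def)
      ultimately show ?thesis by (intro bexI[of _ q]) auto
    qed
  qed
  have lim2: "p \<in> perf \<union> rank_ge (Suc m)"
    if p: "p \<in> ?R" and lim: "\<And>a. a \<in> CA \<Longrightarrow> p \<in> a \<Longrightarrow> \<exists>q\<in>a \<inter> ?R. q \<noteq> p" for p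
  proof (rule ccontr)
    assume neg: "p \<notin> perf \<union> rank_ge (Suc m)"
    have pX: "p \<in> CX" using p by (auto simp: perf_def rank_ge_def)
    obtain n j where nj: "p (n, 2, j) \<noteq> 0" "m \<le> card (free n p)" using p neg by (auto simp: rank_ge_def)
    have "p \<in> rank_ge (Suc m)" if "Suc m \<le> card (free n p)"
      unfolding rank_ge_def using nj(1) pX that by blast
    then have "\<not> Suc m \<le> card (free n p)" using neg by blast
    then have card: "card (free n p) = m" using nj by simp
    have nS: "n \<in> S" "j \<le> n" using pts_in[OF pX nj(1)] by auto
    have sG: "slots n \<subseteq> cgraph S" using nS by (auto simp: slots_def cgraph_def)
    define I where "I = {g \<in> slots n. p g \<noteq> 0}"
    \<comment> \<open>In \<open>a\<close> the occupied slots of \<open>p\<close> stay occupied. A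
      point \<open>q\<close> with at least \<open>m\<close> free slots then has the same free slots
      as \<open>p\<close>, and both points vanish outside the slots.\<close>
    define a where "a = {q \<in> CX. \<forall>g\<in>I. q \<in> cyl CX (g, p g - 1)}"
    have "a \<in> CA" unfolding a_def by (rule clop_Inter) (use sG in \<open>auto simp: I_def\<close>)
    moreover have "p \<in> a" using pX by (auto simp: a_def I_def cyl_def)
    ultimately obtain q where q: "q \<in> a" "q \<in> ?R" "q \<noteq> p" using lim by blast
    have qX: "q \<in> CX" and qI: "\<And>g. g \<in> slots n \<Longrightarrow> p g \<noteq> 0 \<Longrightarrow> q g = p g"
      using q(1) by (auto simp: a_def I_def cyl_def)
    have "(n, 2, j) \<in> slots n" using nS by (auto simp: slots_def)
    then have qn: "q (n, 2, j) \<noteq> 0" using qI nj by auto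
    then have "q \<in> rank_ge m" using q(2) perf_disjoint[of q n j] qn by blast
    then obtain i l where il: "q (i, 2, l) \<noteq> 0" "m \<le> card (free i q)" by (auto simp: rank_ge_def)
    have "i = n" using pts_same_block[OF qX qn il(1)] by simp
    have "free n q \<subseteq> free n p"
    proof
      fix g assume "g \<in> free n q"
      then show "g \<in> free n p" using qI[of g] by (cases "p g = 0") (auto simp: free_def)
    qed
    then have "free n q = free n p" using card il \<open>i = n\<close> by (intro card_seteq) auto
    have "q g = p g" for g
    proof (cases "g \<in> slots n")
      case True
      show ?thesis
      proof (cases "p g = 0")
        case T: True
        then have "g \<in> free n q" using \<open>free n q = free n p\<close> True by (simp add: free_def)
        then show ?thesis using T by (simp add: free_def)
      qed (use qI True in blast)
    next
      case False
      obtain i c l where g: "g = (i, c, l)" by (rule prod_cases3)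
      have "r g = 0" if r: "r \<in> CX" "r (n, 2, j) \<noteq> 0" for r
      proof (rule ccontr)
        assume nz: "r g \<noteq> 0"
        then have "i = n" using pts_same_block[OF r(1) r(2) nz] g by simp
        moreover have "c \<noteq> 1" using pts_no_cantor[OF r, of i l] nz g by auto
        ultimately have "g \<in> slots n" using pts_in[OF r(1), of i c l] nz g by (auto simp: slots_def)
        then show False using False by simp
      qed
      from this[OF pX nj(1)] this[OF qX qn] show ?thesis by simp
    qed
    then show False using q(3) by blast
  qed
  have "rank_ge (Suc m) \<subseteq> rank_ge m" unfolding rank_ge_def using Suc_leD by blast
  then have sub: "perf \<union> rank_ge (Suc m) \<subseteq> ?R" by blast
  show ?case
    unfolding cb.simps Suc
  proof (intro equalityI subsetI CollectI conjI ballI impI)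
    fix p assume "p \<in> perf \<union> rank_ge (Suc m)"
    then show "p \<in> ?R" using sub by blast
  next
    fix p a assume "p \<in> perf \<union> rank_ge (Suc m)" "a \<in> CA" "p \<in> a"
    then show "\<exists>q\<in>a \<inter> ?R. q \<noteq> p" by (rule lim1)
  next
    fix p assume "p \<in> {p \<in> ?R. \<forall>a\<in>CA. p \<in> a \<longrightarrow> (\<exists>q\<in>a \<inter> ?R. q \<noteq> p)}"
    then have "p \<in> ?R" "\<And>a. a \<in> CA \<Longrightarrow> p \<in> a \<Longrightarrow> \<exists>q\<in>a \<inter> ?R. q \<noteq> p" by simp_all
    then show "p \<in> perf \<union> rank_ge (Suc m)" by (rule lim2)
  qed
qed

text \<open>Outside \<open>perf\<close> the number of free slots is a finite rank, so the point is
  lost at some finite derivative.\<close>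

lemma cb_kernel_cgraph:
  assumes S: "S \<noteq> {}"
  shows "(\<Inter>m. cb CX CA m) = perf"
proof
  show "perf \<subseteq> (\<Inter>m. cb CX CA m)" unfolding cb_cgraph[OF S] by blast
  show "(\<Inter>m. cb CX CA m) \<subseteq> perf"
  proof
    fix p assume *: "p \<in> (\<Inter>m. cb CX CA m)"
    show "p \<in> perf"
    proof (rule ccontr)
      assume np: "p \<notin> perf"
      have all: "p \<in> rank_ge m" for m using * np unfolding cb_cgraph[OF S] by blast
      obtain n j where nj: "p (n, 2, j) \<noteq> 0" using all[of 0] by (auto simp: rank_ge_def)
      have pX: "p \<in> CX" using all[of 0] by (simp add: rank_ge_def)
      obtain i l where il: "p (i, 2, l) \<noteq> 0" "Suc (card (free n p)) \<le> card (free i p)"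
        using all[of "Suc (card (free n p))"] by (auto simp: rank_ge_def)
      then show False using pts_same_block[OF pX nj il(1)] by simp
    qed
  qed
qed

text \<open>A witness of type \<open>m\<close> vanishes except possibly at one vertex
  \<open>(n, 0, 0)\<close>. If it is nonzero there, the nearby finite ranks are at most
  \<open>n\<close> and attain \<open>n\<close>, so \<open>m = n\<close>. The zero point is a limit
  of points of unbounded finite rank, as \<open>S\<close> is infinite, and witnesses no
  type.\<close>

lemma cb_type_cgraph:
  assumes inf: "infinite S"
  shows "cb_type CX CA m \<longleftrightarrow> m \<in> S"
proof -
  have S: "S \<noteq> {}" using inf by auto
  note cbS = cb_cgraph[OF S] cb_kernel_cgraph[OF S]
  have rank_le: "m' \<le> n" if r: "q \<in> rank_ge m'" "q (n, 0, 0) \<noteq> 0" for q n m'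
  proof -
    have qX: "q \<in> CX" using r by (simp add: rank_ge_def)
    obtain i j where ij: "q (i, 2, j) \<noteq> 0" "m' \<le> card (free i q)" using r by (auto simp: rank_ge_def)
    have "i = n" using pts_same_block[OF qX ij(1) r(2)] by simp
    moreover have "j \<le> i" using pts_in[OF qX ij(1)] by simp
    ultimately show ?thesis using card_free_le[of q n j] ij r(2) by simp
  qed
  show ?thesis
  proof
    assume m: "m \<in> S"
    \<comment> \<open>Occupying \<open>(m, 0, 0)\<close> keeps nearby finite ranks at most
      \<open>m\<close>; occupying one more slot gives rank exactly \<open>m\<close>.\<close>
    define p :: "nat \<times> nat \<times> nat \<Rightarrow> nat" where "p = (\<lambda>g. if g = (m, 0, 0) then 1 else 0)"
    have pX: "p \<in> CX" using m by (intro ptsI) (auto simp: p_def cgraph_def cedge_def)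
    have pp: "p \<in> perf" using pX by (auto simp: perf_def p_def)
    have 1: "a \<inter> (perf \<union> rank_ge m - (perf \<union> rank_ge (Suc m))) \<noteq> {}" if a: "a \<in> CA" "p \<in> a" for a
    proof -
      obtain D N where D: "finite D" "\<And>q. q \<in> CX \<Longrightarrow> (\<And>g. g \<in> D \<Longrightarrow> q g = p g \<or> p g = 0 \<and> N < q g) \<Longrightarrow> q \<in> a"
        using clop_nbhd[OF a] by blast
      define q where "q = p((m, 2, 0) := Suc N)"
      have qX: "q \<in> CX" unfolding q_def
        by (rule pts_update_slot[OF pX m]) (auto simp: p_def slots_def)
      have "q \<in> a" by (rule D(2)[OF qX]) (auto simp: q_def p_def)
      moreover have "q (m, 2, 0) \<noteq> 0" by (simp add: q_def)
      moreover have "m \<le> card (free m q)" by (rule card_free_ge) (auto simp: q_def p_def)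
      moreover have "q \<notin> rank_ge (Suc m)" using rank_le[of q "Suc m" m] by (auto simp: q_def p_def)
      moreover have "q \<in> rank_ge m" unfolding rank_ge_def using qX calculation(2,3) by blast
      moreover have "q \<notin> perf" using perf_disjoint[of q m 0] calculation(2) by blast
      ultimately show ?thesis by blast
    qed
    have 2: "cyl CX ((m, 0, 0), 0) \<inter> (perf \<union> rank_ge (Suc m)) \<subseteq> perf"
      using rank_le[of _ "Suc m" m] by (fastforce simp: cyl_def)
    show "cb_type CX CA m"
      unfolding cb_type_def cbS
    proof (intro bexI[OF _ pp] conjI ballI impI)
      show "\<exists>a\<in>CA. p \<in> a \<and> a \<inter> (perf \<union> rank_ge (Suc m)) \<subseteq> perf"
      proof (intro bexI[of _ "cyl CX ((m, 0, 0), 0)"] conjI)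
        show "cyl CX ((m, 0, 0), 0) \<in> CA" by (rule cyl_clop) (simp add: cgraph_def m)
        show "p \<in> cyl CX ((m, 0, 0), 0)" using pX by (simp add: cyl_def p_def)
      qed (rule 2)
    qed (use 1 in blast)
  next
    assume "cb_type CX CA m"
    from this[unfolded cb_type_def cbS] obtain p where p: "p \<in> perf"
      and c: "(\<forall>a\<in>CA. p \<in> a \<longrightarrow> a \<inter> (perf \<union> rank_ge m - (perf \<union> rank_ge (Suc m))) \<noteq> {}) \<and>
        (\<exists>a\<in>CA. p \<in> a \<and> a \<inter> (perf \<union> rank_ge (Suc m)) \<subseteq> perf)" by (rule bexE)
    note 1 = conjunct1[OF c] and ex = conjunct2[OF c]
    obtain a where a: "a \<in> CA" "p \<in> a" "a \<inter> (perf \<union> rank_ge (Suc m)) \<subseteq> perf"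
      using ex by (elim bexE conjE)
    note 1 = mp[OF bspec[OF 1]]
    have pX: "p \<in> CX" using p by (simp add: perf_def)
    obtain D N where D: "finite D" "\<And>q. q \<in> CX \<Longrightarrow> (\<And>g. g \<in> D \<Longrightarrow> q g = p g \<or> p g = 0 \<and> N < q g) \<Longrightarrow> q \<in> a"
      using clop_nbhd[OF a(1,2)] by blast
    obtain n where n: "n \<in> S" "\<And>g. fst g \<noteq> n \<Longrightarrow> p g = 0" using pts_block[OF pX S] by blast
    have w: "p (i, 2, j) = 0" for i j using perf_disjoint[OF p] .
    \<comment> \<open>A nonzero value at \<open>(i, 1, j)\<close> persists in a neighbourhood and
      keeps all points of finite rank out of it.\<close>
    have c: "p (i, 1, j) = 0" for i j
    proof (rule ccontr)
      assume nz: "p (i, 1, j) \<noteq> 0"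
      have "i \<in> S" using pts_in[OF pX nz] by simp
      then have "cyl CX ((i, 1, j), p (i, 1, j) - 1) \<in> CA" by (intro cyl_clop) (simp add: cgraph_def)
      moreover have "p \<in> cyl CX ((i, 1, j), p (i, 1, j) - 1)" using nz pX by (simp add: cyl_def)
      ultimately obtain q where q: "q \<in> cyl CX ((i, 1, j), p (i, 1, j) - 1)" "q \<in> rank_ge m"
        using 1 by blast
      then obtain k l where kl: "q (k, 2, l) \<noteq> 0" by (auto simp: rank_ge_def)
      have "q \<in> CX" "q (i, 1, j) \<noteq> 0" using q(1) by (auto simp: cyl_def)
      then show False using pts_no_cantor[of q k l i j] kl by simp
    qed
    have noq: False if "q \<in> CX" "q \<in> rank_ge (Suc m)" "\<And>g. q g = p g \<or> p g = 0 \<and> N < q g" for q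
    proof -
      have "q \<in> a" using D(2) that by blast
      then have "q \<in> perf" using a(3) that(2) by blast
      then show False using that(2) perf_disjoint[of q] by (auto simp: rank_ge_def)
    qed
    show "m \<in> S"
    proof (cases "p (n, 0, 0) = 0")
      case True
      have p0: "p g = 0" for g
      proof (rule ccontr)
        assume nz: "p g \<noteq> 0"
        obtain i d l where g: "g = (i, d, l)" by (rule prod_cases3)
        have "i = n" using n(2)[of g] nz g by auto
        moreover have "d = 0 \<and> l = 0" using pts_in[OF pX, of i d l] nz g c w by auto
        ultimately show False using nz g True by simp
      qed
      \<comment> \<open>Near the zero point, a single occupied slot in block \<open>k\<close> leaves
        \<open>k + 1\<close> free ones, more than \<open>m\<close>.\<close>
      obtain k where k: "k \<in> S" "m \<le> k" using inf by (meson infinite_nat_iff_unbounded_le)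
      define q where "q = p((k, 2, 0) := Suc N)"
      have qX: "q \<in> CX" unfolding q_def
        by (rule pts_update_slot[OF pX k(1)]) (auto simp: p0 slots_def)
      have "Suc k \<le> card (free k q)" by (rule card_free_ge_Suc) (auto simp: q_def p0)
      then have "q \<in> rank_ge (Suc m)" using qX k unfolding rank_ge_def
        by (intro CollectI conjI exI[of _ k] exI[of _ 0]) (auto simp: q_def)
      then have False by (rule noq[OF qX]) (simp add: q_def p0)
      then show ?thesis ..
    next
      case False
      have "cyl CX ((n, 0, 0), p (n, 0, 0) - 1) \<in> CA" using n by (intro cyl_clop) (simp add: cgraph_def)
      moreover have "p \<in> cyl CX ((n, 0, 0), p (n, 0, 0) - 1)" using False pX by (simp add: cyl_def)
      ultimately obtain q where q: "q \<in> cyl CX ((n, 0, 0), p (n, 0, 0) - 1)" "q \<in> rank_ge m"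
        using 1 by blast
      then have "m \<le> n" using rank_le[of q m n] by (auto simp: cyl_def)
      moreover have "\<not> Suc m \<le> n"
      proof
        assume le: "Suc m \<le> n"
        define q where "q = p((n, 2, 0) := Suc N)"
        have qX: "q \<in> CX" unfolding q_def
          by (rule pts_update_slot[OF pX n _ c]) (auto simp: slots_def)
        have "n \<le> card (free n q)" by (rule card_free_ge) (auto simp: q_def w)
        then have "q \<in> rank_ge (Suc m)" using qX le unfolding rank_ge_def
          by (intro CollectI conjI exI[of _ n] exI[of _ 0]) (auto simp: q_def)
        then show False by (rule noq[OF qX]) (simp add: q_def w)
      qed
      ultimately show ?thesis using n(1) by (metis not_less_eq_eq le_antisym)
    qed
  qed
qed

end

lemma clop_homeo_cgraph:
  assumes "infinite S" "infinite S'" and h: "clop_homeo (cgraph S) cedge (cgraph S') cedge \<phi>"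
  shows "S = S'"
proof -
  let ?X = "pts (cgraph S) cedge" and ?X' = "pts (cgraph S') cedge"
  let ?A = "clop ?X (cgraph S \<times> UNIV)" and ?A' = "clop ?X' (cgraph S' \<times> UNIV)"
  have b: "bij_betw \<phi> ?X ?X'" using h by (simp add: clop_homeo_def)
  have im: "image \<phi> ` ?A = ?A'" by (rule clop_homeo_image[OF h])
  have sub: "?A \<subseteq> Pow ?X" using clop_subset by blast
  define \<psi> where "\<psi> = inv_into ?X \<phi>"
  have \<psi>: "inj_on \<psi> ?X'" "\<psi> ` ?X' = ?X" using bij_betw_inv_into[OF b] by (auto simp: \<psi>_def bij_betw_def)
  have inv: "image \<psi> ` ?A' = ?A"
  proof -
    have "\<psi> ` \<phi> ` a = a" if "a \<in> ?A" for a
      using b clop_subset[OF that] unfolding \<psi>_def by (simp add: bij_betw_def inv_into_image_cancel)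
    then show ?thesis unfolding im[symmetric] image_image by simp
  qed
  have sub': "?A' \<subseteq> Pow ?X'" using clop_subset by blast
  have "cb_type ?X ?A m \<longleftrightarrow> cb_type ?X' ?A' m" for m
    using cb_type_image[of \<phi> ?X ?A m] cb_type_image[OF \<psi>(1) sub', of m] b sub im inv \<psi>(2)
    by (auto simp: bij_betw_def)
  then show ?thesis using cb_type_cgraph assms(1,2) by blast
qed

section \<open>Germs of saturations\<close>

text \<open>For a subalgebra \<open>B\<close> of the clopen algebra, this is the image of
  \<open>a\<close> in the quotient space dual to \<open>B\<close>, pulled back to
  \<open>X\<close>.\<close>

definition sat :: "'p set \<Rightarrow> 'p set set \<Rightarrow> 'p set \<Rightarrow> 'p set" where
  "sat X B a = {p \<in> X. \<exists>q\<in>a. \<forall>b\<in>B. p \<in> b \<longleftrightarrow> q \<in> b}"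

lemma sat_UN: "sat X B (\<Union>c\<in>C. f c) = (\<Union>c\<in>C. sat X B (f c))"
proof -
  have "{p \<in> X. \<exists>q\<in>\<Union> (f ` C). R p q} = (\<Union>c\<in>C. {p \<in> X. \<exists>q\<in>f c. R p q})" for R by blast
  then show ?thesis unfolding sat_def .
qed

text \<open>Inclusion of germs at \<open>q\<close>, where the neighbourhoods come from the
  subalgebra \<open>B\<close>.\<close>

definition germ_le :: "'p set set \<Rightarrow> 'p \<Rightarrow> 'p set \<Rightarrow> 'p set \<Rightarrow> bool" where
  "germ_le B q K K' \<longleftrightarrow> (\<exists>b\<in>B. q \<in> b \<and> K \<inter> b \<subseteq> K')"

text \<open>Primeness concerns joins and meets of traces. The families may be empty, so a prime germ
  is neither that of \<open>{}\<close> nor that of \<open>X\<close>.\<close>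

definition prime_germ :: "'p set \<Rightarrow> 'p set set \<Rightarrow> 'p set set \<Rightarrow> 'p \<Rightarrow> 'p set \<Rightarrow> bool" where
  "prime_germ X A B q K \<longleftrightarrow> K \<in> sat X B ` A \<and>
    (\<forall>\<K>. finite \<K> \<and> \<K> \<subseteq> sat X B ` A \<longrightarrow>
      (germ_le B q K (\<Union>\<K>) \<longrightarrow> (\<exists>K'\<in>\<K>. germ_le B q K K')) \<and>
      (germ_le B q (X \<inter> \<Inter>\<K>) K \<longrightarrow> (\<exists>K'\<in>\<K>. germ_le B q K' K)))"

lemma germ_le_mono: "germ_le B q K K' \<Longrightarrow> L \<subseteq> K \<Longrightarrow> K' \<subseteq> L' \<Longrightarrow> germ_le B q L L'"
  unfolding germ_le_def by blast

lemma germ_le_trans: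
  assumes "\<And>b c. b \<in> B \<Longrightarrow> c \<in> B \<Longrightarrow> b \<inter> c \<in> B" "germ_le B q K K'" "germ_le B q K' K''"
  shows "germ_le B q K K''"
proof -
  obtain b c where bc: "b \<in> B" "q \<in> b" "K \<inter> b \<subseteq> K'" "c \<in> B" "q \<in> c" "K' \<inter> c \<subseteq> K''"
    using assms(2,3) unfolding germ_le_def by blast
  then have "K \<inter> (b \<inter> c) \<subseteq> K''" by blast
  then show ?thesis unfolding germ_le_def using assms(1) bc by (intro bexI[of _ "b \<inter> c"]) auto
qed

definition tedge :: "'x list \<Rightarrow> 'x list \<Rightarrow> bool" where
  "tedge s t \<longleftrightarrow> strict_suffix s t \<or> strict_suffix t s"

lemma tedge_sym: "tedge s t \<Longrightarrow> tedge t s"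
  by (auto simp: tedge_def)

locale subtree =
  fixes T U :: "'x list set"
  assumes T_suffix: "t \<in> T \<Longrightarrow> suffix s t \<Longrightarrow> s \<in> T"
    and U_suffix: "t \<in> U \<Longrightarrow> suffix s t \<Longrightarrow> s \<in> U"
    and U_sub: "U \<subseteq> T"
    and Nil_U: "[] \<in> U"
begin

abbreviation "X \<equiv> pts T tedge"
abbreviation "A \<equiv> clop X (T \<times> UNIV)"
abbreviation "B \<equiv> clop X (U \<times> UNIV)"

text \<open>At such a node a coordinate outside \<open>U\<close> can be switched on whose only
  neighbours in \<open>U\<close> are this node and its suffixes.\<close>

definition vis :: "'x list set" where
  "vis = {t \<in> U. \<exists>x. x # t \<in> T - U}"

definition zero :: "'x list set \<Rightarrow> ('x list \<Rightarrow> nat) set" where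
  "zero D = {p \<in> X. \<forall>t\<in>D. \<forall>r. suffix r t \<longrightarrow> p r = 0}"

definition tq :: "('x list \<Rightarrow> nat) \<Rightarrow> 'x list set" where
  "tq q = {t \<in> U. \<forall>r\<in>U. suffix r t \<or> suffix t r \<longrightarrow> q r = 0}"

definition vq :: "('x list \<Rightarrow> nat) \<Rightarrow> 'x list set" where
  "vq q = tq q \<inter> vis"

section \<open>Traces on the subalgebra over a subtree\<close>

lemma zero_subset: "zero D \<subseteq> X"
  by (auto simp: zero_def)

lemma comparable_edge: "suffix r t \<Longrightarrow> r = t \<or> tedge r t"
  by (auto simp: tedge_def strict_suffix_def)

lemma tq_up: "t \<in> tq q \<Longrightarrow> suffix t s \<Longrightarrow> s \<in> U \<Longrightarrow> s \<in> tq q"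
  unfolding tq_def using suffix_same_cases suffix_order.trans by blast

lemma same_B_iff:
  assumes "p \<in> X" "q \<in> X"
  shows "(\<forall>b\<in>B. p \<in> b \<longleftrightarrow> q \<in> b) \<longleftrightarrow> (\<forall>t\<in>U. p t = q t)"
proof
  assume *: "\<forall>b\<in>B. p \<in> b \<longleftrightarrow> q \<in> b"
  show "\<forall>t\<in>U. p t = q t"
  proof
    fix t assume t: "t \<in> U"
    have e: "p t = Suc k \<longleftrightarrow> q t = Suc k" for k
    proof -
      have "cyl X (t, k) \<in> B" using t by simp
      then have "p \<in> cyl X (t, k) \<longleftrightarrow> q \<in> cyl X (t, k)" using * by blast
      then show ?thesis using assms by (simp add: cyl_def)
    qed
    show "p t = q t" using e[of "p t - 1"] e[of "q t - 1"] by (cases "p t"; cases "q t") auto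
  qed
next
  assume *: "\<forall>t\<in>U. p t = q t"
  show "\<forall>b\<in>B. p \<in> b \<longleftrightarrow> q \<in> b"
  proof
    fix b assume "b \<in> B"
    then obtain F where F: "b \<subseteq> X" "finite F" "F \<subseteq> U \<times> UNIV"
      "determines X F b" by (rule clopE)
    have "agree F p q" using * F(3) by (fastforce simp: agree_def)
    then show "p \<in> b \<longleftrightarrow> q \<in> b" using F(4) assms by blast
  qed
qed

lemma sat_iff:
  assumes "a \<subseteq> X"
  shows "p \<in> sat X B a \<longleftrightarrow> p \<in> X \<and> (\<exists>q\<in>a. \<forall>t\<in>U. p t = q t)"
proof -
  have "(\<exists>q\<in>a. \<forall>b\<in>B. p \<in> b \<longleftrightarrow> q \<in> b) \<longleftrightarrow> (\<exists>q\<in>a. \<forall>t\<in>U. p t = q t)" if "p \<in> X"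
    by (rule bex_cong[OF refl], rule same_B_iff[OF that]) (rule subsetD[OF assms])
  then show ?thesis unfolding sat_def by auto
qed

text \<open>On the way from the root to \<open>s\<close>, the last node in \<open>U\<close> is
  visible, because the next one is a child outside \<open>U\<close>.\<close>

lemma exit_node:
  assumes "s \<in> T - U"
  shows "\<exists>t\<in>vis. suffix t s \<and> (\<forall>r\<in>U. suffix r s \<longrightarrow> suffix r t)"
  using assms
proof (induction s)
  case Nil
  then show ?case using Nil_U by simp
next
  case (Cons x s)
  have sT: "s \<in> T" using T_suffix[of "x # s" s] Cons.prems by (auto simp: suffix_ConsI)
  show ?case
  proof (cases "s \<in> U")
    case True
    then have "s \<in> vis" using Cons.prems unfolding vis_def by blast
    moreover have "suffix r s" if "r \<in> U" "suffix r (x # s)" for r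
      using that Cons.prems by (auto simp: suffix_Cons)
    ultimately show ?thesis by (intro bexI[of _ s]) (auto simp: suffix_Cons)
  next
    case False
    then obtain t where t: "t \<in> vis" "suffix t s" "\<forall>r\<in>U. suffix r s \<longrightarrow> suffix r t"
      using Cons.IH sT by auto
    moreover have "suffix r s" if "r \<in> U" "suffix r (x # s)" for r
      using that Cons.prems by (auto simp: suffix_Cons)
    ultimately show ?thesis by (intro bexI[of _ t]) (auto simp: suffix_Cons)
  qed
qed

text \<open>Outside \<open>U\<close>, a coordinate \<open>s\<close> only constrains the points of \<open>U\<close> through the
  suffixes of its exit node; hence the trace of a box is a box cut down by finitely many
  of the closed sets \<open>zero {t}\<close>.\<close>

lemma sat_box:
  assumes p: "p \<in> X" and F: "finite F" "F \<subseteq> T \<times> UNIV"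
  shows "\<exists>D. finite D \<and> D \<subseteq> vis \<and>
    sat X B {q \<in> X. agree F p q} = {q \<in> X. agree (F \<inter> U \<times> UNIV) p q} \<inter> zero D"
proof -
  \<comment> \<open>Among the outside tests only those that hold at \<open>p\<close> constrain the
    trace; the others fail at the value \<open>0\<close> as well.\<close>
  define Out where "Out = {s \<in> T - U. \<exists>k. (s, k) \<in> F \<and> p s = Suc k}"
  have finOut: "finite Out" by (rule finite_subset[of _ "fst ` F"]) (use F(1) in \<open>force simp: Out_def\<close>)+
  have "\<forall>s\<in>Out. \<exists>t\<in>vis. suffix t s \<and> (\<forall>r\<in>U. suffix r s \<longrightarrow> suffix r t)"
    using exit_node unfolding Out_def by blast
  then obtain e where e: "\<And>s. s \<in> Out \<Longrightarrow> e s \<in> vis" "\<And>s. s \<in> Out \<Longrightarrow> suffix (e s) s"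
    "\<And>s r. s \<in> Out \<Longrightarrow> r \<in> U \<Longrightarrow> suffix r s \<Longrightarrow> suffix r (e s)" by metis
  let ?FU = "F \<inter> U \<times> UNIV"
  have "sat X B {q \<in> X. agree F p q} = {q \<in> X. agree ?FU p q} \<inter> zero (e ` Out)" (is "?L = ?R")
  proof (intro equalityI subsetI)
    fix q assume "q \<in> ?L"
    then obtain q' where q: "q \<in> X" "q' \<in> X" "agree F p q'" "\<forall>t\<in>U. q t = q' t"
      by (subst (asm) sat_iff) auto
    have "agree ?FU p q" using q(3,4) unfolding agree_def by auto
    moreover have "q r = 0" if s: "s \<in> Out" "suffix r (e s)" for s r
    proof -
      have rU: "r \<in> U" using e(1)[OF s(1)] s(2) U_suffix unfolding vis_def by blast
      have "q' s \<noteq> 0" using s(1) q(3) unfolding Out_def agree_def by auto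
      moreover have "suffix r s" using s(2) e(2)[OF s(1)] by (rule suffix_order.trans)
      moreover have "r \<noteq> s" using rU s(1) unfolding Out_def by blast
      ultimately have "q' r = 0" using comparable_edge[of r s] pts_edge[OF q(2), of r s] by auto
      then show ?thesis using q(4) rU by simp
    qed
    ultimately show "q \<in> ?R" using q(1) unfolding zero_def by blast
  next
    fix q assume "q \<in> ?R"
    then have q: "q \<in> X" "agree ?FU p q" and z: "\<And>s r. s \<in> Out \<Longrightarrow> suffix r (e s) \<Longrightarrow> q r = 0"
      unfolding zero_def by auto
    \<comment> \<open>The lift follows \<open>q\<close> on \<open>U\<close> and takes the forced
      values of \<open>p\<close> on \<open>Out\<close>. It respects the edges because
      \<open>q\<close> vanishes along the branch to every exit node.\<close>
    define q' where "q' = (\<lambda>s. if s \<in> U then q s else if s \<in> Out then p s else 0)"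
    have cross: "q' s = 0 \<or> q' t = 0" if "tedge s t" "s \<in> U" "t \<notin> U" for s t
    proof (cases "t \<in> Out")
      case True
      have "suffix s t" using that U_suffix[of s t] unfolding tedge_def strict_suffix_def by blast
      then have "q s = 0" using z[OF True] e(3)[OF True that(2)] by blast
      then show ?thesis using that by (simp add: q'_def)
    qed (use that in \<open>simp add: q'_def\<close>)
    have "q' \<in> X"
    proof (rule ptsI)
      show "q' s = 0" if "s \<notin> T" for s
        using that U_sub pts_outside[OF q(1) that] by (auto simp: q'_def Out_def)
    next
      fix s t :: "'x list" assume st: "tedge s t"
      show "q' s = 0 \<or> q' t = 0"
        using cross[OF st] cross[OF tedge_sym[OF st]] pts_edge[OF q(1) st] pts_edge[OF p st]
        by (cases "s \<in> U"; cases "t \<in> U") (auto simp: q'_def)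
    qed
    moreover have "agree F p q'"
      unfolding agree_def
    proof (intro allI impI)
      fix s k assume sk: "(s, k) \<in> F"
      show "p s = Suc k \<longleftrightarrow> q' s = Suc k"
      proof (cases "s \<in> U")
        case True
        then show ?thesis using q(2) sk by (auto simp: agree_def q'_def)
      next
        case False
        then show ?thesis using sk F(2) by (auto simp: q'_def Out_def)
      qed
    qed
    ultimately show "q \<in> ?L" using q(1) by (subst sat_iff) (auto simp: q'_def intro!: exI[of _ q'])
  qed
  then show ?thesis using finOut e(1) by (intro exI[of _ "e ` Out"]) auto
qed

text \<open>A disjunctive normal form: near \<open>q\<close> the set is a finite union of finite
  intersections of sets \<open>zero {t}\<close> with \<open>t\<close> in
  \<open>vq q\<close>.\<close>

definition germ_form :: "('x list \<Rightarrow> nat) \<Rightarrow> ('x list \<Rightarrow> nat) set \<Rightarrow> bool" where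
  "germ_form q K \<longleftrightarrow> (\<exists>\<D>. finite \<D> \<and> (\<forall>D\<in>\<D>. finite D \<and> D \<subseteq> vq q) \<and>
    (\<exists>b\<in>B. q \<in> b \<and> K \<inter> b = (\<Union>D\<in>\<D>. zero D) \<inter> b))"

lemma germ_form_empty: "q \<in> X \<Longrightarrow> germ_form q {}"
  unfolding germ_form_def by (intro exI[of _ "{}"] conjI bexI[of _ X]) auto

lemma germ_form_un:
  assumes "germ_form q K" "germ_form q L" shows "germ_form q (K \<union> L)"
proof -
  obtain \<D> b where 1: "finite \<D>" "\<forall>D\<in>\<D>. finite D \<and> D \<subseteq> vq q" "b \<in> B" "q \<in> b" "K \<inter> b = (\<Union>D\<in>\<D>. zero D) \<inter> b"
    using assms(1) unfolding germ_form_def by blast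
  obtain \<E> c where 2: "finite \<E>" "\<forall>D\<in>\<E>. finite D \<and> D \<subseteq> vq q" "c \<in> B" "q \<in> c" "L \<inter> c = (\<Union>D\<in>\<E>. zero D) \<inter> c"
    using assms(2) unfolding germ_form_def by blast
  have "(K \<union> L) \<inter> (b \<inter> c) = (\<Union>D\<in>\<D> \<union> \<E>. zero D) \<inter> (b \<inter> c)" using 1(5) 2(5) by blast
  then show ?thesis unfolding germ_form_def
    using 1(1-4) 2(1-4) by (intro exI[of _ "\<D> \<union> \<E>"] conjI bexI[of _ "b \<inter> c"] clop_int) auto
qed

text \<open>By \<open>sat_box\<close> the trace is a box over \<open>U\<close> cut down by
  \<open>zero D\<close>. If \<open>q\<close> violates one of these conditions, so does a whole
  neighbourhood, and the germ is empty. Otherwise the box condition holds near \<open>q\<close>, and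
  so do the conditions at nodes of \<open>D\<close> outside \<open>tq q\<close>.\<close>

lemma germ_form_box:
  assumes p: "p \<in> X" and F: "finite F" "F \<subseteq> T \<times> UNIV" and q: "q \<in> X"
  shows "germ_form q (sat X B {p' \<in> X. agree F p p'})"
proof -
  obtain D where D: "finite D" "D \<subseteq> vis"
    "sat X B {q \<in> X. agree F p q} = {q \<in> X. agree (F \<inter> U \<times> UNIV) p q} \<inter> zero D"
    using sat_box[OF p F] by blast
  let ?FU = "F \<inter> U \<times> UNIV"
  define c where "c = {p' \<in> X. agree ?FU q p'}"
  have "c \<in> B"
  proof (rule clopI[where F = ?FU])
    fix r s assume "r \<in> X" "s \<in> X" "agree ?FU r s" "r \<in> c"
    then show "s \<in> c" unfolding c_def using agree_trans[of ?FU q r s] by blast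
  qed (use F(1) in \<open>auto simp: c_def\<close>)
  have cq: "q \<in> c" using q by (simp add: c_def)
  show ?thesis
  proof (cases "agree ?FU p q \<and> q \<in> zero D")
    case False
    have "\<exists>b\<in>B. q \<in> b \<and> ({q \<in> X. agree ?FU p q} \<inter> zero D) \<inter> b = {}"
    proof (cases "agree ?FU p q")
      case True
      then obtain t r where tr: "t \<in> D" "suffix r t" "q r \<noteq> 0" using False q by (auto simp: zero_def)
      have "r \<in> U" using tr D(2) U_suffix unfolding vis_def by blast
      then have "cyl X (r, q r - 1) \<in> B" by simp
      moreover have "q \<in> cyl X (r, q r - 1)" using tr q by (simp add: cyl_def)
      moreover have "zero D \<inter> cyl X (r, q r - 1) = {}" using tr by (auto simp: zero_def cyl_def)
      ultimately show ?thesis by blast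
    next
      case False
      have "{q \<in> X. agree ?FU p q} \<inter> c = {}"
        unfolding c_def using False agree_trans[of ?FU p _ q] agree_sym[of ?FU q] by blast
      then show ?thesis using \<open>c \<in> B\<close> cq by blast
    qed
    then show ?thesis unfolding germ_form_def D(3) by (intro exI[of _ "{}"]) auto
  next
    case True
    \<comment> \<open>Such a \<open>t\<close> has a strict extension \<open>r\<close> in
      \<open>U\<close> with \<open>q r\<close> nonzero; fixing that value forces \<open>0\<close> at
      \<open>t\<close> and its suffixes.\<close>
    have "\<exists>b\<in>B. q \<in> b \<and> b \<subseteq> zero {t}" if t: "t \<in> D - tq q" for t
    proof -
      have tU: "t \<in> U" using t D(2) by (auto simp: vis_def)
      then obtain r where r: "r \<in> U" "suffix r t \<or> suffix t r" "q r \<noteq> 0" using t by (auto simp: tq_def)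
      have "\<not> suffix r t" using True t r(3) by (auto simp: zero_def)
      then have tr: "strict_suffix t r" using r(2) by (auto simp: strict_suffix_def)
      have "cyl X (r, q r - 1) \<in> B" using r(1) by simp
      moreover have "q \<in> cyl X (r, q r - 1)" using r q by (simp add: cyl_def)
      moreover have "cyl X (r, q r - 1) \<subseteq> zero {t}"
      proof
        fix s assume s: "s \<in> cyl X (r, q r - 1)"
        have "s v = 0" if "suffix v t" for v
        proof -
          have "strict_suffix v r" using that tr by (rule suffix_order.le_less_trans)
          then have "tedge v r" by (simp add: tedge_def)
          then show ?thesis using pts_edge[of s T tedge v r] s by (auto simp: cyl_def)
        qed
        then show "s \<in> zero {t}" using s by (auto simp: zero_def cyl_def)
      qed
      ultimately show ?thesis by blast
    qed
    then obtain b where b: "\<And>t. t \<in> D - tq q \<Longrightarrow> b t \<in> B" "\<And>t. t \<in> D - tq q \<Longrightarrow> q \<in> b t"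
      "\<And>t. t \<in> D - tq q \<Longrightarrow> b t \<subseteq> zero {t}" by metis
    define d where "d = c \<inter> {p \<in> X. \<forall>t\<in>D - tq q. p \<in> b t}"
    have "d \<in> B" unfolding d_def using \<open>c \<in> B\<close> b(1) D(1) by (intro clop_int clop_Inter) auto
    moreover have "q \<in> d" unfolding d_def using cq q b(2) by blast
    moreover have "({q \<in> X. agree ?FU p q} \<inter> zero D) \<inter> d = (\<Union>D\<in>{D \<inter> tq q}. zero D) \<inter> d"
    proof -
      have "d \<subseteq> {q \<in> X. agree ?FU p q}" unfolding d_def c_def using True agree_trans[of ?FU p q] by blast
      moreover have "s \<in> zero D" if "s \<in> d" "s \<in> zero (D \<inter> tq q)" for s
      proof -
        have "s \<in> zero {t}" if "t \<in> D" for t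
          using that \<open>s \<in> zero (D \<inter> tq q)\<close> \<open>s \<in> d\<close> b(3)[of t] by (cases "t \<in> tq q") (auto simp: d_def zero_def)
        then show ?thesis using that by (auto simp: zero_def)
      qed
      moreover have "zero D \<subseteq> zero (D \<inter> tq q)" by (auto simp: zero_def)
      ultimately show ?thesis by blast
    qed
    ultimately show ?thesis unfolding germ_form_def D(3)
      using D(1,2) by (intro exI[of _ "{D \<inter> tq q}"] conjI bexI[of _ d]) (auto simp: vq_def)
  qed
qed

lemma germ_form_sat:
  assumes a: "a \<in> A" and q: "q \<in> X"
  shows "germ_form q (sat X B a)"
proof -
  obtain F where F: "a \<subseteq> X" "finite F" "F \<subseteq> T \<times> UNIV"
    "determines X F a" using a by (rule clopE)
  define box where "box = (\<lambda>p. {p' \<in> X. agree F p p'})"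
  have fin: "finite (box ` a)"
  proof -
    define g where "g = (\<lambda>H. {p' \<in> X. \<forall>x\<in>F. p' (fst x) = Suc (snd x) \<longleftrightarrow> x \<in> H})"
    have "box p = g {x \<in> F. p (fst x) = Suc (snd x)}" for p
      unfolding box_def g_def agree_def by auto
    then have "box ` a \<subseteq> g ` Pow F" by auto
    then show ?thesis by (rule finite_subset) (simp add: F(2))
  qed
  have "germ_form q (\<Union>c\<in>C. sat X B c)" if "finite C" "C \<subseteq> box ` a" for C
    using that
  proof (induction C)
    case empty
    then show ?case using germ_form_empty[OF q] by simp
  next
    case (insert c C)
    then obtain p where "p \<in> a" "c = box p" by blast
    then have "germ_form q (sat X B c)" unfolding box_def using germ_form_box[OF _ F(2,3) q] F(1) by blast
    then show ?case using germ_form_un insert by simp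
  qed
  from this[OF fin subset_refl] have "germ_form q (\<Union>c\<in>box ` a. sat X B c)" .
  moreover have "(\<Union>c\<in>box ` a. sat X B c) = sat X B a"
  proof -
    have "a = (\<Union>p\<in>a. box p)"
    proof
      show "a \<subseteq> (\<Union>p\<in>a. box p)" using F(1) agree_refl unfolding box_def by blast
      show "(\<Union>p\<in>a. box p) \<subseteq> a"
      proof
        fix p' assume "p' \<in> (\<Union>p\<in>a. box p)"
        then obtain p where "p \<in> a" "p' \<in> X" "agree F p p'" unfolding box_def by blast
        then show "p' \<in> a" using F(1,4) by blast
      qed
    qed
    then have "sat X B a = sat X B (\<Union>c\<in>box ` a. c)" by simp
    then show ?thesis unfolding sat_UN by simp
  qed
  ultimately show ?thesis by simp
qed

text \<open>Require the value \<open>Suc 0\<close> at a child outside \<open>U\<close> of each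
  \<open>t\<close> in \<open>D\<close>. Seen from \<open>U\<close> this only says that the
  coordinates along the branch to \<open>t\<close> are \<open>0\<close>.\<close>

lemma zero_is_sat:
  assumes D: "finite D" "D \<subseteq> vis"
  shows "zero D \<in> sat X B ` A"
proof -
  have "\<forall>t\<in>D. \<exists>x. x # t \<in> T - U" using D(2) by (auto simp: vis_def)
  then obtain x where x: "\<And>t. t \<in> D \<Longrightarrow> x t # t \<in> T - U" by metis
  have DU: "D \<subseteq> U" using D(2) by (auto simp: vis_def)
  define a where "a = {p \<in> X. \<forall>t\<in>D. p \<in> cyl X (x t # t, 0)}"
  have "a \<in> A" unfolding a_def using D(1) x by (intro clop_Inter) auto
  have aX: "a \<subseteq> X" by (auto simp: a_def)
  have "sat X B a = zero D"
  proof (intro equalityI subsetI)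
    fix p assume "p \<in> sat X B a"
    then obtain q where pq: "p \<in> X" "q \<in> a" "\<forall>t\<in>U. p t = q t" using sat_iff[OF aX] by blast
    have "p r = 0" if t: "t \<in> D" "suffix r t" for t r
    proof -
      have "r \<in> U" using t DU U_suffix by blast
      moreover have "strict_suffix r (x t # t)" using t(2) by (auto simp: strict_suffix_def suffix_Cons dest: suffix_length_le)
      moreover have "q (x t # t) \<noteq> 0" "q \<in> X" using pq(2) t(1) by (auto simp: a_def cyl_def)
      ultimately show ?thesis using pts_edge[of q T tedge r "x t # t"] pq(3) by (auto simp: tedge_def)
    qed
    then show "p \<in> zero D" using pq(1) by (auto simp: zero_def)
  next
    fix p assume p: "p \<in> zero D"
    then have pX: "p \<in> X" by (simp add: zero_def)
    define q where "q = (\<lambda>s. if s \<in> U then p s else if \<exists>t\<in>D. s = x t # t then Suc 0 else 0)"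
    have cross: "q s = 0 \<or> q u = 0" if su: "tedge s u" "s \<in> U" "u \<notin> U" for s u
    proof (cases "\<exists>t\<in>D. u = x t # t")
      case True
      then obtain t where t: "t \<in> D" "u = x t # t" by blast
      have "suffix s u" "s \<noteq> u" using su U_suffix[of s u] unfolding tedge_def strict_suffix_def by blast+
      then have "suffix s t" unfolding t(2) by (simp add: suffix_Cons)
      then have "p s = 0" using p t(1) by (auto simp: zero_def)
      then show ?thesis using su by (simp add: q_def)
    qed (use su in \<open>simp add: q_def\<close>)
    \<comment> \<open>Two chosen children are never strictly comparable, since each strict suffix of
      one of them lies in \<open>U\<close>.\<close>
    have out: "q s = 0 \<or> q u = 0" if su: "strict_suffix s u" "s \<notin> U" "u \<notin> U" for s u
    proof (rule ccontr)
      assume "\<not> (q s = 0 \<or> q u = 0)"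
      then obtain t where t: "t \<in> D" "u = x t # t" using su by (auto simp: q_def split: if_splits)
      have "suffix s t" using su(1) unfolding t(2) by (auto simp: strict_suffix_def suffix_Cons)
      then show False using su(2) t(1) DU U_suffix by blast
    qed
    have "q \<in> X"
    proof (rule ptsI)
      show "q s = 0" if "s \<notin> T" for s using that U_sub x by (auto simp: q_def)
    next
      fix s u :: "'x list" assume su: "tedge s u"
      show "q s = 0 \<or> q u = 0"
      proof (cases "s \<in> U"; cases "u \<in> U")
        assume "s \<in> U" "u \<in> U"
        then show ?thesis using pts_edge[OF pX su] by (simp add: q_def)
      next
        assume "s \<in> U" "u \<notin> U" then show ?thesis by (rule cross[OF su])
      next
        assume "s \<notin> U" "u \<in> U" then show ?thesis using cross[OF tedge_sym[OF su]] by auto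
      next
        assume "s \<notin> U" "u \<notin> U"
        then show ?thesis using out[of s u] out[of u s] su unfolding tedge_def by auto
      qed
    qed
    then have "q \<in> a" using x by (auto simp: a_def cyl_def q_def)
    moreover have "\<forall>t\<in>U. p t = q t" by (simp add: q_def)
    ultimately show "p \<in> sat X B a" using sat_iff[OF aX] pX by blast
  qed
  then show ?thesis using \<open>a \<in> A\<close> by blast
qed

text \<open>The test point is \<open>q\<close> with a huge value added at every minimal node of \<open>tq q\<close>
  that is not below \<open>D\<close>: these nodes form an antichain, and the point is close to \<open>q\<close>.\<close>

lemma germ_le_zero:
  assumes q: "q \<in> X" and D: "D \<subseteq> tq q" and \<D>: "\<And>D'. D' \<in> \<D> \<Longrightarrow> D' \<subseteq> tq q"
    and le: "germ_le B q (zero D) (\<Union>D'\<in>\<D>. zero D')"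
  shows "\<exists>D'\<in>\<D>. \<forall>t'\<in>D'. \<exists>t\<in>D. suffix t' t"
proof -
  obtain b where b: "b \<in> B" "q \<in> b" "zero D \<inter> b \<subseteq> (\<Union>D'\<in>\<D>. zero D')"
    using le unfolding germ_le_def by blast
  define Good where "Good = {r \<in> tq q. \<forall>t\<in>D. \<not> suffix r t}"
  define R where "R = {r \<in> Good. \<forall>s. strict_suffix s r \<longrightarrow> s \<notin> Good}"
  have RU: "r \<in> U" if "r \<in> R" for r using that by (auto simp: R_def Good_def tq_def)
  \<comment> \<open>Dropping the coordinates outside \<open>U\<close> keeps the point in
    \<open>b\<close> and makes room for the new values on \<open>R\<close>.\<close>
  define q0 where "q0 = (\<lambda>s. if s \<in> U then q s else 0)"
  have q0X: "q0 \<in> X"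
  proof (rule ptsI)
    show "q0 s = 0" if "s \<notin> T" for s using that U_sub by (auto simp: q0_def)
    show "q0 s = 0 \<or> q0 t = 0" if "tedge s t" for s t using pts_edge[OF q that] by (auto simp: q0_def)
  qed
  have "q0 \<in> b" using same_B_iff[OF q q0X] b(1,2) by (auto simp: q0_def)
  then obtain F N where N: "\<And>p. p \<in> X \<Longrightarrow> (\<And>g. g \<in> F \<Longrightarrow> p g = q0 g \<or> q0 g = 0 \<and> N < p g) \<Longrightarrow> p \<in> b"
    using clop_nbhd[OF b(1)] by metis
  define p where "p = (\<lambda>s. if s \<in> R then Suc N else q0 s)"
  have Rq: "q0 s = 0" if "r \<in> R" "suffix r s \<or> suffix s r" for r s
    using that by (auto simp: R_def Good_def tq_def q0_def)
  have anti: "\<not> tedge s t" if "s \<in> R" "t \<in> R" for s t using that by (auto simp: R_def tedge_def)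
  have "p \<in> X"
  proof (rule ptsI)
    show "p s = 0" if "s \<notin> T" for s using that RU U_sub pts_outside[OF q0X that] by (auto simp: p_def)
  next
    fix s t :: "'x list" assume st: "tedge s t"
    then have c: "suffix s t \<or> suffix t s" by (auto simp: tedge_def strict_suffix_def)
    show "p s = 0 \<or> p t = 0"
      using anti[of s t] st c Rq[of s t] Rq[of t s] pts_edge[OF q0X st]
      by (cases "s \<in> R"; cases "t \<in> R") (auto simp: p_def)
  qed
  have "p \<in> b" by (rule N[OF \<open>p \<in> X\<close>]) (use Rq in \<open>auto simp: p_def\<close>)
  moreover have "p \<in> zero D"
  proof -
    have "p r = 0" if t: "t \<in> D" "suffix r t" for t r
    proof -
      have "r \<in> U" using t D U_suffix by (auto simp: tq_def)
      then have "q0 r = 0" using t D by (auto simp: tq_def q0_def)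
      moreover have "r \<notin> R" using t by (auto simp: R_def Good_def)
      ultimately show ?thesis by (simp add: p_def)
    qed
    then show ?thesis using \<open>p \<in> X\<close> by (auto simp: zero_def)
  qed
  ultimately obtain D' where D': "D' \<in> \<D>" "p \<in> zero D'" using b(3) by blast
  have "\<exists>t\<in>D. suffix t' t" if t': "t' \<in> D'" for t'
  proof (rule ccontr)
    assume neg: "\<not> ?thesis"
    have "t' \<in> Good" using \<D>[OF D'(1)] t' neg by (auto simp: Good_def)
    \<comment> \<open>Suffixes get shorter, so there is a minimal good node below \<open>t'\<close>;
      the large value there contradicts membership in \<open>zero D'\<close>.\<close>
    then have "\<exists>r. r \<in> R \<and> suffix r t'"
    proof (induction t' rule: length_induct)
      case (1 t)
      show ?case
      proof (cases "t \<in> R")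
        case False
        then obtain s where s: "strict_suffix s t" "s \<in> Good" using 1(2) by (auto simp: R_def)
        then have "length s < length t" by (auto simp: strict_suffix_def suffix_def)
        then obtain r where "r \<in> R" "suffix r s" using 1(1) s by blast
        then show ?thesis using s by (meson suffix_order.less_imp_le suffix_order.trans)
      qed auto
    qed
    then obtain r where r: "r \<in> R" "suffix r t'" by blast
    then have "p r \<noteq> 0" by (simp add: p_def)
    then show False using D'(2) t' r(2) by (auto simp: zero_def)
  qed
  then show ?thesis using D'(1) by blast
qed

section \<open>Prime germs and visible nodes\<close>

abbreviation le :: "('x list \<Rightarrow> nat) \<Rightarrow> ('x list \<Rightarrow> nat) set \<Rightarrow> ('x list \<Rightarrow> nat) set \<Rightarrow> bool" where
  "le \<equiv> germ_le B"

lemma le_trans: "le q K K' \<Longrightarrow> le q K' K'' \<Longrightarrow> le q K K''"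
  by (rule germ_le_trans) (rule clop_int)

text \<open>The order of the nodes in \<open>tq q\<close> is recovered, reversed, from the germs of
  the sets \<open>zero {t}\<close>.\<close>

lemma le_zero_iff:
  assumes q: "q \<in> X" and "s \<in> tq q" "t \<in> tq q"
  shows "le q (zero {s}) (zero {t}) \<longleftrightarrow> suffix t s"
proof
  assume "le q (zero {s}) (zero {t})"
  then have "\<exists>D'\<in>{{t}}. \<forall>t'\<in>D'. \<exists>r\<in>{s}. suffix t' r"
    using assms by (intro germ_le_zero) auto
  then show "suffix t s" by simp
next
  assume "suffix t s"
  then have "zero {s} \<subseteq> zero {t}" by (auto simp: zero_def intro: suffix_order.trans)
  then show "le q (zero {s}) (zero {t})" unfolding germ_le_def using q by (intro bexI[of _ X]) auto
qed

lemma germ_forms: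
  assumes K: "finite \<K>" "\<K> \<subseteq> sat X B ` A" and q: "q \<in> X"
  obtains \<D> b where "\<And>K. K \<in> \<K> \<Longrightarrow> finite (\<D> K)" "\<And>K D. K \<in> \<K> \<Longrightarrow> D \<in> \<D> K \<Longrightarrow> finite D \<and> D \<subseteq> vq q"
    "b \<in> B" "q \<in> b" "\<And>K. K \<in> \<K> \<Longrightarrow> K \<inter> b = (\<Union>D\<in>\<D> K. zero D) \<inter> b"
proof -
  have "\<forall>K\<in>\<K>. \<exists>\<D> b. finite \<D> \<and> (\<forall>D\<in>\<D>. finite D \<and> D \<subseteq> vq q) \<and> b \<in> B \<and> q \<in> b \<and> K \<inter> b = (\<Union>D\<in>\<D>. zero D) \<inter> b"
  proof
    fix K assume "K \<in> \<K>"
    then obtain a where "a \<in> A" "K = sat X B a" using K(2) by blast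
    then have "germ_form q K" using germ_form_sat q by simp
    then show "\<exists>\<D> b. finite \<D> \<and> (\<forall>D\<in>\<D>. finite D \<and> D \<subseteq> vq q) \<and> b \<in> B \<and> q \<in> b \<and> K \<inter> b = (\<Union>D\<in>\<D>. zero D) \<inter> b"
      unfolding germ_form_def by blast
  qed
  from bchoice[OF this] obtain \<D> where "\<forall>K\<in>\<K>. \<exists>b. finite (\<D> K) \<and> (\<forall>D\<in>\<D> K. finite D \<and> D \<subseteq> vq q) \<and> b \<in> B \<and> q \<in> b \<and> K \<inter> b = (\<Union>D\<in>\<D> K. zero D) \<inter> b" ..
  from bchoice[OF this] obtain b where *: "\<forall>K\<in>\<K>. finite (\<D> K) \<and> (\<forall>D\<in>\<D> K. finite D \<and> D \<subseteq> vq q) \<and> b K \<in> B \<and> q \<in> b K \<and> K \<inter> b K = (\<Union>D\<in>\<D> K. zero D) \<inter> b K" ..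
  define c where "c = {p \<in> X. \<forall>K\<in>\<K>. p \<in> b K}"
  show thesis
  proof (rule that[of \<D> c])
    show "c \<in> B" unfolding c_def using * K(1) by (intro clop_Inter) auto
    show "q \<in> c" unfolding c_def using * q by blast
    show "K \<inter> c = (\<Union>D\<in>\<D> K. zero D) \<inter> c" if "K \<in> \<K>" for K
    proof -
      have "c \<subseteq> b K" using that unfolding c_def by blast
      moreover have "K \<inter> b K = (\<Union>D\<in>\<D> K. zero D) \<inter> b K" using * that by blast
      ultimately show ?thesis by blast
    qed
  qed (use * in blast)+
qed

text \<open>Both halves use normal forms and \<open>germ_le_zero\<close>. Below a join, some term
  \<open>zero D'\<close> has only suffixes of \<open>t\<close> in \<open>D'\<close>. If no factor of
  a meet is below \<open>zero {t}\<close>, each factor has a term without a node extending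
  \<open>t\<close>; the intersection of these terms is below \<open>zero {t}\<close>, so one of its
  nodes would have to extend \<open>t\<close>.\<close>

lemma prime_zero:
  assumes q: "q \<in> X" and t: "t \<in> vq q"
  shows "prime_germ X A B q (zero {t})"
  unfolding prime_germ_def
proof (intro conjI allI impI)
  show "zero {t} \<in> sat X B ` A" using t by (intro zero_is_sat) (auto simp: vq_def)
next
  fix \<K> assume K: "finite \<K> \<and> \<K> \<subseteq> sat X B ` A" and l: "le q (zero {t}) (\<Union>\<K>)"
  obtain \<D> b where D: "\<And>K. K \<in> \<K> \<Longrightarrow> finite (\<D> K)" "\<And>K D. K \<in> \<K> \<Longrightarrow> D \<in> \<D> K \<Longrightarrow> finite D \<and> D \<subseteq> vq q"
    "b \<in> B" "q \<in> b" "\<And>K. K \<in> \<K> \<Longrightarrow> K \<inter> b = (\<Union>D\<in>\<D> K. zero D) \<inter> b"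
    using germ_forms[of \<K> q] K q by blast
  let ?E = "\<Union>K\<in>\<K>. \<D> K"
  obtain c where c: "c \<in> B" "q \<in> c" "zero {t} \<inter> c \<subseteq> \<Union>\<K>" using l unfolding germ_le_def by blast
  have "zero {t} \<inter> (b \<inter> c) \<subseteq> (\<Union>D\<in>?E. zero D)"
  proof
    fix p assume p: "p \<in> zero {t} \<inter> (b \<inter> c)"
    then obtain K where K: "K \<in> \<K>" "p \<in> K \<inter> b" using c(3) by blast
    then have "p \<in> (\<Union>D\<in>\<D> K. zero D)" using D(5)[OF K(1)] by blast
    then show "p \<in> (\<Union>D\<in>?E. zero D)" using K(1) by blast
  qed
  then have "le q (zero {t}) (\<Union>D\<in>?E. zero D)" unfolding germ_le_def
    using D(3,4) c(1,2) by (intro bexI[of _ "b \<inter> c"] clop_int) auto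
  then have "\<exists>D'\<in>?E. \<forall>t'\<in>D'. \<exists>r\<in>{t}. suffix t' r"
  proof (rule germ_le_zero[OF q, rotated 2])
    show "{t} \<subseteq> tq q" using t by (simp add: vq_def)
    show "D' \<subseteq> tq q" if "D' \<in> ?E" for D' using D(2) that unfolding vq_def by blast
  qed
  then obtain K D' where KD: "K \<in> \<K>" "D' \<in> \<D> K" "\<And>t'. t' \<in> D' \<Longrightarrow> suffix t' t" by auto
  have "zero {t} \<subseteq> zero D'" using KD(3) unfolding zero_def by (auto intro: suffix_order.trans)
  then have "zero {t} \<inter> b \<subseteq> K" using D(5)[OF KD(1)] KD(2) by blast
  then show "\<exists>K'\<in>\<K>. le q (zero {t}) K'" unfolding germ_le_def using KD(1) D(3,4) by blast
next
  fix \<K> assume K: "finite \<K> \<and> \<K> \<subseteq> sat X B ` A" and l: "le q (X \<inter> \<Inter>\<K>) (zero {t})"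
  obtain \<D> b where D: "\<And>K. K \<in> \<K> \<Longrightarrow> finite (\<D> K)" "\<And>K D. K \<in> \<K> \<Longrightarrow> D \<in> \<D> K \<Longrightarrow> finite D \<and> D \<subseteq> vq q"
    "b \<in> B" "q \<in> b" "\<And>K. K \<in> \<K> \<Longrightarrow> K \<inter> b = (\<Union>D\<in>\<D> K. zero D) \<inter> b"
    using germ_forms[of \<K> q] K q by blast
  obtain c where c: "c \<in> B" "q \<in> c" "(X \<inter> \<Inter>\<K>) \<inter> c \<subseteq> zero {t}" using l unfolding germ_le_def by blast
  show "\<exists>K'\<in>\<K>. le q K' (zero {t})"
  proof (rule ccontr)
    assume neg: "\<not> ?thesis"
    have "\<forall>K\<in>\<K>. \<exists>D. D \<in> \<D> K \<and> (\<forall>r\<in>D. \<not> suffix t r)"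
    proof (rule ballI, rule ccontr)
      fix K assume K: "K \<in> \<K>" and n: "\<nexists>D. D \<in> \<D> K \<and> (\<forall>r\<in>D. \<not> suffix t r)"
      have "zero D \<subseteq> zero {t}" if D: "D \<in> \<D> K" for D
      proof -
        obtain r where "r \<in> D" "suffix t r" using n D by blast
        then show ?thesis unfolding zero_def by (auto intro: suffix_order.trans)
      qed
      then have "K \<inter> b \<subseteq> zero {t}" using D(5)[OF K] by blast
      then have "le q K (zero {t})" unfolding germ_le_def using D(3,4) by blast
      then show False using neg K by blast
    qed
    from bchoice[OF this] obtain e where e: "\<And>K. K \<in> \<K> \<Longrightarrow> e K \<in> \<D> K" "\<And>K r. K \<in> \<K> \<Longrightarrow> r \<in> e K \<Longrightarrow> \<not> suffix t r"
      by blast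
    let ?E = "\<Union>K\<in>\<K>. e K"
    have "zero ?E \<inter> (b \<inter> c) \<subseteq> zero {t}"
    proof
      fix p assume p: "p \<in> zero ?E \<inter> (b \<inter> c)"
      have "p \<in> K" if "K \<in> \<K>" for K
      proof -
        have "p \<in> zero (e K)" using p that unfolding zero_def by blast
        then show ?thesis using D(5)[OF that] e(1)[OF that] p by blast
      qed
      moreover have "p \<in> X" using p by (simp add: zero_def)
      ultimately show "p \<in> zero {t}" using c(3) p by blast
    qed
    then have "le q (zero ?E) (\<Union>D'\<in>{{t}}. zero D')" unfolding germ_le_def
      using D(3,4) c(1,2) by (intro bexI[of _ "b \<inter> c"] clop_int) auto
    then have "\<exists>D'\<in>{{t}}. \<forall>t'\<in>D'. \<exists>r\<in>?E. suffix t' r"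
    proof (rule germ_le_zero[OF q, rotated 2])
      show "?E \<subseteq> tq q" using D(2) e(1) unfolding vq_def by blast
      show "D' \<subseteq> tq q" if "D' \<in> {{t}}" for D' using that t by (simp add: vq_def)
    qed
    then show False using e(2) by blast
  qed
qed

text \<open>In normal form \<open>K\<close> is a join of meets of sets \<open>zero {t}\<close>.
  Primeness for joins selects one meet, and primeness for meets selects one factor.\<close>

lemma prime_germ_is_zero:
  assumes q: "q \<in> X" and K: "prime_germ X A B q K"
  shows "\<exists>t\<in>vq q. le q K (zero {t}) \<and> le q (zero {t}) K"
proof -
  have join: "\<And>\<K>. finite \<K> \<Longrightarrow> \<K> \<subseteq> sat X B ` A \<Longrightarrow> le q K (\<Union>\<K>) \<Longrightarrow> \<exists>K'\<in>\<K>. le q K K'"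
    and meet: "\<And>\<K>. finite \<K> \<Longrightarrow> \<K> \<subseteq> sat X B ` A \<Longrightarrow> le q (X \<inter> \<Inter>\<K>) K \<Longrightarrow> \<exists>K'\<in>\<K>. le q K' K"
    using K unfolding prime_germ_def by simp_all
  obtain a where "a \<in> A" "K = sat X B a" using K unfolding prime_germ_def by blast
  then have "germ_form q K" using germ_form_sat q by simp
  then obtain \<D> b where D: "finite \<D>" "\<And>D. D \<in> \<D> \<Longrightarrow> finite D \<and> D \<subseteq> vq q"
    "b \<in> B" "q \<in> b" "K \<inter> b = (\<Union>D\<in>\<D>. zero D) \<inter> b" unfolding germ_form_def by metis
  have sat: "zero D \<in> sat X B ` A" if "finite D" "D \<subseteq> vq q" for D
    using that by (intro zero_is_sat) (auto simp: vq_def)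
  have "le q K (\<Union>(zero ` \<D>))" unfolding germ_le_def using D(3-5) by blast
  then have "\<exists>K'\<in>zero ` \<D>. le q K K'" using D(1,2) sat by (intro join) auto
  then obtain D' where D': "D' \<in> \<D>" "le q K (zero D')" by blast
  have D'f: "finite D'" "D' \<subseteq> vq q" using D(2)[OF D'(1)] by auto
  have "zero D' \<inter> b \<subseteq> K" using D(5) D'(1) by blast
  then have le: "le q (zero D') K" unfolding germ_le_def using D(3,4) by blast
  have "X \<inter> \<Inter>((\<lambda>t. zero {t}) ` D') \<subseteq> zero D'" by (auto simp: zero_def)
  then have "le q (X \<inter> \<Inter>((\<lambda>t. zero {t}) ` D')) K" using germ_le_mono[OF le _ subset_refl] by blast
  then have "\<exists>K'\<in>(\<lambda>t. zero {t}) ` D'. le q K' K"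
    using D'f sat by (intro meet) (auto simp: subset_eq)
  then obtain t where t: "t \<in> D'" "le q (zero {t}) K" by blast
  have "zero D' \<subseteq> zero {t}" using t(1) by (auto simp: zero_def)
  then have "le q K (zero {t})" using germ_le_mono[OF D'(2) subset_refl] by blast
  then show ?thesis using t D'f by blast
qed

end

section \<open>Transport of germs along a homeomorphism\<close>

lemma germ_le_image:
  assumes inj: "inj_on \<phi> X" and q: "q \<in> X" and B: "B \<subseteq> Pow X" and K: "K \<subseteq> X" "K' \<subseteq> X"
  shows "germ_le (image \<phi> ` B) (\<phi> q) (\<phi> ` K) (\<phi> ` K') \<longleftrightarrow> germ_le B q K K'"
proof -
  have "\<phi> q \<in> \<phi> ` b \<and> \<phi> ` K \<inter> \<phi> ` b \<subseteq> \<phi> ` K' \<longleftrightarrow> q \<in> b \<and> K \<inter> b \<subseteq> K'" if "b \<in> B" for b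
  proof -
    have b: "b \<subseteq> X" using B that by blast
    have "\<phi> ` K \<inter> \<phi> ` b = \<phi> ` (K \<inter> b)" using inj_on_image_Int[OF inj K(1) b] by simp
    moreover have "\<phi> ` (K \<inter> b) \<subseteq> \<phi> ` K' \<longleftrightarrow> K \<inter> b \<subseteq> K'"
    proof
      assume im: "\<phi> ` (K \<inter> b) \<subseteq> \<phi> ` K'"
      show "K \<inter> b \<subseteq> K'"
      proof
        fix x assume x: "x \<in> K \<inter> b"
        then have "x \<in> X" "\<phi> x \<in> \<phi> ` K'" using im K by auto
        then show "x \<in> K'" using inj_on_image_mem_iff[OF inj _ K(2)] by blast
      qed
    qed blast
    ultimately show ?thesis using inj_on_image_mem_iff[OF inj q b] by simp
  qed
  then show ?thesis unfolding germ_le_def by (simp add: bex_simps)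
qed

lemma sat_image:
  assumes inj: "inj_on \<phi> X" and B: "B \<subseteq> Pow X" and a: "a \<subseteq> X"
  shows "sat (\<phi> ` X) (image \<phi> ` B) (\<phi> ` a) = \<phi> ` sat X B a"
proof -
  have mem: "\<phi> p \<in> \<phi> ` b \<longleftrightarrow> p \<in> b" if "b \<in> B" "p \<in> X" for b p
    using inj_on_image_mem_iff[OF inj that(2)] B that(1) by blast
  have *: "(\<exists>q\<in>\<phi> ` a. \<forall>b\<in>image \<phi> ` B. \<phi> p \<in> b \<longleftrightarrow> q \<in> b) \<longleftrightarrow> (\<exists>q\<in>a. \<forall>b\<in>B. p \<in> b \<longleftrightarrow> q \<in> b)" if p: "p \<in> X" for p
  proof -
    have "(\<forall>b\<in>image \<phi> ` B. \<phi> p \<in> b \<longleftrightarrow> \<phi> q \<in> b) \<longleftrightarrow> (\<forall>b\<in>B. p \<in> b \<longleftrightarrow> q \<in> b)" if "q \<in> a" for q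
    proof -
      have "q \<in> X" using a that by blast
      then show ?thesis using mem[OF _ p] mem[of _ q] by (simp cong: ball_cong)
    qed
    then show ?thesis by (simp cong: bex_cong)
  qed
  show ?thesis
  proof (intro equalityI subsetI)
    fix y assume "y \<in> sat (\<phi> ` X) (image \<phi> ` B) (\<phi> ` a)"
    then have y: "y \<in> \<phi> ` X \<and> (\<exists>q\<in>\<phi> ` a. \<forall>b\<in>image \<phi> ` B. y \<in> b \<longleftrightarrow> q \<in> b)"
      unfolding sat_def by (rule CollectD)
    from conjunct1[OF this] obtain p where p0: "y = \<phi> p" "p \<in> X" by (rule imageE)
    note p = p0(2,1) conjunct2[OF y, unfolded p0(1)]
    have "\<exists>q\<in>a. \<forall>b\<in>B. p \<in> b \<longleftrightarrow> q \<in> b" using *[OF p(1)] p(3) by (rule iffD1)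
    then show "y \<in> \<phi> ` sat X B a"
      unfolding sat_def p(2) by (intro CollectI conjI imageI p(1))
  next
    fix y assume "y \<in> \<phi> ` sat X B a"
    then obtain p where p0: "y = \<phi> p" "p \<in> sat X B a" by (rule imageE)
    note p = conjunct1[OF CollectD[OF p0(2)[unfolded sat_def]]] p0(1) conjunct2[OF CollectD[OF p0(2)[unfolded sat_def]]]
    have "\<exists>q\<in>\<phi> ` a. \<forall>b\<in>image \<phi> ` B. \<phi> p \<in> b \<longleftrightarrow> q \<in> b" using *[OF p(1)] p(3) by (rule iffD2)
    then show "y \<in> sat (\<phi> ` X) (image \<phi> ` B) (\<phi> ` a)"
      unfolding sat_def p(2) by (intro CollectI conjI imageI p(1))
  qed
qed

lemma prime_germ_image:
  assumes inj: "inj_on \<phi> X" and q: "q \<in> X" and A: "A \<subseteq> Pow X" and B: "B \<subseteq> Pow X"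
    and K: "prime_germ X A B q K"
  shows "prime_germ (\<phi> ` X) (image \<phi> ` A) (image \<phi> ` B) (\<phi> q) (\<phi> ` K)"
proof -
  have sub: "sat X B a \<subseteq> X" for a by (auto simp: sat_def)
  have fam: "sat (\<phi> ` X) (image \<phi> ` B) ` (image \<phi> ` A) = image \<phi> ` (sat X B ` A)"
    unfolding image_image using sat_image[OF inj B] A by (intro image_cong) auto
  have KX: "K \<subseteq> X" using K sub unfolding prime_germ_def by auto
  have le: "germ_le (image \<phi> ` B) (\<phi> q) (\<phi> ` L) (\<phi> ` L') \<longleftrightarrow> germ_le B q L L'" if "L \<subseteq> X" "L' \<subseteq> X" for L L'
    by (rule germ_le_image[OF inj q B that])
  show ?thesis
    unfolding prime_germ_def fam
  proof (intro conjI allI impI)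
    show "\<phi> ` K \<in> image \<phi> ` sat X B ` A" using K unfolding prime_germ_def by blast
  next
    fix \<L> assume L: "finite \<L> \<and> \<L> \<subseteq> image \<phi> ` sat X B ` A" and l: "germ_le (image \<phi> ` B) (\<phi> q) (\<phi> ` K) (\<Union>\<L>)"
    obtain \<K> where \<K>: "finite \<K>" "\<K> \<subseteq> sat X B ` A" "\<L> = image \<phi> ` \<K>" using L finite_subset_image by metis
    have \<K>X: "L \<subseteq> X" if "L \<in> \<K>" for L using that \<K>(2) sub by blast
    have "\<Union>\<L> = \<phi> ` \<Union>\<K>" unfolding \<K>(3) by blast
    then have "germ_le B q K (\<Union>\<K>)" using l le[OF KX, of "\<Union>\<K>"] \<K>X by auto
    then obtain L where "L \<in> \<K>" "germ_le B q K L" using K \<K>(1,2) unfolding prime_germ_def by blast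
    then show "\<exists>L'\<in>\<L>. germ_le (image \<phi> ` B) (\<phi> q) (\<phi> ` K) L'" unfolding \<K>(3) using le[OF KX \<K>X] by blast
  next
    fix \<L> assume L: "finite \<L> \<and> \<L> \<subseteq> image \<phi> ` sat X B ` A" and l: "germ_le (image \<phi> ` B) (\<phi> q) (\<phi> ` X \<inter> \<Inter>\<L>) (\<phi> ` K)"
    obtain \<K> where \<K>: "finite \<K>" "\<K> \<subseteq> sat X B ` A" "\<L> = image \<phi> ` \<K>" using L finite_subset_image by metis
    have \<K>X: "L \<subseteq> X" if "L \<in> \<K>" for L using that \<K>(2) sub by blast
    have "\<phi> ` X \<inter> \<Inter>\<L> = \<phi> ` (X \<inter> \<Inter>\<K>)"
    proof
      show "\<phi> ` (X \<inter> \<Inter>\<K>) \<subseteq> \<phi> ` X \<inter> \<Inter>\<L>" unfolding \<K>(3) by blast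
      show "\<phi> ` X \<inter> \<Inter>\<L> \<subseteq> \<phi> ` (X \<inter> \<Inter>\<K>)"
      proof
        fix y assume y: "y \<in> \<phi> ` X \<inter> \<Inter>\<L>"
        then obtain x where x: "x \<in> X" "y = \<phi> x" by blast
        have "x \<in> L" if "L \<in> \<K>" for L
          using y that inj_on_image_mem_iff[OF inj x(1) \<K>X[OF that]] unfolding x(2) \<K>(3) by blast
        then show "y \<in> \<phi> ` (X \<inter> \<Inter>\<K>)" using x by blast
      qed
    qed
    then have "germ_le B q (X \<inter> \<Inter>\<K>) K" using l le[OF _ KX, of "X \<inter> \<Inter>\<K>"] by auto
    then obtain L where "L \<in> \<K>" "germ_le B q L K" using K \<K>(1,2) unfolding prime_germ_def by blast
    then show "\<exists>L'\<in>\<L>. germ_le (image \<phi> ` B) (\<phi> q) L' (\<phi> ` K)" unfolding \<K>(3) using le[OF \<K>X KX] by blast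
  qed
qed

text \<open>A homeomorphism respecting both algebras maps prime germs at \<open>q\<close> to prime
  germs at \<open>\<phi> q\<close>. Each prime germ belongs to a unique node, and the order of the
  germs is that of the nodes reversed.\<close>

lemma forest_isomorphism:
  assumes S: "subtree T U" and S': "subtree T' U'"
    and b: "bij_betw \<phi> (pts T tedge) (pts T' tedge)"
    and A: "image \<phi> ` clop (pts T tedge) (T \<times> UNIV) = clop (pts T' tedge) (T' \<times> UNIV)"
    and B: "image \<phi> ` clop (pts T tedge) (U \<times> UNIV) = clop (pts T' tedge) (U' \<times> UNIV)"
    and q: "q \<in> pts T tedge"
  obtains f where "bij_betw f (subtree.vq T U q) (subtree.vq T' U' (\<phi> q))"
    "\<And>s t. s \<in> subtree.vq T U q \<Longrightarrow> t \<in> subtree.vq T U q \<Longrightarrow> suffix t s \<longleftrightarrow> suffix (f t) (f s)"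
proof -
  interpret S: subtree T U by (rule S)
  interpret S': subtree T' U' by (rule S')
  let ?V = "S.vq q" and ?V' = "S'.vq (\<phi> q)"
  define \<psi> where "\<psi> = inv_into S.X \<phi>"
  have inj: "inj_on \<phi> S.X" and im: "\<phi> ` S.X = S'.X" using b by (simp_all add: bij_betw_def)
  have inj': "inj_on \<psi> S'.X" and im': "\<psi> ` S'.X = S.X"
    using bij_betw_inv_into[OF b] by (simp_all add: \<psi>_def bij_betw_def)
  have \<psi>\<phi>: "\<psi> ` \<phi> ` a = a" if "a \<subseteq> S.X" for a
    using inv_into_image_cancel[OF inj that] by (simp add: \<psi>_def)
  have \<phi>\<psi>: "\<phi> ` \<psi> ` a = a" if "a \<subseteq> S'.X" for a
    using image_inv_into_cancel[OF im that] by (simp add: \<psi>_def)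
  have AP: "S.A \<subseteq> Pow S.X" and BP: "S.B \<subseteq> Pow S.X" and AP': "S'.A \<subseteq> Pow S'.X" and BP': "S'.B \<subseteq> Pow S'.X"
    by (auto dest: clop_subset)
  have A': "image \<psi> ` S'.A = S.A"
  proof -
    have "image \<psi> ` image \<phi> ` S.A = (\<lambda>a. a) ` S.A"
      unfolding image_image[of "image \<psi>"] using \<psi>\<phi>[OF clop_subset] by (intro image_cong) auto
    then show ?thesis unfolding A by simp
  qed
  have B': "image \<psi> ` S'.B = S.B"
  proof -
    have "image \<psi> ` image \<phi> ` S.B = (\<lambda>a. a) ` S.B"
      unfolding image_image[of "image \<psi>"] using \<psi>\<phi>[OF clop_subset] by (intro image_cong) auto
    then show ?thesis unfolding B by simp
  qed
  have q': "\<phi> q \<in> S'.X" using q im by blast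
  have \<psi>q: "\<psi> (\<phi> q) = q" using inj q by (simp add: \<psi>_def)
  have le_iff: "S'.le (\<phi> q) (\<phi> ` K) (\<phi> ` L) \<longleftrightarrow> S.le q K L" if "K \<subseteq> S.X" "L \<subseteq> S.X" for K L
    using germ_le_image[OF inj q BP that] unfolding B .
  have vt: "t \<in> S.tq q" if "t \<in> ?V" for t using that by (simp add: S.vq_def)
  have vt': "t \<in> S'.tq (\<phi> q)" if "t \<in> ?V'" for t using that by (simp add: S'.vq_def)
  have "\<exists>t'\<in>?V'. S'.le (\<phi> q) (\<phi> ` S.zero {t}) (S'.zero {t'}) \<and> S'.le (\<phi> q) (S'.zero {t'}) (\<phi> ` S.zero {t})"
    if t: "t \<in> ?V" for t
    using prime_germ_image[OF inj q AP BP S.prime_zero[OF q t]] unfolding A B im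
    by (rule S'.prime_germ_is_zero[OF q'])
  then obtain f where f: "\<And>t. t \<in> ?V \<Longrightarrow> f t \<in> ?V'"
    "\<And>t. t \<in> ?V \<Longrightarrow> S'.le (\<phi> q) (\<phi> ` S.zero {t}) (S'.zero {f t})"
    "\<And>t. t \<in> ?V \<Longrightarrow> S'.le (\<phi> q) (S'.zero {f t}) (\<phi> ` S.zero {t})" by metis
  have ord: "suffix t s \<longleftrightarrow> suffix (f t) (f s)" if st: "s \<in> ?V" "t \<in> ?V" for s t
  proof -
    have "suffix t s \<longleftrightarrow> S.le q (S.zero {s}) (S.zero {t})"
      using S.le_zero_iff[OF q vt[OF st(1)] vt[OF st(2)]] by simp
    also have "\<dots> \<longleftrightarrow> S'.le (\<phi> q) (\<phi> ` S.zero {s}) (\<phi> ` S.zero {t})"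
      using le_iff[OF S.zero_subset S.zero_subset] by simp
    also have "\<dots> \<longleftrightarrow> S'.le (\<phi> q) (S'.zero {f s}) (S'.zero {f t})"
    proof
      assume l: "S'.le (\<phi> q) (\<phi> ` S.zero {s}) (\<phi> ` S.zero {t})"
      show "S'.le (\<phi> q) (S'.zero {f s}) (S'.zero {f t})"
        by (rule S'.le_trans[OF f(3)[OF st(1)] S'.le_trans[OF l f(2)[OF st(2)]]])
    next
      assume l: "S'.le (\<phi> q) (S'.zero {f s}) (S'.zero {f t})"
      show "S'.le (\<phi> q) (\<phi> ` S.zero {s}) (\<phi> ` S.zero {t})"
        by (rule S'.le_trans[OF f(2)[OF st(1)] S'.le_trans[OF l f(3)[OF st(2)]]])
    qed
    also have "\<dots> \<longleftrightarrow> suffix (f t) (f s)"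
      using S'.le_zero_iff[OF q' vt'[OF f(1)[OF st(1)]] vt'[OF f(1)[OF st(2)]]] .
    finally show ?thesis .
  qed
  have "inj_on f ?V"
  proof (rule inj_onI)
    fix s t assume st: "s \<in> ?V" "t \<in> ?V" "f s = f t"
    then have "suffix s t" "suffix t s" using ord[of s t] ord[of t s] by simp_all
    then show "s = t" by (rule suffix_order.antisym)
  qed
  moreover have "f ` ?V = ?V'"
  proof
    show "f ` ?V \<subseteq> ?V'" using f(1) by blast
    show "?V' \<subseteq> f ` ?V"
    proof
      fix t' assume t': "t' \<in> ?V'"
      have "prime_germ S.X S.A S.B q (\<psi> ` S'.zero {t'})"
        using prime_germ_image[OF inj' q' AP' BP' S'.prime_zero[OF q' t']] unfolding A' B' im' \<psi>q .
      then obtain t where t: "t \<in> ?V" "S.le q (\<psi> ` S'.zero {t'}) (S.zero {t})" "S.le q (S.zero {t}) (\<psi> ` S'.zero {t'})"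
        using S.prime_germ_is_zero[OF q] by blast
      have sub: "\<psi> ` S'.zero {t'} \<subseteq> S.X" using S'.zero_subset im' by blast
      have "S'.le (\<phi> q) (S'.zero {t'}) (\<phi> ` S.zero {t})" "S'.le (\<phi> q) (\<phi> ` S.zero {t}) (S'.zero {t'})"
        using t(2,3) le_iff[OF sub S.zero_subset] le_iff[OF S.zero_subset sub] \<phi>\<psi>[OF S'.zero_subset] by simp_all
      then have "S'.le (\<phi> q) (S'.zero {t'}) (S'.zero {f t})" "S'.le (\<phi> q) (S'.zero {f t}) (S'.zero {t'})"
        using S'.le_trans f(2,3)[OF t(1)] by blast+
      then have "suffix (f t) t'" "suffix t' (f t)"
        using S'.le_zero_iff[OF q'] vt'[OF t'] vt'[OF f(1)[OF t(1)]] by simp_all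
      then have "t' = f t" by (intro suffix_order.antisym)
      then show "t' \<in> f ` ?V" using t(1) by blast
    qed
  qed
  ultimately show thesis using ord by (intro that[of f]) (simp_all add: bij_betw_def)
qed

section \<open>Descending trees\<close>

text \<open>A node is a list with the root end last, and suffixes are its predecessors. The
  first component of an entry is the descending label; the second one only multiplies
  the children, so that every nonterminal node over a proper subset \<open>Q\<close> has a child
  outside.\<close>

fun child :: "'k rel \<Rightarrow> 'k set \<Rightarrow> ('k \<times> 'k) list \<Rightarrow> 'k set" where
  "child \<kappa> S [] = S"
| "child \<kappa> S (x # t) = underS \<kappa> (fst x)"

primrec dtree :: "'k rel \<Rightarrow> 'k set \<Rightarrow> ('k \<times> 'k) list \<Rightarrow> bool" where
  "dtree \<kappa> S [] \<longleftrightarrow> True"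
| "dtree \<kappa> S (x # t) \<longleftrightarrow> dtree \<kappa> S t \<and> fst x \<in> child \<kappa> S t \<and> snd x \<in> Field \<kappa>"

definition tree :: "'k rel \<Rightarrow> 'k set \<Rightarrow> ('k \<times> 'k) list set" where
  "tree \<kappa> S = {t. dtree \<kappa> S t}"

definition subtree_over :: "'k rel \<Rightarrow> 'k set \<Rightarrow> 'k set \<Rightarrow> ('k \<times> 'k) list set" where
  "subtree_over \<kappa> S Q = {t. dtree \<kappa> S t \<and> set t \<subseteq> Q \<times> Q}"

section \<open>Branches of the descending tree\<close>

lemma dtree_append: "dtree \<kappa> S (w @ t) \<Longrightarrow> dtree \<kappa> S t"
  by (induction w) auto

lemma dtree_suffix: "dtree \<kappa> S t \<Longrightarrow> suffix s t \<Longrightarrow> dtree \<kappa> S s"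
  by (auto simp: suffix_def intro: dtree_append)

lemma subtree_tree: "subtree (tree \<kappa> S) (subtree_over \<kappa> S Q)"
proof
  fix t s assume t: "t \<in> subtree_over \<kappa> S Q" and s: "suffix s t"
  have "set s \<subseteq> set t" using s by (auto simp: suffix_def)
  then show "s \<in> subtree_over \<kappa> S Q" using t dtree_suffix[OF _ s] by (auto simp: subtree_over_def)
qed (auto simp: tree_def subtree_over_def intro: dtree_suffix)

lemma dtree_descend:
  assumes tr: "trans \<kappa>" "antisym \<kappa>" and d: "dtree \<kappa> S (w @ x # u)" and w: "w \<noteq> []"
  shows "fst (hd w) \<in> underS \<kappa> (fst x)"
  using d w
proof (induction w)
  case (Cons y w)
  show ?case
  proof (cases w)
    case Nil
    then show ?thesis using Cons.prems by simp
  next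
    case (Cons z w')
    then have "fst z \<in> underS \<kappa> (fst x)" using Cons.IH Cons.prems by simp
    moreover have "fst y \<in> underS \<kappa> (fst z)" using Cons.prems Cons by simp
    ultimately show ?thesis
      using underS_incr[OF tr, of "fst z" "fst x"] by (auto simp: underS_def)
  qed
qed simp

text \<open>A multiplicity outside \<open>Q\<close> turns any available label into a child outside
  the subtree.\<close>

lemma vis_tree:
  assumes "\<exists>i\<in>Field \<kappa>. i \<notin> Q"
  shows "subtree.vis (tree \<kappa> S) (subtree_over \<kappa> S Q) = {t \<in> subtree_over \<kappa> S Q. child \<kappa> S t \<noteq> {}}"
proof -
  interpret subtree "tree \<kappa> S" "subtree_over \<kappa> S Q" by (rule subtree_tree)
  obtain i where i: "i \<in> Field \<kappa>" "i \<notin> Q" using assms by blast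
  show ?thesis
  proof (intro equalityI subsetI)
    fix t assume "t \<in> vis"
    then obtain x where x: "t \<in> subtree_over \<kappa> S Q" "x # t \<in> tree \<kappa> S" unfolding vis_def by blast
    then have "fst x \<in> child \<kappa> S t" by (simp add: tree_def)
    then show "t \<in> {t \<in> subtree_over \<kappa> S Q. child \<kappa> S t \<noteq> {}}" using x by blast
  next
    fix t assume "t \<in> {t \<in> subtree_over \<kappa> S Q. child \<kappa> S t \<noteq> {}}"
    then obtain \<beta> where t: "t \<in> subtree_over \<kappa> S Q" "\<beta> \<in> child \<kappa> S t" by blast
    then have "(\<beta>, i) # t \<in> tree \<kappa> S - subtree_over \<kappa> S Q"
      using i by (auto simp: subtree_over_def tree_def)
    then show "t \<in> vis" unfolding vis_def using t(1) by blast
  qed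
qed

lemma strict_suffix_split:
  assumes "suffix t s" "t \<noteq> s" obtains w where "s = w @ t" "w \<noteq> []"
  using assms by (auto simp: suffix_def)

text \<open>The labels below a node are read off the isomorphism of the forests of visible
  nodes: by induction along \<open>\<kappa>\<close> it preserves all labels, so the root of the first tree
  corresponds to a node with the same visible child labels.\<close>

lemma forest_isomorphism_labels:
  fixes \<kappa> :: "'k rel"
  assumes \<kappa>: "Well_order \<kappa>" and S: "S \<subseteq> Field \<kappa>" "S' \<subseteq> Field \<kappa>" and Q: "Q \<subseteq> Field \<kappa>"
    and V: "V = {t \<in> subtree_over \<kappa> S Q. child \<kappa> S t \<noteq> {}}"
    and V': "V' \<subseteq> {t \<in> subtree_over \<kappa> S' Q. child \<kappa> S' t \<noteq> {}}"
    and up: "\<And>s t. t \<in> V' \<Longrightarrow> suffix t s \<Longrightarrow> s \<in> subtree_over \<kappa> S' Q \<Longrightarrow> child \<kappa> S' s \<noteq> {} \<Longrightarrow> s \<in> V'"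
    and f: "bij_betw f V V'" "\<And>s t. s \<in> V \<Longrightarrow> t \<in> V \<Longrightarrow> suffix t s \<longleftrightarrow> suffix (f t) (f s)"
    and S_ne: "S \<noteq> {}"
  shows "{\<beta> \<in> S \<inter> Q. underS \<kappa> \<beta> \<noteq> {}} = {\<beta> \<in> child \<kappa> S' (f []) \<inter> Q. underS \<kappa> \<beta> \<noteq> {}}"
proof -
  have lin: "Linear_order \<kappa>" and wf: "wf (\<kappa> - Id)" using \<kappa> by (simp_all add: well_order_on_def)
  have tr: "trans \<kappa>" and an: "antisym \<kappa>" and tot: "total_on (Field \<kappa>) \<kappa>"
    using lin by (simp_all add: linear_order_on_def partial_order_on_def preorder_on_def)
  have inj: "f s = f t \<Longrightarrow> s = t" if "s \<in> V" "t \<in> V" for s t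
    using f(1) that by (auto simp: bij_betw_def dest: inj_onD)
  have fV: "f t \<in> V'" if "t \<in> V" for t using f(1) that by (auto simp: bij_betw_def)
  have surj: "\<exists>t\<in>V. f t = t'" if "t' \<in> V'" for t' using f(1) that by (auto simp: bij_betw_def)
  have dV: "dtree \<kappa> S t" "set t \<subseteq> Q \<times> Q" if "t \<in> V" for t using that by (auto simp: V subtree_over_def)
  have dV': "dtree \<kappa> S' t" "set t \<subseteq> Q \<times> Q" "child \<kappa> S' t \<noteq> {}" if "t \<in> V'" for t
    using that V' by (auto simp: subtree_over_def)
  have root: "[] \<in> V" using S_ne by (simp add: V subtree_over_def)
  have f_Cons: "\<exists>x u. f t = x # u" if "t \<in> V" "t \<noteq> []" for t
  proof -
    have "suffix (f []) (f t)" using f(2)[OF that(1) root] by simp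
    moreover have "f [] \<noteq> f t" using inj[OF root that(1)] that(2) by metis
    ultimately show ?thesis by (cases "f t") auto
  qed
  have mem: "(\<beta>, \<beta>) # t \<in> V" if "t \<in> V" "\<beta> \<in> child \<kappa> S t" "\<beta> \<in> Q" "underS \<kappa> \<beta> \<noteq> {}" for \<beta> t
    using that dV[OF that(1)] Q by (auto simp: V subtree_over_def)
  have mem': "(\<beta>, \<beta>) # t \<in> V'" if "t \<in> V'" "\<beta> \<in> child \<kappa> S' t" "\<beta> \<in> Q" "underS \<kappa> \<beta> \<noteq> {}" for \<beta> t
  proof (rule up[OF that(1)])
    show "(\<beta>, \<beta>) # t \<in> subtree_over \<kappa> S' Q"
      using that dV'[OF that(1)] Q by (auto simp: subtree_over_def)
  qed (use that in \<open>auto simp: suffix_Cons\<close>)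
  \<comment> \<open>Induction on the head label \<open>\<alpha>\<close>. If the labels differed, in
    either direction, a node with a smaller head label would also change its label.\<close>
  have label: "\<alpha>' = \<alpha>" if "t \<in> V" "t = (\<alpha>, j) # u" "f t = (\<alpha>', j') # u'" for \<alpha> \<alpha>' t j j' u u'
    using that
  proof (induction \<alpha> arbitrary: \<alpha>' t j j' u u' rule: wf_induct_rule[OF wf])
    case (1 \<alpha>)
    have IH: "\<gamma>' = \<gamma>" if "\<gamma> \<in> underS \<kappa> \<alpha>" "s \<in> V" "s = (\<gamma>, i) # v" "f s = (\<gamma>', i') # v'" for \<gamma> \<gamma>' s i i' v v'
      using "1.IH"[of \<gamma> s i v \<gamma>' i' v'] that by (auto simp: underS_def)
    have tV: "t \<in> V" and t: "t = (\<alpha>, j) # u" and ft: "f t = (\<alpha>', j') # u'" by fact+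
    have \<alpha>: "\<alpha> \<in> Q" "underS \<kappa> \<alpha> \<noteq> {}" using tV unfolding t by (auto simp: V subtree_over_def)
    have \<alpha>': "\<alpha>' \<in> Q" "underS \<kappa> \<alpha>' \<noteq> {}" using dV'(2,3)[OF fV[OF tV]] unfolding ft by auto
    have "\<alpha>' = \<alpha> \<or> \<alpha> \<in> underS \<kappa> \<alpha>' \<or> \<alpha>' \<in> underS \<kappa> \<alpha>"
      using tot \<alpha>(1) \<alpha>'(1) Q unfolding total_on_def underS_def by blast
    \<comment> \<open>The child of \<open>f t\<close> with label \<open>\<alpha>\<close> has a
      preimage that properly extends \<open>t\<close>. The head label of this preimage is smaller
      than \<open>\<alpha>\<close>, yet by induction equal to it.\<close>
    moreover have False if a: "\<alpha> \<in> underS \<kappa> \<alpha>'"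
    proof -
      have s': "(\<alpha>, \<alpha>) # f t \<in> V'" using mem'[OF fV[OF tV]] a \<alpha> unfolding ft by simp
      then obtain s where s: "s \<in> V" "f s = (\<alpha>, \<alpha>) # f t" using surj by blast
      then have "suffix t s" "t \<noteq> s" using f(2)[OF s(1) tV] by (auto simp: suffix_Cons)
      then obtain w where w: "s = w @ t" "w \<noteq> []" by (rule strict_suffix_split)
      obtain y w' where y: "w = y # w'" using w(2) by (cases w) auto
      have "fst y \<in> underS \<kappa> \<alpha>" using dtree_descend[OF tr an, of S w "(\<alpha>, j)" u] dV(1)[OF s(1)] w y t by simp
      moreover from this have "\<alpha> = fst y" using IH[of "fst y" s "snd y" "w' @ t" \<alpha> \<alpha> "f t"] s w y by simp
      ultimately show False by (simp add: underS_def)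
    qed
    \<comment> \<open>Conversely, the child of \<open>t\<close> with label \<open>\<alpha>'\<close>
      has an image properly extending \<open>f t\<close>, with a head label smaller than
      \<open>\<alpha>'\<close>.\<close>
    moreover have False if a: "\<alpha>' \<in> underS \<kappa> \<alpha>"
    proof -
      have s: "(\<alpha>', \<alpha>') # t \<in> V" using mem[OF tV] a \<alpha>' unfolding t by simp
      let ?s = "(\<alpha>', \<alpha>') # t"
      have "suffix (f t) (f ?s)" using f(2)[OF s tV] by (simp add: suffix_Cons)
      moreover have "f t \<noteq> f ?s" using inj[OF tV s] by auto
      ultimately obtain w where w: "f ?s = w @ f t" "w \<noteq> []" by (rule strict_suffix_split)
      obtain y w' where y: "w = y # w'" using w(2) by (cases w) auto
      have "fst y \<in> underS \<kappa> \<alpha>'"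
        using dtree_descend[OF tr an, of S' w "(\<alpha>', j')" u'] dV'(1)[OF fV[OF s]] w y ft by simp
      moreover have "fst y = \<alpha>'" using IH[OF a s refl, of "fst y" "snd y" "w' @ f t"] w y by simp
      ultimately show False by (simp add: underS_def)
    qed
    ultimately show "\<alpha>' = \<alpha>" by blast
  qed
  have r: "f [] \<in> V'" using fV[OF root] .
  have sufr: "suffix (f []) (f t)" if "t \<in> V" for t using f(2)[OF that root] by simp
  show ?thesis
  proof (intro equalityI subsetI)
    fix \<beta> assume "\<beta> \<in> {\<beta> \<in> S \<inter> Q. underS \<kappa> \<beta> \<noteq> {}}"
    then have \<beta>: "\<beta> \<in> S" "\<beta> \<in> Q" "underS \<kappa> \<beta> \<noteq> {}" by auto
    let ?s = "[(\<beta>, \<beta>)]"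
    have s: "?s \<in> V" using mem[OF root] \<beta> by simp
    have "f [] \<noteq> f ?s" using inj[OF root s] by auto
    then obtain w where w: "f ?s = w @ f []" "w \<noteq> []" using strict_suffix_split[OF sufr[OF s]] by metis
    \<comment> \<open>\<open>y\<close> is the first step from \<open>f []\<close> towards the image
      of \<open>?s\<close>. It leads to the image of some \<open>s1\<close> strictly above the root
      and at most \<open>?s\<close>, hence of \<open>?s\<close> itself.\<close>
    define y where "y = last w"
    have w': "w = butlast w @ [y]" using w(2) by (simp add: y_def)
    let ?t' = "y # f []"
    have fs: "f ?s = butlast w @ ?t'" using w(1) w' by (metis append.assoc append_Cons append_Nil)
    have t'U: "?t' \<in> subtree_over \<kappa> S' Q"
      using dV'[OF fV[OF s]] dtree_append[of \<kappa> S' "butlast w" ?t'] unfolding fs by (auto simp: subtree_over_def)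
    have "child \<kappa> S' ?t' \<noteq> {}"
    proof (cases "butlast w = []")
      case True
      then show ?thesis using dV'(3)[OF fV[OF s]] fs by simp
    next
      case False
      then show ?thesis using dtree_descend[OF tr an, of S' "butlast w" y "f []"] dV'(1)[OF fV[OF s]] fs by auto
    qed
    then have "?t' \<in> V'" using up[OF r _ t'U] by (simp add: suffix_Cons)
    then obtain s1 where s1: "s1 \<in> V" "f s1 = ?t'" using surj by blast
    have "suffix (f s1) (f ?s)" unfolding s1(2) fs by (simp add: suffix_def)
    then have "suffix s1 ?s" using f(2)[OF s s1(1)] by simp
    moreover have "s1 \<noteq> []" using s1(2) by auto
    ultimately have "s1 = ?s" by (auto simp: suffix_Cons)
    then have "fst y = \<beta>" using label[OF s refl, of "fst y" "snd y" "f []"] s1(2) by simp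
    then show "\<beta> \<in> {\<beta> \<in> child \<kappa> S' (f []) \<inter> Q. underS \<kappa> \<beta> \<noteq> {}}"
      using t'U \<beta> by (auto simp: subtree_over_def)
  next
    fix \<beta> assume "\<beta> \<in> {\<beta> \<in> child \<kappa> S' (f []) \<inter> Q. underS \<kappa> \<beta> \<noteq> {}}"
    then have \<beta>: "\<beta> \<in> child \<kappa> S' (f [])" "\<beta> \<in> Q" "underS \<kappa> \<beta> \<noteq> {}" by auto
    have "(\<beta>, \<beta>) # f [] \<in> V'" using mem'[OF r] \<beta> by simp
    then obtain s where s: "s \<in> V" "f s = (\<beta>, \<beta>) # f []" using surj by blast
    then have "s \<noteq> []" by auto
    \<comment> \<open>\<open>[x]\<close> is the first node above the root on the way to
      \<open>s\<close>; its image lies strictly above \<open>f []\<close> and so is the given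
      child.\<close>
    define x where "x = last s"
    have s': "s = butlast s @ [x]" using \<open>s \<noteq> []\<close> by (simp add: x_def)
    have "child \<kappa> S [x] \<noteq> {}"
    proof (cases "butlast s = []")
      case True
      then show ?thesis using s(1) s' by (auto simp: V)
    next
      case False
      then show ?thesis using dtree_descend[OF tr an, of S "butlast s" x "[]"] dV(1)[OF s(1)] s' by auto
    qed
    moreover have "dtree \<kappa> S [x]" using dtree_append[of \<kappa> S "butlast s" "[x]"] dV(1)[OF s(1)] s' by simp
    moreover have "x \<in> Q \<times> Q" using dV(2)[OF s(1)] \<open>s \<noteq> []\<close> by (auto simp: x_def)
    ultimately have xV: "[x] \<in> V" by (simp add: V subtree_over_def)
    have "suffix [x] s" using s' by (metis suffixI)
    then have "suffix (f [x]) ((\<beta>, \<beta>) # f [])" using f(2)[OF s(1) xV] s(2) by simp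
    moreover have "f [x] \<noteq> f []" using inj[OF xV root] by auto
    moreover have "suffix (f []) (f [x])" using sufr[OF xV] .
    ultimately have "f [x] = (\<beta>, \<beta>) # f []" by (auto simp: suffix_Cons dest: suffix_order.antisym)
    then have "\<beta> = fst x" using label[OF xV, of "fst x" "snd x" "[]" \<beta> \<beta> "f []"] by simp
    then show "\<beta> \<in> {\<beta> \<in> S \<inter> Q. underS \<kappa> \<beta> \<noteq> {}}" using \<open>dtree \<kappa> S [x]\<close> \<beta> by simp
  qed
qed

text \<open>Closing off \<omega> times suffices, because a finite list over the union of the stages
  already lies over one stage.\<close>

lemma countable_closure:
  fixes N :: "('k \<times> 'k) list \<Rightarrow> 'k set"
  assumes N: "\<And>t. countable (N t)" "\<And>t. N t \<subseteq> K" and Q0: "countable Q0" "Q0 \<subseteq> K"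
  obtains Q where "countable Q" "Q0 \<subseteq> Q" "Q \<subseteq> K" "\<And>t. set t \<subseteq> Q \<times> Q \<Longrightarrow> N t \<subseteq> Q"
proof -
  define step where "step = (\<lambda>Q. Q \<union> (\<Union>t\<in>lists (Q \<times> Q). N t))"
  define R where "R = (\<lambda>n. (step ^^ n) Q0)"
  have R_Suc: "R (Suc n) = step (R n)" for n by (simp add: R_def)
  have cnt: "countable (R n)" for n
  proof (induction n)
    case (Suc n)
    then have "countable (lists (R n \<times> R n))" by (intro countable_lists countable_SIGMA)
    then show ?case unfolding R_Suc step_def using Suc N(1) by (intro countable_Un countable_UN)
  qed (simp add: R_def Q0)
  have sub: "R n \<subseteq> K" for n
  proof (induction n)
    case (Suc n)
    then show ?case unfolding R_Suc step_def using N(2) by blast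
  qed (simp add: R_def Q0)
  have mono: "R m \<subseteq> R n" if "m \<le> n" for m n
    using that by (rule lift_Suc_mono_le[rotated]) (simp add: R_Suc step_def)
  define Q where "Q = (\<Union>n. R n)"
  have fin: "\<exists>n. set t \<subseteq> R n \<times> R n" if "set t \<subseteq> Q \<times> Q" for t
    using that
  proof (induction t)
    case (Cons x t)
    then obtain n where n: "set t \<subseteq> R n \<times> R n" by auto
    obtain i j where ij: "fst x \<in> R i" "snd x \<in> R j" using Cons.prems unfolding Q_def by auto
    let ?m = "max n (max i j)"
    have m: "R n \<subseteq> R ?m" "R i \<subseteq> R ?m" "R j \<subseteq> R ?m" by (simp_all add: mono)
    have "x \<in> R ?m \<times> R ?m" using ij m by (auto simp: mem_Times_iff)
    moreover have "set t \<subseteq> R ?m \<times> R ?m" using n m(1) by blast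
    ultimately show ?case by (intro exI[of _ ?m]) simp
  qed simp
  show thesis
  proof (rule that[of Q])
    show "countable Q" unfolding Q_def using cnt by (intro countable_UN) simp_all
    have "Q0 = R 0" by (simp add: R_def)
    then show "Q0 \<subseteq> Q" unfolding Q_def by blast
    show "Q \<subseteq> K" unfolding Q_def using sub by blast
    show "N t \<subseteq> Q" if t: "set t \<subseteq> Q \<times> Q" for t
    proof -
      obtain n where "set t \<subseteq> R n \<times> R n" using fin[OF t] ..
      then have "t \<in> lists (R n \<times> R n)" by (simp add: in_lists_conv_set subset_code(1))
      then have "N t \<subseteq> R (Suc n)" unfolding R_Suc step_def by blast
      then show ?thesis unfolding Q_def by blast
    qed
  qed
qed

section \<open>Countable label sets respected by a homeomorphism\<close>

lemma clop_image_subset: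
  assumes inj: "inj_on \<phi> X" and im: "\<phi> ` X = X'"
    and gen: "\<And>x. x \<in> P \<Longrightarrow> \<phi> ` cyl X x \<in> clop X' P'"
    and a: "a \<in> clop X P"
  shows "\<phi> ` a \<in> clop X' P'"
  using a
proof (induction rule: clop_induct)
  case (compl a)
  have "\<phi> ` (X - a) = X' - \<phi> ` a"
    using inj_on_image_set_diff[OF inj, of X a] clop_subset[OF compl(1)] im by blast
  then show ?case using compl by (simp add: clop_compl)
qed (simp_all add: gen image_Un clop_un)

definition labels :: "(('k \<times> 'k) list \<times> nat) set \<Rightarrow> 'k set" where
  "labels F = (\<Union>x\<in>F. fst ` set (fst x) \<union> snd ` set (fst x))"

lemma labels_subset_iff: "labels F \<subseteq> Q \<longleftrightarrow> (\<forall>x\<in>F. set (fst x) \<subseteq> Q \<times> Q)"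
  unfolding labels_def UN_subset_iff Un_subset_iff image_subset_iff subset_eq[of _ "Q \<times> Q"] mem_Times_iff by blast

lemma subset_subtree_over:
  assumes "D \<subseteq> tree \<kappa> R \<times> UNIV" "labels D \<subseteq> Q" shows "D \<subseteq> subtree_over \<kappa> R Q \<times> UNIV"
proof
  fix x assume x: "x \<in> D"
  then have "fst x \<in> tree \<kappa> R" using assms(1) by auto
  moreover have "set (fst x) \<subseteq> Q \<times> Q" using assms(2) x unfolding labels_subset_iff by (rule bspec)
  ultimately show "x \<in> subtree_over \<kappa> R Q \<times> UNIV"
    by (simp add: subtree_over_def tree_def mem_Times_iff)
qed

lemma dtree_labels:
  assumes "S \<subseteq> Field \<kappa>" "dtree \<kappa> S t" shows "set t \<subseteq> Field \<kappa> \<times> Field \<kappa>"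
  using assms(2)
proof (induction t)
  case (Cons x t)
  have "child \<kappa> S t \<subseteq> Field \<kappa>" using assms(1) by (cases t) (auto simp: underS_def Field_def)
  then show ?case using Cons by (auto simp: mem_Times_iff)
qed simp

text \<open>It suffices that the images of generators over \<open>Q\<close>, in both directions,
  have supports over \<open>Q\<close>. These supports are finite, so a countable set of labels can
  be closed under them.\<close>

lemma clop_homeo_subtree:
  assumes S: "S \<subseteq> Field \<kappa>" "S' \<subseteq> Field \<kappa>" and Q0: "countable Q0" "Q0 \<subseteq> Field \<kappa>"
    and h: "clop_homeo (tree \<kappa> S) tedge (tree \<kappa> S') tedge \<phi>"
  obtains Q where "countable Q" "Q0 \<subseteq> Q" "Q \<subseteq> Field \<kappa>"
    "image \<phi> ` clop (pts (tree \<kappa> S) tedge) (subtree_over \<kappa> S Q \<times> UNIV) =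
     clop (pts (tree \<kappa> S') tedge) (subtree_over \<kappa> S' Q \<times> UNIV)"
proof -
  let ?X = "pts (tree \<kappa> S) tedge" and ?X' = "pts (tree \<kappa> S') tedge"
  let ?P = "tree \<kappa> S \<times> (UNIV :: nat set)" and ?P' = "tree \<kappa> S' \<times> (UNIV :: nat set)"
  define \<psi> where "\<psi> = inv_into ?X \<phi>"
  have b: "bij_betw \<phi> ?X ?X'" using h by (simp add: clop_homeo_def)
  have A: "image \<phi> ` clop ?X ?P = clop ?X' ?P'" by (rule clop_homeo_image[OF h])
  have inj: "inj_on \<phi> ?X" and im: "\<phi> ` ?X = ?X'" using b by (simp_all add: bij_betw_def)
  have inj': "inj_on \<psi> ?X'" and im': "\<psi> ` ?X' = ?X"
    using bij_betw_inv_into[OF b] by (simp_all add: \<psi>_def bij_betw_def)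
  have \<phi>\<psi>: "\<phi> ` \<psi> ` a = a" if "a \<subseteq> ?X'" for a
    using image_inv_into_cancel[OF im that] by (simp add: \<psi>_def)
  have \<psi>\<phi>: "\<psi> ` \<phi> ` a = a" if "a \<subseteq> ?X" for a
    using inv_into_image_cancel[OF inj that] by (simp add: \<psi>_def)
  have supp: "\<exists>F. finite F \<and> F \<subseteq> P \<and> a \<in> clop X F" if "a \<in> clop X P"
    for a :: "(('k \<times> 'k) list \<Rightarrow> nat) set" and X P
    using that unfolding clop_def by blast
  have "\<exists>F. finite F \<and> F \<subseteq> ?P' \<and> \<phi> ` cyl ?X x \<in> clop ?X' F" if "x \<in> ?P" for x
  proof (rule supp)
    have "cyl ?X x \<in> clop ?X ?P" using that by (rule cyl_clop)
    then show "\<phi> ` cyl ?X x \<in> clop ?X' ?P'" unfolding A[symmetric] by (rule imageI)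
  qed
  then obtain F where F: "\<And>x. x \<in> ?P \<Longrightarrow> finite (F x)" "\<And>x. x \<in> ?P \<Longrightarrow> F x \<subseteq> ?P'"
    "\<And>x. x \<in> ?P \<Longrightarrow> \<phi> ` cyl ?X x \<in> clop ?X' (F x)" by metis
  have "\<exists>F. finite F \<and> F \<subseteq> ?P \<and> \<psi> ` cyl ?X' x \<in> clop ?X F" if "x \<in> ?P'" for x
  proof (rule supp)
    have "cyl ?X' x \<in> clop ?X' ?P'" using that by (rule cyl_clop)
    then obtain a where "a \<in> clop ?X ?P" "cyl ?X' x = \<phi> ` a" unfolding A[symmetric] by (rule imageE)
    then show "\<psi> ` cyl ?X' x \<in> clop ?X ?P" using \<psi>\<phi>[OF clop_subset] by simp
  qed
  then obtain F' where F': "\<And>x. x \<in> ?P' \<Longrightarrow> finite (F' x)" "\<And>x. x \<in> ?P' \<Longrightarrow> F' x \<subseteq> ?P"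
    "\<And>x. x \<in> ?P' \<Longrightarrow> \<psi> ` cyl ?X' x \<in> clop ?X (F' x)" by metis
  \<comment> \<open>\<open>N t\<close> collects the labels in the supports of the images of all
    generators at \<open>t\<close>, under \<open>\<phi>\<close> and under its inverse.\<close>
  define N where "N = (\<lambda>t. (if t \<in> tree \<kappa> S then \<Union>k. labels (F (t, k)) else {}) \<union>
    (if t \<in> tree \<kappa> S' then \<Union>k. labels (F' (t, k)) else {}))"
  have fin_labels: "countable (labels D)" if "finite D" for D :: "(('k \<times> 'k) list \<times> nat) set"
    unfolding labels_def by (rule countable_finite) (use that in auto)
  have sub_labels: "labels D \<subseteq> Field \<kappa>" if "D \<subseteq> tree \<kappa> R \<times> UNIV" "R \<subseteq> Field \<kappa>" for D and R
    unfolding labels_subset_iff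
  proof
    fix x assume "x \<in> D"
    then have "dtree \<kappa> R (fst x)" using that(1) by (auto simp: tree_def)
    then show "set (fst x) \<subseteq> Field \<kappa> \<times> Field \<kappa>" by (rule dtree_labels[OF that(2)])
  qed
  have cN: "countable (N t)" for t
    unfolding N_def using fin_labels F(1) F'(1) by (auto intro!: countable_Un countable_UN)
  have sN: "N t \<subseteq> Field \<kappa>" for t
  proof -
    have "labels (F (t, k)) \<subseteq> Field \<kappa>" if "t \<in> tree \<kappa> S" for k
      using sub_labels[OF F(2) S(2)] that by simp
    moreover have "labels (F' (t, k)) \<subseteq> Field \<kappa>" if "t \<in> tree \<kappa> S'" for k
      using sub_labels[OF F'(2) S(1)] that by simp
    ultimately show ?thesis unfolding N_def by (simp add: UN_subset_iff)
  qed
  obtain Q where Q: "countable Q" "Q0 \<subseteq> Q" "Q \<subseteq> Field \<kappa>" "\<And>t. set t \<subseteq> Q \<times> Q \<Longrightarrow> N t \<subseteq> Q"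
    using countable_closure[of N "Field \<kappa>" Q0, OF cN sN Q0] by blast
  let ?U = "subtree_over \<kappa> S Q" and ?U' = "subtree_over \<kappa> S' Q"
  have gen: "\<phi> ` cyl ?X x \<in> clop ?X' (?U' \<times> UNIV)" if xU: "x \<in> ?U \<times> UNIV" for x
  proof -
    obtain t k where x: "x = (t, k)" "t \<in> ?U" using xU by auto
    then have t: "t \<in> tree \<kappa> S" "set t \<subseteq> Q \<times> Q" by (auto simp: subtree_over_def tree_def)
    have "labels (F (t, k)) \<subseteq> N t" unfolding N_def using t(1) by (simp, blast)
    then have "labels (F x) \<subseteq> Q" using Q(4)[OF t(2)] unfolding x by (rule subset_trans)
    moreover have xP: "x \<in> ?P" using x t by simp
    ultimately have "F x \<subseteq> ?U' \<times> UNIV"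
      using subset_subtree_over[OF F(2)[OF xP]] by simp
    then show ?thesis using F(3)[OF xP] clop_mono[of "F x"] by blast
  qed
  have gen': "\<psi> ` cyl ?X' x \<in> clop ?X (?U \<times> UNIV)" if xU: "x \<in> ?U' \<times> UNIV" for x
  proof -
    obtain t k where x: "x = (t, k)" "t \<in> ?U'" using xU by auto
    then have t: "t \<in> tree \<kappa> S'" "set t \<subseteq> Q \<times> Q" by (auto simp: subtree_over_def tree_def)
    have "labels (F' (t, k)) \<subseteq> N t" unfolding N_def using t(1) by (simp, blast)
    then have "labels (F' x) \<subseteq> Q" using Q(4)[OF t(2)] unfolding x by (rule subset_trans)
    moreover have xP: "x \<in> ?P'" using x t by simp
    ultimately have "F' x \<subseteq> ?U \<times> UNIV"
      using subset_subtree_over[OF F'(2)[OF xP]] by simp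
    then show ?thesis using F'(3)[OF xP] clop_mono[of "F' x"] by blast
  qed
  have "image \<phi> ` clop ?X (?U \<times> UNIV) = clop ?X' (?U' \<times> UNIV)"
  proof
    show "image \<phi> ` clop ?X (?U \<times> UNIV) \<subseteq> clop ?X' (?U' \<times> UNIV)"
      using clop_image_subset[OF inj im gen] by blast
    show "clop ?X' (?U' \<times> UNIV) \<subseteq> image \<phi> ` clop ?X (?U \<times> UNIV)"
    proof
      fix a assume a: "a \<in> clop ?X' (?U' \<times> UNIV)"
      have "\<psi> ` a \<in> clop ?X (?U \<times> UNIV)" using clop_image_subset[OF inj' im' gen' a] .
      moreover have "a = \<phi> ` \<psi> ` a" using \<phi>\<psi>[OF clop_subset[OF a]] by simp
      ultimately show "a \<in> image \<phi> ` clop ?X (?U \<times> UNIV)" by (rule image_eqI[rotated])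
    qed
  qed
  with Q(1-3) show thesis by (rule that)
qed

text \<open>Within \<open>Q\<close>, the members of \<open>S\<close> are the nonminimal child labels
  of \<open>f []\<close>. If \<open>f []\<close> were not the root, its child labels would form an
  initial segment of \<open>\<kappa>\<close>; but \<open>S\<close> contains \<open>\<beta>1\<close>
  and omits the smaller \<open>\<beta>0\<close>. So \<open>f []\<close> is the root and
  \<open>S\<close>, \<open>S'\<close> agree on \<open>Q\<close>, which includes a label where they
  differ.\<close>

lemma clop_homeo_tree:
  fixes \<kappa> :: "'k rel"
  assumes \<kappa>: "Well_order \<kappa>" "uncountable (Field \<kappa>)"
    and S: "S \<subseteq> {\<beta> \<in> Field \<kappa>. underS \<kappa> \<beta> \<noteq> {}}" "S' \<subseteq> {\<beta> \<in> Field \<kappa>. underS \<kappa> \<beta> \<noteq> {}}"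
    and \<beta>: "\<beta>0 \<in> underS \<kappa> \<beta>1" "underS \<kappa> \<beta>0 \<noteq> {}" "\<beta>1 \<in> S" "\<beta>0 \<notin> S"
    and h: "clop_homeo (tree \<kappa> S) tedge (tree \<kappa> S') tedge \<phi>"
  shows "S = S'"
proof (rule ccontr)
  assume "S \<noteq> S'"
  then obtain x where x: "x \<in> S \<longleftrightarrow> x \<notin> S'" by blast
  then have xF: "x \<in> Field \<kappa>" using S by blast
  have SF: "S \<subseteq> Field \<kappa>" "S' \<subseteq> Field \<kappa>" using S by blast+
  have \<beta>F: "\<beta>0 \<in> Field \<kappa>" "\<beta>1 \<in> Field \<kappa>" using \<beta>(1) by (auto simp: underS_def Field_def)
  have "countable {\<beta>0, \<beta>1, x}" "{\<beta>0, \<beta>1, x} \<subseteq> Field \<kappa>" using xF \<beta>F by simp_all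
  from clop_homeo_subtree[OF SF this h]
  obtain Q where Q: "countable Q" "{\<beta>0, \<beta>1, x} \<subseteq> Q" "Q \<subseteq> Field \<kappa>"
    "image \<phi> ` clop (pts (tree \<kappa> S) tedge) (subtree_over \<kappa> S Q \<times> UNIV) =
     clop (pts (tree \<kappa> S') tedge) (subtree_over \<kappa> S' Q \<times> UNIV)" by blast
  have out: "\<exists>i\<in>Field \<kappa>. i \<notin> Q"
  proof (rule ccontr)
    assume "\<not> ?thesis"
    then have "Field \<kappa> \<subseteq> Q" by blast
    then show False using countable_subset[OF _ Q(1)] \<kappa>(2) by blast
  qed
  let ?U = "subtree_over \<kappa> S Q" and ?U' = "subtree_over \<kappa> S' Q"
  interpret T: subtree "tree \<kappa> S" ?U by (rule subtree_tree)
  interpret T': subtree "tree \<kappa> S'" ?U' by (rule subtree_tree)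
  have b: "bij_betw \<phi> T.X T'.X" using h by (simp add: clop_homeo_def)
  have z: "(\<lambda>_. 0) \<in> T.X" by (simp add: pts_def)
  \<comment> \<open>At the zero point every nonterminal node over \<open>Q\<close> takes part in the
    forest.\<close>
  let ?q = "\<lambda>_ :: ('k \<times> 'k) list. 0 :: nat"
  obtain f where f: "bij_betw f (T.vq ?q) (T'.vq (\<phi> ?q))"
    "\<And>s t. s \<in> T.vq ?q \<Longrightarrow> t \<in> T.vq ?q \<Longrightarrow> suffix t s \<longleftrightarrow> suffix (f t) (f s)"
    using forest_isomorphism[OF subtree_tree subtree_tree b clop_homeo_image[OF h] Q(4) z] by blast
  have V: "T.vq ?q = {t \<in> ?U. child \<kappa> S t \<noteq> {}}"
    using vis_tree[OF out, of S] by (auto simp: T.vq_def T.tq_def)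
  have V': "T'.vq (\<phi> ?q) \<subseteq> {t \<in> ?U'. child \<kappa> S' t \<noteq> {}}"
    using vis_tree[OF out, of S'] by (auto simp: T'.vq_def)
  have up: "s \<in> T'.vq (\<phi> ?q)" if "t \<in> T'.vq (\<phi> ?q)" "suffix t s" "s \<in> ?U'" "child \<kappa> S' s \<noteq> {}" for s t
    using T'.tq_up[of t "\<phi> ?q" s] that vis_tree[OF out, of S'] by (auto simp: T'.vq_def)
  have eq: "{\<beta> \<in> S \<inter> Q. underS \<kappa> \<beta> \<noteq> {}} = {\<beta> \<in> child \<kappa> S' (f []) \<inter> Q. underS \<kappa> \<beta> \<noteq> {}}"
    by (rule forest_isomorphism_labels[OF \<kappa>(1) SF Q(3) V V' up f]) (use \<beta>(3) in auto)
  have mem: "\<beta> \<in> S \<longleftrightarrow> \<beta> \<in> child \<kappa> S' (f [])" if "\<beta> \<in> Q" "underS \<kappa> \<beta> \<noteq> {}" for \<beta>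
  proof -
    have "\<beta> \<in> {\<beta> \<in> S \<inter> Q. underS \<kappa> \<beta> \<noteq> {}} \<longleftrightarrow> \<beta> \<in> {\<beta> \<in> child \<kappa> S' (f []) \<inter> Q. underS \<kappa> \<beta> \<noteq> {}}"
      unfolding eq ..
    then show ?thesis using that by simp
  qed
  have \<beta>Q: "\<beta>0 \<in> Q" "\<beta>1 \<in> Q" "x \<in> Q" using Q(2) by simp_all
  show False
  proof (cases "f []")
    case Nil
    have "underS \<kappa> x \<noteq> {}" using x S by blast
    then have "x \<in> S \<longleftrightarrow> x \<in> S'" using mem[OF \<beta>Q(3)] Nil by simp
    then show False using x by blast
  next
    case (Cons y u)
    have "underS \<kappa> \<beta>1 \<noteq> {}" using \<beta>(1) by blast
    then have "\<beta>1 \<in> underS \<kappa> (fst y)" using mem[OF \<beta>Q(2)] \<beta>(3) Cons by simp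
    then have "(\<beta>1, fst y) \<in> \<kappa>" by (simp add: underS_def)
    moreover have "trans \<kappa>" "antisym \<kappa>"
      using \<kappa>(1) by (simp_all add: well_order_on_def linear_order_on_def partial_order_on_def preorder_on_def)
    ultimately have "underS \<kappa> \<beta>1 \<subseteq> underS \<kappa> (fst y)" by (intro underS_incr)
    then have "\<beta>0 \<in> child \<kappa> S' (f [])" using \<beta>(1) Cons by auto
    then show False using mem[OF \<beta>Q(1) \<beta>(2)] \<beta>(4) by simp
  qed
qed

lemma sparse_graph_tree: "sparse_graph (tree \<kappa> S) tedge (\<lambda>t. {s. suffix s t})"
proof
  fix t :: "('a \<times> 'a) list"
  show "finite {s. suffix s t}" unfolding set_suffixes_eq[symmetric] by (rule finite_set)
qed (auto simp: tree_def tedge_def dest: dtree_suffix suffix_order.trans suffix_order.antisym)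

text \<open>Nodes are finite sequences over an infinite set, and one label in \<open>S\<close> with
  all its multiplicities already gives \<open>\<kappa>\<close> nodes.\<close>

lemma card_of_tree:
  assumes \<kappa>: "Card_order \<kappa>" "cinfinite \<kappa>" and S: "S \<subseteq> Field \<kappa>" "S \<noteq> {}"
  shows "|tree \<kappa> S| =o \<kappa>"
proof -
  have inf: "infinite (Field \<kappa>)" using \<kappa>(2) by (simp add: cinfinite_def)
  have "tree \<kappa> S \<subseteq> lists (Field \<kappa> \<times> Field \<kappa>)"
    using dtree_labels[OF S(1)] by (auto simp: tree_def in_lists_conv_set)
  then have "|tree \<kappa> S| \<le>o |lists (Field \<kappa> \<times> Field \<kappa>)|" by (rule card_of_mono1)
  also have "|lists (Field \<kappa> \<times> Field \<kappa>)| =o |Field \<kappa> \<times> Field \<kappa>|"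
    by (rule card_of_lists_infinite) (use inf in \<open>auto simp: finite_cartesian_product_iff\<close>)
  also have "|Field \<kappa> \<times> Field \<kappa>| =o |Field \<kappa>|" using inf by (rule card_of_Times_same_infinite)
  finally have 1: "|tree \<kappa> S| \<le>o |Field \<kappa>|" .
  obtain \<beta> where "\<beta> \<in> S" using S(2) by blast
  then have "inj_on (\<lambda>i. [(\<beta>, i)]) (Field \<kappa>) \<and> (\<lambda>i. [(\<beta>, i)]) ` Field \<kappa> \<subseteq> tree \<kappa> S"
    by (auto simp: inj_on_def tree_def)
  then have "|Field \<kappa>| \<le>o |tree \<kappa> S|" using card_of_ordLeq by blast
  with 1 have "|tree \<kappa> S| =o |Field \<kappa>|" by (simp add: ordIso_iff_ordLeq)
  then show ?thesis using card_of_Field_ordIso[OF \<kappa>(1)] by (rule ordIso_transitive)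
qed

section \<open>The families\<close>

lemma Pow_ordIso_ctwo_cexp:
  assumes "|A| =o |Field \<kappa>|" shows "|Pow A| =o ctwo ^c \<kappa>"
proof -
  obtain f where "bij_betw f A (Field \<kappa>)" using assms card_of_ordIso by blast
  then have "bij_betw (image f) (Pow A) (Pow (Field \<kappa>))" by (rule bij_betw_Pow)
  then have "|Pow A| =o |Pow (Field \<kappa>)|" by (rule card_of_ordIsoI)
  also have "|Pow (Field \<kappa>)| =o ctwo ^c \<kappa>"
    unfolding ctwo_def cexp_def Field_card_of by (rule card_of_Pow_Func)
  finally show ?thesis .
qed

lemma ordIso_image: "inj_on f A \<Longrightarrow> |A| =o r \<Longrightarrow> |f ` A| =o r"
  by (metis card_of_ordIsoI inj_on_imp_bij_betw ordIso_symmetric ordIso_transitive)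

lemma infinite_cgraph: "infinite S \<Longrightarrow> infinite (cgraph S)"
proof
  assume S: "infinite S" and fin: "finite (cgraph S)"
  have "S \<subseteq> fst ` cgraph S" by (force simp: cgraph_def)
  then show False using S fin finite_subset by blast
qed

lemma countable_card_order_case:
  fixes \<kappa> :: "'k rel"
  assumes \<kappa>: "Card_order \<kappa>" "cinfinite \<kappa>" and cnt: "countable (Field \<kappa>)"
  shows "\<exists>S :: 'k gorder set. |S| =o ctwo ^c \<kappa> \<and>
    (\<forall>A\<in>S. boolean_lattice A \<and> |carrier A| =o \<kappa> \<and> tightly_sigma_filtered A \<and> ba_ccc A) \<and>
    pairwise (\<lambda>A B. \<not> ba_isomorphic A B) S"
proof -
  have inf: "infinite (Field \<kappa>)" using \<kappa>(2) by (simp add: cinfinite_def)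
  have eq: "|A| =o |Field \<kappa>|" if "countable A" "infinite A" for A :: "'c set"
    using bij_betw_trans[OF to_nat_on_infinite[OF that] bij_betw_from_nat_into[OF cnt inf]]
    by (rule card_of_ordIsoI)
  \<comment> \<open>The even numbers make \<open>C R\<close> infinite; the odd ones code
    \<open>R\<close>.\<close>
  define C :: "nat set \<Rightarrow> nat set" where "C = (\<lambda>R. range (\<lambda>n. 2 * n) \<union> (\<lambda>n. 2 * n + 1) ` R)"
  have infC: "infinite (C R)" for R
    unfolding C_def by (simp add: finite_image_iff inj_on_def)
  have injC: "inj_on C UNIV"
  proof (rule inj_onI)
    have mem: "2 * n + 1 \<in> C R \<longleftrightarrow> n \<in> R" for n R
    proof -
      have "2 * n + 1 \<noteq> 2 * m" for m :: nat by presburger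
      then show ?thesis unfolding C_def by (simp add: image_iff)
    qed
    fix R R' assume "C R = C R'"
    then show "R = R'" using mem by blast
  qed
  show ?thesis
  proof (rule family_of_sparse_graphs[OF \<kappa>, of "C ` UNIV"])
    have "|Pow (UNIV :: nat set)| =o ctwo ^c \<kappa>"
      by (intro Pow_ordIso_ctwo_cexp eq) simp_all
    then show "|range C| =o ctwo ^c \<kappa>" using injC by (intro ordIso_image) simp_all
    show "sparse_graph (cgraph S) cedge (\<lambda>g. {h \<in> cgraph S. to_nat h \<le> to_nat g})" for S
      by (rule sparse_graph_cgraph)
    show "|cgraph S| =o \<kappa>" if "S \<in> range C" for S
    proof -
      have "infinite (cgraph S)" using that infC infinite_cgraph by blast
      then have "|cgraph S| =o |Field \<kappa>|" by (intro eq) simp_all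
      then show ?thesis using card_of_Field_ordIso[OF \<kappa>(1)] by (rule ordIso_transitive)
    qed
    show "S = S'" if "S \<in> range C" "S' \<in> range C" "clop_homeo (cgraph S) cedge (cgraph S') cedge \<phi>" for S S' \<phi>
      by (rule clop_homeo_cgraph[OF _ _ that(3)]) (use that(1,2) infC in blast)+
  qed
qed

lemma uncountable_card_order_case:
  fixes \<kappa> :: "'k rel"
  assumes \<kappa>: "Card_order \<kappa>" "cinfinite \<kappa>" and unc: "uncountable (Field \<kappa>)"
  shows "\<exists>S :: 'k gorder set. |S| =o ctwo ^c \<kappa> \<and>
    (\<forall>A\<in>S. boolean_lattice A \<and> |carrier A| =o \<kappa> \<and> tightly_sigma_filtered A \<and> ba_ccc A) \<and>
    pairwise (\<lambda>A B. \<not> ba_isomorphic A B) S"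
proof -
  have wo: "Well_order \<kappa>" using \<kappa>(1) by (rule card_order_on_well_order_on)
  have inf: "infinite (Field \<kappa>)" using \<kappa>(2) by (simp add: cinfinite_def)
  have tot: "a \<in> underS \<kappa> b \<or> b \<in> underS \<kappa> a" if "a \<in> Field \<kappa>" "b \<in> Field \<kappa>" "a \<noteq> b" for a b
  proof -
    have "total_on (Field \<kappa>) \<kappa>" using wo unfolding well_order_on_def linear_order_on_def by blast
    then have "(a, b) \<in> \<kappa> \<or> (b, a) \<in> \<kappa>" using that unfolding total_on_def by blast
    then show ?thesis using that(3) unfolding underS_def by blast
  qed
  \<comment> \<open>\<open>Z\<close> holds the least element. A node with this label is terminal,
    hence invisible, so the sets \<open>S\<close> avoid it.\<close>
  define Z where "Z = {\<beta> \<in> Field \<kappa>. underS \<kappa> \<beta> = {}}"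
  define N where "N = {\<beta> \<in> Field \<kappa>. underS \<kappa> \<beta> \<noteq> {}}"
  have "finite Z"
  proof (cases "Z = {}")
    case False
    then obtain a where "a \<in> Z" by blast
    then have "Z \<subseteq> {a}" using tot unfolding Z_def by blast
    then show ?thesis by (rule finite_subset) simp
  qed simp
  have NZ: "N = Field \<kappa> - Z" by (auto simp: N_def Z_def)
  have infN: "infinite N" unfolding NZ using inf \<open>finite Z\<close> by simp
  obtain a where a: "a \<in> N" using infinite_imp_nonempty[OF infN] by blast
  have "infinite (N - {a})" using infN by simp
  then obtain b where b: "b \<in> N" "b \<noteq> a" using infinite_imp_nonempty by blast
  obtain \<beta>0 \<beta>1 where \<beta>: "\<beta>0 \<in> N" "\<beta>1 \<in> N" "\<beta>0 \<in> underS \<kappa> \<beta>1"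
    using tot[of a b] a b unfolding N_def by blast
  have ne: "\<beta>0 \<noteq> \<beta>1" using \<beta>(3) by (auto simp: underS_def)
  \<comment> \<open>Every set of the family contains \<open>\<beta>1\<close> and omits
    \<open>\<beta>0\<close>, as \<open>clop_homeo_tree\<close> demands. The other nonminimal labels
    are free, and all but finitely many labels remain.\<close>
  define M where "M = Field \<kappa> - (Z \<union> {\<beta>0, \<beta>1})"
  have MN: "M \<subseteq> N" "\<beta>0 \<notin> M" "\<beta>1 \<notin> M" by (auto simp: M_def NZ)
  have "|M| =o |Field \<kappa>|"
    unfolding M_def by (rule card_of_infinite_diff_finite) (use inf \<open>finite Z\<close> in simp_all)
  then have P: "|Pow M| =o ctwo ^c \<kappa>" by (rule Pow_ordIso_ctwo_cexp)
  have injP: "inj_on (insert \<beta>1) (Pow M)"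
    using MN(3) by (auto simp: inj_on_def insert_ident)
  have S: "S \<subseteq> N" "\<beta>1 \<in> S" "\<beta>0 \<notin> S" if "S \<in> insert \<beta>1 ` Pow M" for S
    using that MN \<beta> ne by auto
  have SF: "S \<subseteq> Field \<kappa>" if "S \<in> insert \<beta>1 ` Pow M" for S using S(1)[OF that] by (auto simp: N_def)
  show ?thesis
  proof (rule family_of_sparse_graphs[OF \<kappa>, of "insert \<beta>1 ` Pow M"])
    show "|insert \<beta>1 ` Pow M| =o ctwo ^c \<kappa>" by (rule ordIso_image[OF injP P])
    show "sparse_graph (tree \<kappa> S) tedge (\<lambda>t. {s. suffix s t})" for S by (rule sparse_graph_tree)
    show "|tree \<kappa> S| =o \<kappa>" if "S \<in> insert \<beta>1 ` Pow M" for S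
      by (rule card_of_tree[OF \<kappa> SF[OF that]]) (use S(2)[OF that] in blast)
    show "S = S'" if "S \<in> insert \<beta>1 ` Pow M" "S' \<in> insert \<beta>1 ` Pow M"
      "clop_homeo (tree \<kappa> S) tedge (tree \<kappa> S') tedge \<phi>" for S S' \<phi>
    proof (rule clop_homeo_tree[OF wo unc _ _ \<beta>(3) _ S(2,3)[OF that(1)] that(3)])
      show "S \<subseteq> {\<beta> \<in> Field \<kappa>. underS \<kappa> \<beta> \<noteq> {}}" using S(1)[OF that(1)] unfolding N_def .
      show "S' \<subseteq> {\<beta> \<in> Field \<kappa>. underS \<kappa> \<beta> \<noteq> {}}" using S(1)[OF that(2)] unfolding N_def .
      show "underS \<kappa> \<beta>0 \<noteq> {}" using \<beta>(1) unfolding N_def by blast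
    qed
  qed
qed

theorem theorem3p1:
  fixes \<kappa> :: "'k rel"
  assumes "Card_order \<kappa>" and "cinfinite \<kappa>"
  shows "\<exists>S :: 'k gorder set.
    |S| =o ctwo ^c \<kappa> \<and>
    (\<forall>A\<in>S. boolean_lattice A \<and> |carrier A| =o \<kappa> \<and>
            tightly_sigma_filtered A \<and> ba_ccc A) \<and>
    pairwise (\<lambda>A B. \<not> ba_isomorphic A B) S"
  using countable_card_order_case[OF assms] uncountable_card_order_case[OF assms] by blast

end
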